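(* Let $\Omega\subset\mathbb{R}^2$ be a bounded convex domain that maximizes, among all bounded convex planar domains, one of the two functionals $\|\nabla u\|_{L^\infty(\Omega)}/|\Omega|^{1/2}$ or $\|\nabla u\|_{L^\infty(\Omega)}/\mathcal{H}^1(\partial\Omega)$ (where $u$ is the torsion function of the domain). Then at least one of the following holds: (1) there is no $\varepsilon>0$ for which $\partial\Omega$ is of class $C^{2+\varepsilon}$; or (2) the points of $\partial\Omega$ at which the curvature of $\partial\Omega$ vanishes accumulate at the point of $\partial\Omega$ at which $|\nabla u|$ is maximal; that is, if $p\in\partial\Omega$ is a point with $|\nabla u(p)|=\|\nabla u\|_{L^\infty(\Omega)}$, then every neighborhood of $p$ contains infinitely many points of $\partial\Omega$ of zero curvature.
   Context: For a bounded convex domain $\Omega\subset\mathbb{R}^2$, the torsion function $u$ of $\Omega$ is the unique solution of $-\Delta u=1$ in $\Omega$, $u=0$ on $\partial\Omega$. $|\Omega|$ denotes area and $\mathcal{H}^1(\partial\Omega)$ the length of the boundary. The supremum of $|\nabla u|$ is attained on the boundary. *)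

theory Defs
  imports "HOL-Analysis.Analysis" "HOL-Probability.Essential_Supremum"
begin

definition bounded_convex_domain :: "(real^2) set \<Rightarrow> bool" where
  "bounded_convex_domain \<Omega> \<longleftrightarrow> open \<Omega> \<and> convex \<Omega> \<and> bounded \<Omega> \<and> \<Omega> \<noteq> {}"


text \<open>
  The filter argument allows one-sided gradients at boundary points
  (\<open>at p within closure \<Omega>\<close>). For an open convex \<open>\<Omega>\<close> there is at most one such gradient at
  each point of \<open>closure \<Omega>\<close>. The value is arbitrary where the function is not differentiable.
\<close>

definition grad :: "(real^2 \<Rightarrow> real) \<Rightarrow> (real^2) filter \<Rightarrow> real^2" where
  "grad u F = (THE v. (u has_derivative (\<lambda>h. h \<bullet> v)) F)"

definition divergence :: "(real^2 \<Rightarrow> real^2) \<Rightarrow> real^2 \<Rightarrow> real" where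
  "divergence F x = (\<Sum>i\<in>UNIV. frechet_derivative F (at x) (axis i 1) $ i)"

definition laplacian :: "(real^2 \<Rightarrow> real) \<Rightarrow> real^2 \<Rightarrow> real" where
  "laplacian u = divergence (\<lambda>x. grad u (at x))"

definition C2_on :: "(real^2) set \<Rightarrow> (real^2 \<Rightarrow> real) \<Rightarrow> bool" where
  "C2_on \<Omega> u \<longleftrightarrow>
     (\<forall>x\<in>\<Omega>. u differentiable (at x)) \<and>
     (\<forall>x\<in>\<Omega>. (\<lambda>y. grad u (at y)) differentiable (at x)) \<and>
     (\<forall>h. continuous_on \<Omega> (\<lambda>x. frechet_derivative (\<lambda>y. grad u (at y)) (at x) h))"

text \<open>
  Only the values of \<open>u\<close> on \<open>closure \<Omega>\<close> matter, and these are unique.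
\<close>

definition torsion_function :: "(real^2) set \<Rightarrow> (real^2 \<Rightarrow> real) \<Rightarrow> bool" where
  "torsion_function \<Omega> u \<longleftrightarrow>
     continuous_on (closure \<Omega>) u \<and> C2_on \<Omega> u \<and>
     (\<forall>x\<in>\<Omega>. - laplacian u x = 1) \<and> (\<forall>x\<in>frontier \<Omega>. u x = 0)"

definition Linf_norm :: "(real^2) set \<Rightarrow> (real^2 \<Rightarrow> real^2) \<Rightarrow> ennreal" where
  "Linf_norm \<Omega> F = esssup (lebesgue_on \<Omega>) (\<lambda>x. ennreal (norm (F x)))"

definition grad_norm :: "(real^2) set \<Rightarrow> (real^2 \<Rightarrow> real) \<Rightarrow> ennreal" where
  "grad_norm \<Omega> u = Linf_norm \<Omega> (\<lambda>x. grad u (at x))"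


text \<open>
  One-dimensional Hausdorff measure. No normalising constant occurs in dimension one; the
  boundedness condition is there because \<^const>\<open>diameter\<close> is unspecified on unbounded sets.
\<close>

definition hausdorff1_pre :: "real \<Rightarrow> 'a::metric_space set \<Rightarrow> ennreal" where
  "hausdorff1_pre \<delta> A =
     (INF C \<in> {C :: nat \<Rightarrow> 'a set. A \<subseteq> (\<Union>i. C i) \<and> (\<forall>i. bounded (C i) \<and> diameter (C i) \<le> \<delta>)}.
        \<Sum>i. ennreal (diameter (C i)))"

definition hausdorff1 :: "'a::metric_space set \<Rightarrow> ennreal" where
  "hausdorff1 A = (SUP \<delta>\<in>{0<..}. hausdorff1_pre \<delta> A)"

definition area_functional :: "(real^2) set \<Rightarrow> (real^2 \<Rightarrow> real) \<Rightarrow> ennreal" where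
  "area_functional \<Omega> u = grad_norm \<Omega> u / ennreal (sqrt (measure lebesgue \<Omega>))"

definition perimeter_functional :: "(real^2) set \<Rightarrow> (real^2 \<Rightarrow> real) \<Rightarrow> ennreal" where
  "perimeter_functional \<Omega> u = grad_norm \<Omega> u / hausdorff1 (frontier \<Omega>)"

text \<open>
  The functionals depend on \<open>\<Omega>\<close> alone; the competing torsion function is quantified together
  with its domain.
\<close>

definition maximizes ::
  "((real^2) set \<Rightarrow> (real^2 \<Rightarrow> real) \<Rightarrow> ennreal) \<Rightarrow> (real^2) set \<Rightarrow> (real^2 \<Rightarrow> real) \<Rightarrow> bool" where
  "maximizes J \<Omega> u \<longleftrightarrow>
     (\<forall>\<Omega>' u'. bounded_convex_domain \<Omega>' \<longrightarrow> torsion_function \<Omega>' u' \<longrightarrow> J \<Omega>' u' \<le> J \<Omega> u)"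


definition Ck_on :: "nat \<Rightarrow> real set \<Rightarrow> (real \<Rightarrow> real) \<Rightarrow> bool" where
  "Ck_on k I f \<longleftrightarrow>
     (\<forall>j<k. \<forall>x\<in>I. (deriv ^^ j) f differentiable (at x)) \<and> continuous_on I ((deriv ^^ k) f)"

text \<open>
  The class \<open>C\<^sup>s\<close> for real \<open>s \<ge> 0\<close>, meaning \<open>C\<^bsup>k,\<alpha>\<^esup>\<close> with \<open>k = \<lfloor>s\<rfloor>\<close> and \<open>\<alpha> = s - k\<close>. For integral
  \<open>s\<close> it is \<open>C\<^sup>k\<close> with the \<open>k\<close>-th derivative having bounded oscillation on \<open>I\<close>, so locally just \<open>C\<^sup>k\<close>.
\<close>

definition holder_class :: "real \<Rightarrow> real set \<Rightarrow> (real \<Rightarrow> real) \<Rightarrow> bool" where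
  "holder_class s I f \<longleftrightarrow>
     Ck_on (nat \<lfloor>s\<rfloor>) I f \<and>
     (\<exists>L. \<forall>x\<in>I. \<forall>y\<in>I.
        \<bar>(deriv ^^ nat \<lfloor>s\<rfloor>) f x - (deriv ^^ nat \<lfloor>s\<rfloor>) f y\<bar> \<le> L * \<bar>x - y\<bar> powr (s - \<lfloor>s\<rfloor>))"

text \<open>
  In the orthonormal frame \<open>(a, b)\<close> centred at \<open>p\<close>, the set \<open>\<Omega>\<close> is near \<open>p\<close> the strict
  epigraph of \<open>f\<close>.
\<close>

definition local_graph ::
  "(real^2) set \<Rightarrow> real^2 \<Rightarrow> real^2 \<Rightarrow> real^2 \<Rightarrow> real \<Rightarrow> (real \<Rightarrow> real) \<Rightarrow> bool" where
  "local_graph \<Omega> p a b r f \<longleftrightarrow>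
     r > 0 \<and> norm a = 1 \<and> norm b = 1 \<and> a \<bullet> b = 0 \<and>
     (\<forall>x\<in>ball p r. x \<in> \<Omega> \<longleftrightarrow> f ((x - p) \<bullet> a) < (x - p) \<bullet> b)"

definition boundary_of_class :: "real \<Rightarrow> (real^2) set \<Rightarrow> bool" where
  "boundary_of_class s \<Omega> \<longleftrightarrow>
     (\<forall>p\<in>frontier \<Omega>. \<exists>a b r f. local_graph \<Omega> p a b r f \<and> holder_class s {-r<..<r} f)"

text \<open>
  The boundary is \<open>C\<^sup>2\<close> near the boundary point \<open>p\<close> and has curvature \<open>\<kappa>\<close> there, with the sign that
  makes convex domains have nonnegative curvature. The value of \<open>\<kappa>\<close> does not depend on the
  local graph chosen.
\<close>

definition has_boundary_curvature :: "(real^2) set \<Rightarrow> real^2 \<Rightarrow> real \<Rightarrow> bool" where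
  "has_boundary_curvature \<Omega> p \<kappa> \<longleftrightarrow>
     (\<exists>a b r f. local_graph \<Omega> p a b r f \<and> Ck_on 2 {-r<..<r} f \<and>
        \<kappa> = deriv (deriv f) 0 / sqrt (1 + (deriv f 0)\<^sup>2) ^ 3)"

definition max_gradient_point :: "(real^2) set \<Rightarrow> (real^2 \<Rightarrow> real) \<Rightarrow> real^2 \<Rightarrow> bool" where
  "max_gradient_point \<Omega> u p \<longleftrightarrow>
     p \<in> frontier \<Omega> \<and> u differentiable (at p within closure \<Omega>) \<and>
     ennreal (norm (grad u (at p within closure \<Omega>))) = grad_norm \<Omega> u"

end

theory Submission
  imports Defs "HOL-Complex_Analysis.Complex_Analysis"
begin

text \<open>
  Suppose that the boundary of the maximal domain \<open>\<Omega>\<close> is of class \<open>C\<^bsup>2+\<epsilon>\<^esup>\<close> and that only finitely many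
  boundary points near the point \<open>p\<close> of maximal gradient have zero curvature. Write \<open>G\<close> for the
  maximal value of \<open>|\<nabla> u|\<close>, \<open>n\<close> for the inner normal at \<open>p\<close>, and \<open>Y = (x - p) \<bullet> n\<close> for the height above
  the support line at \<open>p\<close>. A boundary segment would consist of points of zero curvature, so the
  closure of \<open>\<Omega>\<close> meets the support line at \<open>p\<close> only. The contradiction comes from cutting off a small
  cap: the domain \<open>{Y > \<delta>}\<close> inside \<open>\<Omega>\<close> has smaller area and smaller perimeter, but the maximal gradient
  of its torsion function \<open>v\<close> exceeds \<open>G\<close>.

  To see the last point, note that \<open>|\<nabla> u| \<le> G\<close> and \<open>u = 0\<close> on the boundary give \<open>u \<le> G Y\<close>, and that
  \<open>|\<nabla> v| \<le> G\<close> would give \<open>v \<le> G (Y - \<delta>)\<close>. The harmonic function \<open>u - v\<close> is at most \<open>G \<delta>\<close> on the chord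
  \<open>Y = \<delta>\<close> and zero on the rest of the boundary. If the chord lies within distance \<open>a\<close> of \<open>p\<close>, then \<open>u - v\<close>
  has dropped by a fixed fraction at a height comparable to \<open>a\<close>, and by Harnack's inequality it is
  at most \<open>G \<delta> - G \<delta>\<^sup>2 / (12 a)\<close> at the point \<open>x\<^sub>1 = p + 2 \<delta> n\<close>. Conversely, \<open>u\<close> cannot be much smaller than
  \<open>G Y\<close> on the normal: the normal derivative of \<open>u\<close> at \<open>p\<close> equals \<open>G\<close>, the boundary has an interior
  ball at \<open>p\<close>, and Harnack's inequality in such a ball shows \<open>u \<ge> G Y - 3 Y\<^sup>2 / 4\<close> there. Together
  \<open>v(x\<^sub>1) \<ge> G \<delta> + \<delta>\<^sup>2 (G / (12 a) - 3)\<close>, which exceeds \<open>G \<delta> = G (Y - \<delta>)\<close> when \<open>a < G / 36\<close>. Since the support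
  line touches at \<open>p\<close> only, \<open>a\<close> can be taken this small. The argument is in
  \<open>torsion_function_ge_of_interior_ball\<close> and \<open>cut_torsion_function_steep\<close>.

  Maximality speaks about domains together with their torsion functions, so \<open>v\<close> has to exist. Here
  \<open>torsion_function_exists\<close> uses that \<open>u\<close> is a torsion function iff \<open>u + |x|\<^sup>2 / 4\<close> is the real part of a
  holomorphic function, \<open>u\<close> is continuous up to the boundary and vanishes there. The candidate is
  \<open>(H - |x|\<^sup>2) / 4\<close> with \<open>H\<close> the least harmonic majorant of \<open>|x|\<^sup>2\<close>. It is obtained by means of the
  Riemann map and polynomial approximation on the disc, and the support lines of the convex
  domain force the right boundary values.
\<close>

no_notation fps_nth (infixl "$" 75)

section \<open>Holomorphic functions with nonnegative real part\<close>

text \<open>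
  The Cayley transform \<open>w \<mapsto> (w - F 0) / (w + cnj (F 0))\<close> maps the right half-plane to the unit disc and
  \<open>F 0\<close> to \<open>0\<close>, so this is the Schwarz lemma for its composition with \<open>F\<close>.
\<close>

lemma Schwarz_positive_Re:
  assumes holF: "F holomorphic_on ball 0 1"
    and pos: "\<And>z. z \<in> ball 0 1 \<Longrightarrow> Re (F z) > 0"
    and z: "z \<in> ball 0 1"
  shows "norm (F z - F 0) \<le> norm z * norm (F z + cnj (F 0))"
proof -
  have nz: "F w + cnj (F 0) \<noteq> 0" if "w \<in> ball 0 1" for w
  proof -
    have "Re (F w + cnj (F 0)) > 0"
      using pos[OF that] pos[of 0] by simp
    then show ?thesis by force
  qed
  define f where "f = (\<lambda>w. (F w - F 0) / (F w + cnj (F 0)))"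
  have "f holomorphic_on ball 0 1"
    unfolding f_def using nz by (intro holomorphic_intros holF) auto
  moreover have "f 0 = 0" by (simp add: f_def)
  moreover have "norm (f w) < 1" if "norm w < 1" for w
  proof -
    have w: "w \<in> ball 0 1" using that by simp
    have "(norm (F w + cnj (F 0)))\<^sup>2 - (norm (F w - F 0))\<^sup>2 = 4 * Re (F w) * Re (F 0)"
      unfolding cmod_power2 by (simp add: power2_eq_square algebra_simps)
    also have "\<dots> > 0" using pos[OF w] pos[of 0] by simp
    finally have "norm (F w - F 0) < norm (F w + cnj (F 0))"
      by (metis diff_gt_0_iff_gt norm_ge_zero power2_less_imp_less)
    then show ?thesis by (simp add: f_def norm_divide divide_less_eq)
  qed
  ultimately have "norm (f z) \<le> norm z"
    using z by (intro Schwarz_Lemma(1)) auto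
  then show ?thesis
    using nz[OF z] by (simp add: f_def norm_divide divide_le_eq)
qed

lemma Harnack_unit_disc:
  assumes holF: "F holomorphic_on ball 0 1"
    and pos: "\<And>z. z \<in> ball 0 1 \<Longrightarrow> Re (F z) > 0"
    and z: "z \<in> ball 0 1"
  shows "Re (F 0) * (1 - norm z) \<le> Re (F z) * (1 + norm z)"
proof -
  have "(norm (F z - F 0))\<^sup>2 \<le> (norm z * norm (F z + cnj (F 0)))\<^sup>2"
    using Schwarz_positive_Re[OF assms] by (simp add: power_mono)
  then have *: "(Re (F z) - Re (F 0))\<^sup>2 + (Im (F z) - Im (F 0))\<^sup>2
      \<le> (norm z)\<^sup>2 * (Re (F z) + Re (F 0))\<^sup>2 + (norm z)\<^sup>2 * (Im (F z) - Im (F 0))\<^sup>2"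
    by (simp add: cmod_power2 power_mult_distrib algebra_simps)
  have "(norm z)\<^sup>2 \<le> 1" using z by (simp add: power_le_one)
  then have "(norm z)\<^sup>2 * (Im (F z) - Im (F 0))\<^sup>2 \<le> (Im (F z) - Im (F 0))\<^sup>2"
    by (simp add: mult_left_le_one_le)
  with * have "(Re (F z) - Re (F 0))\<^sup>2 \<le> (norm z * (Re (F z) + Re (F 0)))\<^sup>2"
    by (simp add: power_mult_distrib)
  moreover have "0 \<le> norm z * (Re (F z) + Re (F 0))"
    using pos[OF z] pos[of 0] by simp
  ultimately have "\<bar>Re (F z) - Re (F 0)\<bar> \<le> norm z * (Re (F z) + Re (F 0))"
    by (metis abs_le_square_iff abs_of_nonneg)
  then show ?thesis by (simp add: algebra_simps)
qed

text \<open>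
  Nonnegative real parts suffice: add a small positive constant \<open>d\<close> to \<open>F\<close>, apply the strict case on
  the unit disc, and let \<open>d\<close> tend to \<open>0\<close>.
\<close>

lemma Harnack_ball:
  fixes c :: complex
  assumes holF: "F holomorphic_on ball c R" and "R > 0"
    and nonneg: "\<And>z. z \<in> ball c R \<Longrightarrow> Re (F z) \<ge> 0"
    and z: "z \<in> ball c R"
  shows "Re (F c) * (R - dist c z) \<le> Re (F z) * (R + dist c z)"
proof (rule field_le_epsilon)
  fix e :: real assume "e > 0"
  define d where "d = e / (2 * R)"
  have "d > 0" using \<open>e > 0\<close> \<open>R > 0\<close> by (simp add: d_def)
  define f where "f = (\<lambda>w. F (c + of_real R * w) + of_real d)"
  have img: "c + of_real R * w \<in> ball c R" if "w \<in> ball 0 1" for w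
    using that \<open>R > 0\<close> by (simp add: dist_norm norm_mult)
  have "(F \<circ> (\<lambda>w. c + of_real R * w)) holomorphic_on ball 0 1"
    by (rule holomorphic_on_compose_gen[OF _ holF]) (use img in \<open>auto intro!: holomorphic_intros\<close>)
  then have 1: "f holomorphic_on ball 0 1"
    unfolding f_def o_def by (intro holomorphic_intros)
  have 2: "Re (f w) > 0" if "w \<in> ball 0 1" for w
    using nonneg[OF img[OF that]] \<open>d > 0\<close> by (simp add: f_def)
  define w where "w = (z - c) / of_real R"
  have nw: "norm w = dist c z / R"
    using \<open>R > 0\<close> by (simp add: w_def norm_divide dist_norm norm_minus_commute)
  then have "w \<in> ball 0 1" using z \<open>R > 0\<close> by simp
  from Harnack_unit_disc[OF 1 2 this] have "(Re (F c) + d) * (1 - dist c z / R) \<le> (Re (F z) + d) * (1 + dist c z / R)"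
    using \<open>R > 0\<close> unfolding nw by (simp add: f_def w_def)
  then have "R * ((Re (F c) + d) * (1 - dist c z / R)) \<le> R * ((Re (F z) + d) * (1 + dist c z / R))"
    using \<open>R > 0\<close> by (intro mult_left_mono) auto
  moreover have "R * (a * (1 - dist c z / R)) = a * (R - dist c z)"
      "R * (a * (1 + dist c z / R)) = a * (R + dist c z)" for a
    using \<open>R > 0\<close> by (simp_all add: field_simps)
  ultimately have "(Re (F c) + d) * (R - dist c z) \<le> (Re (F z) + d) * (R + dist c z)"
    by simp
  then have "Re (F c) * (R - dist c z) \<le> Re (F z) * (R + dist c z) + 2 * d * dist c z"
    by (simp add: algebra_simps)
  also have "2 * d * dist c z \<le> 2 * d * R"
    using z \<open>d > 0\<close> by simp
  also have "\<dots> = e" using \<open>R > 0\<close> by (simp add: d_def)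
  finally show "Re (F c) * (R - dist c z) \<le> Re (F z) * (R + dist c z) + e" by simp
qed

text \<open>
  Control of the value at the centre alone makes a family of functions with positive real part
  locally bounded; this is the input for Montel's theorem below.
\<close>

lemma norm_le_positive_Re:
  assumes holF: "F holomorphic_on ball 0 1"
    and pos: "\<And>z. z \<in> ball 0 1 \<Longrightarrow> Re (F z) > 0"
    and z: "norm z \<le> r" "r < 1"
  shows "norm (F z) \<le> 2 * norm (F 0) / (1 - r)"
proof -
  have "norm (F z) - norm (F 0) \<le> norm (F z - F 0)" by norm
  also have "\<dots> \<le> norm z * norm (F z + cnj (F 0))"
    using z by (intro Schwarz_positive_Re[OF holF pos]) auto
  also have "\<dots> \<le> norm z * (norm (F z) + norm (F 0))"
    by (intro mult_left_mono order.trans[OF norm_triangle_ineq]) auto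
  also have "\<dots> \<le> r * (norm (F z) + norm (F 0))"
    using z by (intro mult_right_mono) auto
  finally have "norm (F z) * (1 - r) \<le> (1 + r) * norm (F 0)" by (simp add: algebra_simps)
  also have "\<dots> \<le> 2 * norm (F 0)" using z by (intro mult_right_mono) auto
  finally show ?thesis using z by (simp add: field_simps)
qed

text \<open>
  Only the real part is assumed to extend continuously to the boundary. If its minimum over the
  closure is attained inside, then \<open>exp (- F)\<close> has a modulus maximum there and is constant, so the
  minimum is also taken on the boundary.
\<close>

lemma Re_nonneg_max_principle:
  fixes h :: "complex \<Rightarrow> real"
  assumes S: "open S" "connected S" "bounded S"
    and holF: "F holomorphic_on S"
    and hF: "\<And>z. z \<in> S \<Longrightarrow> h z = Re (F z)"
    and cont: "continuous_on (closure S) h"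
    and bd: "\<And>z. z \<in> frontier S \<Longrightarrow> h z \<ge> 0"
    and w: "w \<in> S"
  shows "h w \<ge> 0"
proof -
  have "compact (closure S)" using S by (simp add: compact_closure)
  moreover have ne: "closure S \<noteq> {}" using w closure_subset by blast
  ultimately obtain x where x: "x \<in> closure S" and min: "\<And>y. y \<in> closure S \<Longrightarrow> h x \<le> h y"
    using continuous_attains_inf[OF _ _ cont] by metis
  have "h x \<ge> 0"
  proof (cases "x \<in> S")
    case False
    then show ?thesis using x S bd by (simp add: frontier_def interior_open)
  next
    case True
    define E where "E = (\<lambda>z. exp (- F z))"
    have "E constant_on S"
    proof (rule maximum_modulus_principle[OF _ S(1,2) S(1) order.refl True])
      show "E holomorphic_on S" unfolding E_def by (intro holomorphic_intros holF)
      show "norm (E z) \<le> norm (E x)" if "z \<in> S" for z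
        using min[of z] that closure_subset[of S] hF[OF that] hF[OF True] by (auto simp: E_def)
    qed
    then obtain k where k: "\<And>z. z \<in> S \<Longrightarrow> E z = k" unfolding constant_on_def by blast
    have "h z = h x" if "z \<in> S" for z
    proof -
      have "norm (E z) = norm (E x)" using k that True by simp
      then show ?thesis using hF that True by (simp add: E_def)
    qed
    then have const: "h z = h x" if "z \<in> closure S" for z
      using continuous_constant_on_closure[OF cont _ that, of "h x"] by blast
    have "frontier S \<noteq> {}"
      using S w frontier_eq_empty[of S] by (metis empty_iff not_bounded_UNIV)
    then obtain y where "y \<in> frontier S" by blast
    then show ?thesis using bd[of y] const[of y] by (simp add: frontier_def)
  qed
  then show ?thesis using min[of w] w closure_subset[of S] by force
qed

section \<open>The least harmonic majorant of \<open>|z|\<^sup>2\<close>\<close>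

text \<open>
  On the unit circle \<open>cnj z = 1 / z\<close>, so each product \<open>z ^ n * cnj (z ^ m)\<close> in the expansion of
  \<open>|P z|\<^sup>2\<close> agrees there with a power of \<open>z\<close> or the conjugate of one. This solves the Dirichlet
  problem with boundary data \<open>|P|\<^sup>2\<close> on the disc by a finite sum. Adding an imaginary constant makes
  \<open>H 0\<close> real.
\<close>

lemma harmonic_extension_norm_poly:
  fixes a :: "nat \<Rightarrow> complex"
  obtains H where "H holomorphic_on UNIV" "Im (H 0) = 0"
    "\<And>z. norm z = 1 \<Longrightarrow> Re (H z) = (norm (\<Sum>n<N. a n * z ^ n))\<^sup>2"
proof
  define T where "T = (\<lambda>n m (z::complex). if m \<le> n then a n * cnj (a m) * z ^ (n - m)
                                   else cnj (a n) * a m * z ^ (m - n))"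
  define H where "H = (\<lambda>z. \<Sum>n<N. \<Sum>m<N. T n m z)"
  define H' where "H' = (\<lambda>z. H z - \<i> * of_real (Im (H 0)))"
  have "T n m holomorphic_on UNIV" for n m
    unfolding T_def by (cases "m \<le> n") (simp_all, intro holomorphic_intros, intro holomorphic_intros)
  then have "H holomorphic_on UNIV"
    unfolding H_def by (intro holomorphic_intros) auto
  then show "H' holomorphic_on UNIV" unfolding H'_def by (intro holomorphic_intros)
  show "Im (H' 0) = 0" by (simp add: H'_def)
  fix z :: complex assume z: "norm z = 1"
  have T: "Re (T n m z) = Re ((a n * z ^ n) * cnj (a m * z ^ m))" for n m
  proof (cases "m \<le> n")
    case True
    have "z ^ n * cnj (z ^ m) = z ^ (n - m) * (z * cnj z) ^ m"
      using True by (simp add: power_mult_distrib flip: power_add mult.assoc)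
    then have "z ^ n * cnj (z ^ m) = z ^ (n - m)"
      using z by (simp add: complex_norm_square[symmetric])
    then have "(a n * z ^ n) * cnj (a m * z ^ m) = a n * cnj (a m) * z ^ (n - m)"
      by (simp add: algebra_simps)
    then show ?thesis by (simp only: T_def True if_True)
  next
    case False
    have "cnj (z ^ n) * z ^ m = z ^ (m - n) * (z * cnj z) ^ n"
      using False by (simp add: power_mult_distrib flip: power_add mult.assoc)
    then have "cnj (z ^ n) * z ^ m = z ^ (m - n)"
      using z by (simp add: complex_norm_square[symmetric])
    then have "cnj ((a n * z ^ n) * cnj (a m * z ^ m)) = cnj (a n) * a m * z ^ (m - n)"
      by (simp add: algebra_simps)
    then have "Re (cnj ((a n * z ^ n) * cnj (a m * z ^ m))) = Re (T n m z)"
      by (simp only: T_def False if_False)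
    then show ?thesis by (metis complex_cnj(1) complex_surj cnj.simps(1))
  qed
  have "Re (H' z) = (\<Sum>n<N. \<Sum>m<N. Re ((a n * z ^ n) * cnj (a m * z ^ m)))"
    unfolding H'_def H_def by (simp add: T del: mult.assoc complex_cnj_mult)
  also have "\<dots> = Re ((\<Sum>n<N. a n * z ^ n) * cnj (\<Sum>m<N. a m * z ^ m))"
    by (simp only: sum_product cnj_sum Re_sum)
  finally show "Re (H' z) = (norm (\<Sum>n<N. a n * z ^ n))\<^sup>2"
    by (simp only: complex_norm_square[symmetric] Re_complex_of_real)
qed

lemma Taylor_polynomial_dilation:
  assumes hol: "\<phi> holomorphic_on ball 0 1" and r: "0 < r" "r < 1" and "e > 0"
  obtains a :: "nat \<Rightarrow> complex" and N where
    "\<And>z. z \<in> cball 0 1 \<Longrightarrow> dist (\<Sum>n<N. a n * z ^ n) (\<phi> (of_real r * z)) < e"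
proof -
  define b where "b = (\<lambda>n. (deriv ^^ n) \<phi> 0 / fact n)"
  define a where "a = (\<lambda>n. b n * of_real r ^ n)"
  have sums: "(\<lambda>n. b n * w ^ n) sums \<phi> w" if "w \<in> ball 0 1" for w
    using holomorphic_power_series[OF hol that] by (simp add: b_def)
  define s where "s = (r + 1) / 2"
  have s: "r < s" "s < 1" "0 < s" using r by (auto simp: s_def)
  have "summable (\<lambda>n. norm (b n * of_real r ^ n))"
  proof (rule powser_insidea[where x = "of_real s"])
    show "summable (\<lambda>n. b n * of_real s ^ n)" using sums[of "of_real s"] s by (auto simp: sums_iff)
    show "norm (of_real r :: complex) < norm (of_real s :: complex)" using r s by simp
  qed
  then have summ: "summable (\<lambda>n. norm (a n))" by (simp add: a_def)
  have "uniform_limit (cball 0 1) (\<lambda>N z. \<Sum>n<N. a n * z ^ n) (\<lambda>z. \<Sum>n. a n * z ^ n) sequentially"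
    by (rule Weierstrass_m_test[OF _ summ])
       (auto simp: norm_mult norm_power intro!: mult_left_le power_le_one)
  then have "\<forall>\<^sub>F N in sequentially. \<forall>z\<in>cball 0 1. dist (\<Sum>n<N. a n * z ^ n) (\<Sum>n. a n * z ^ n) < e"
    using \<open>e > 0\<close> by (simp add: uniform_limit_iff)
  then obtain N where N: "\<And>z. z \<in> cball 0 1 \<Longrightarrow> dist (\<Sum>n<N. a n * z ^ n) (\<Sum>n. a n * z ^ n) < e"
    unfolding eventually_sequentially by blast
  have "(\<Sum>n. a n * z ^ n) = \<phi> (of_real r * z)" if "z \<in> cball 0 1" for z
  proof -
    have "r * norm z < 1" using r that by (smt (verit) mem_cball_0 mult_left_le)
    then have "(\<lambda>n. b n * (of_real r * z) ^ n) sums \<phi> (of_real r * z)"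
      using r by (intro sums) (simp add: norm_mult)
    then show ?thesis by (simp add: a_def power_mult_distrib mult.assoc sums_iff)
  qed
  then show ?thesis using N that by metis
qed

text \<open>
  The polynomial \<open>P\<close> is chosen close enough to the compact set \<open>\<phi> ` cball 0 r\<close> to keep its values
  inside \<open>S\<close>; then functions on \<open>S\<close> can be composed with \<open>P\<close> up to the boundary of the disc.
\<close>

lemma inner_approximation_disc:
  assumes hol: "\<phi> holomorphic_on ball 0 1" and S: "open S" "\<phi> ` ball 0 1 \<subseteq> S"
    and r: "0 < r" "r < 1" and "e > 0"
  obtains P H where "P holomorphic_on UNIV" "H holomorphic_on UNIV" "Im (H 0) = 0"
    "\<And>z. norm z = 1 \<Longrightarrow> Re (H z) = (norm (P z))\<^sup>2"
    "\<And>z. z \<in> cball 0 1 \<Longrightarrow> P z \<in> S \<and> dist (P z) (\<phi> (of_real r * z)) < e"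
proof -
  have sub: "(\<lambda>z. of_real r * z) ` cball 0 1 \<subseteq> ball (0::complex) 1"
    using r by (auto simp: norm_mult) (smt (verit) mult_left_le)
  have "continuous_on (cball 0 1) (\<phi> \<circ> (\<lambda>z. of_real r * z))"
    by (intro continuous_on_compose continuous_intros
        continuous_on_subset[OF holomorphic_on_imp_continuous_on[OF hol] sub])
  then have "compact ((\<phi> \<circ> (\<lambda>z. of_real r * z)) ` cball 0 1)"
    by (intro compact_continuous_image) auto
  moreover have "(\<phi> \<circ> (\<lambda>z. of_real r * z)) ` cball 0 1 \<subseteq> S"
    using sub S by auto
  ultimately obtain d where d: "d > 0" "(\<Union>x\<in>(\<phi> \<circ> (\<lambda>z. of_real r * z)) ` cball 0 1. ball x d) \<subseteq> S"
    using compact_subset_open_imp_ball_epsilon_subset \<open>open S\<close> by metis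
  obtain a N where a: "\<And>z. z \<in> cball 0 1 \<Longrightarrow> dist (\<Sum>n<N. a n * z ^ n) (\<phi> (of_real r * z)) < min d e"
    using Taylor_polynomial_dilation[OF hol r, of "min d e"] d \<open>e > 0\<close> by (metis min_less_iff_conj)
  obtain H where H: "H holomorphic_on UNIV" "Im (H 0) = 0"
    "\<And>z. norm z = 1 \<Longrightarrow> Re (H z) = (norm (\<Sum>n<N. a n * z ^ n))\<^sup>2"
    using harmonic_extension_norm_poly by blast
  show ?thesis
  proof
    show "(\<lambda>z. \<Sum>n<N. a n * z ^ n) holomorphic_on UNIV" by (intro holomorphic_intros)
    show "(\<Sum>n<N. a n * z ^ n) \<in> S \<and> dist (\<Sum>n<N. a n * z ^ n) (\<phi> (of_real r * z)) < e"
      if "z \<in> cball 0 1" for z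
      using d(2) a[OF that] that by (fastforce simp: dist_commute)
  qed (use H in auto)
qed

lemma Re_nonneg_max_principle_disc:
  assumes "continuous_on (cball 0 1) F" "F holomorphic_on ball 0 1"
    and "\<And>z. norm z = 1 \<Longrightarrow> Re (F z) \<ge> 0" and "w \<in> ball 0 1"
  shows "Re (F w) \<ge> 0"
  by (rule Re_nonneg_max_principle[where S = "ball 0 1" and F = F])
     (use assms in \<open>auto simp: closure_ball frontier_ball dist_norm intro!: continuous_intros\<close>)

text \<open>
  Take polynomials \<open>P k \<longlonglongrightarrow> \<phi>\<close> with values in \<open>S\<close> and the harmonic functions \<open>Re (H k)\<close> with boundary
  values \<open>|P k|\<^sup>2\<close>. The maximum principle gives \<open>|P k|\<^sup>2 \<le> Re (H k) \<le> Re (q \<circ> P k)\<close> for every harmonic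
  majorant \<open>Re q\<close> of \<open>|z|\<^sup>2\<close> on \<open>S\<close>, and Montel's theorem allows passing to the limit. The boundary
  behaviour of \<open>\<phi>\<close> itself never has to be studied.
\<close>

lemma least_harmonic_majorant_disc:
  assumes hol: "\<phi> holomorphic_on ball 0 1" and S: "open S" "bounded S" "\<phi> ` ball 0 1 \<subseteq> S"
  obtains H where "H holomorphic_on ball 0 1"
    "\<And>z. z \<in> ball 0 1 \<Longrightarrow> (norm (\<phi> z))\<^sup>2 \<le> Re (H z)"
    "\<And>q z. q holomorphic_on S \<Longrightarrow> (\<And>w. w \<in> S \<Longrightarrow> (norm w)\<^sup>2 \<le> Re (q w)) \<Longrightarrow> z \<in> ball 0 1
       \<Longrightarrow> Re (H z) \<le> Re (q (\<phi> z))"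
proof -
  define r where "r = (\<lambda>k. 1 - 1 / real (Suc (Suc k)))"
  have r: "0 < r k" "r k < 1" for k by (auto simp: r_def)
  have "\<forall>k. \<exists>P H. P holomorphic_on UNIV \<and> H holomorphic_on UNIV \<and> Im (H 0) = 0 \<and>
    (\<forall>z. norm z = 1 \<longrightarrow> Re (H z) = (norm (P z))\<^sup>2) \<and>
    (\<forall>z\<in>cball 0 1. P z \<in> S \<and> dist (P z) (\<phi> (of_real (r k) * z)) < 1 / Suc k)"
    using inner_approximation_disc[OF hol S(1,3) r] by (smt (verit) divide_pos_pos of_nat_0_less_iff zero_less_Suc)
  then obtain P H where holP: "\<And>k. P k holomorphic_on UNIV" and holH: "\<And>k. H k holomorphic_on UNIV"
    and Im0: "\<And>k. Im (H k 0) = 0"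
    and bd: "\<And>k z. norm z = 1 \<Longrightarrow> Re (H k z) = (norm (P k z))\<^sup>2"
    and PS: "\<And>k z. z \<in> cball 0 1 \<Longrightarrow> P k z \<in> S"
    and Pd: "\<And>k z. z \<in> cball 0 1 \<Longrightarrow> dist (P k z) (\<phi> (of_real (r k) * z)) < 1 / Suc k"
    by metis
  have contP: "continuous_on A (P k)" and contH: "continuous_on A (H k)"
    and holP': "P k holomorphic_on A" and holH': "H k holomorphic_on A" for A k
    using holP[of k] holH[of k]
    by (auto intro: continuous_on_subset holomorphic_on_imp_continuous_on holomorphic_on_subset)
  have lower: "(norm (P k z))\<^sup>2 \<le> Re (H k z)" if z: "z \<in> ball 0 1" for k z
  proof -
    \<comment> \<open>The tangent plane of the convex function \<open>|w|\<^sup>2\<close> at \<open>P k z\<close> bounds it from below and is the real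
      part of a polynomial in \<open>w\<close>, so its composition with \<open>P k\<close> can be compared with \<open>H k\<close>.\<close>
    define F where "F = (\<lambda>w. H k w - 2 * P k w * cnj (P k z) + of_real ((norm (P k z))\<^sup>2))"
    have "Re (F z) \<ge> 0"
    proof (rule Re_nonneg_max_principle_disc[OF _ _ _ z])
      show "continuous_on (cball 0 1) F" "F holomorphic_on ball 0 1"
        unfolding F_def by (intro continuous_intros contP contH holomorphic_intros holP' holH')+
      fix w :: complex assume "norm w = 1"
      then have "Re (F w) = (norm (P k w - P k z))\<^sup>2"
        unfolding F_def by (simp add: bd, simp only: cmod_power2) (simp add: power2_eq_square algebra_simps)
      then show "Re (F w) \<ge> 0" by simp
    qed
    moreover have "Re (F z) = Re (H k z) - (norm (P k z))\<^sup>2"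
      unfolding F_def by (simp, simp only: cmod_power2) (simp add: power2_eq_square algebra_simps)
    ultimately show ?thesis by simp
  qed
  have upper: "Re (H k z) \<le> Re (q (P k z))"
    if q: "q holomorphic_on S" "\<And>w. w \<in> S \<Longrightarrow> (norm w)\<^sup>2 \<le> Re (q w)" and z: "z \<in> ball 0 1" for q k z
  proof -
    have "Re (q (P k z) - H k z) \<ge> 0"
    proof (rule Re_nonneg_max_principle_disc[where F = "\<lambda>z. q (P k z) - H k z", OF _ _ _ z])
      have "continuous_on (cball 0 1) (q \<circ> P k)"
        by (intro continuous_on_compose contP continuous_on_subset[OF holomorphic_on_imp_continuous_on[OF q(1)]])
           (use PS in auto)
      then show "continuous_on (cball 0 1) (\<lambda>z. q (P k z) - H k z)"
        unfolding o_def by (intro continuous_intros contH)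
      have "(q \<circ> P k) holomorphic_on ball 0 1"
        by (rule holomorphic_on_compose_gen[OF holP' q(1)]) (use PS in auto)
      then show "(\<lambda>z. q (P k z) - H k z) holomorphic_on ball 0 1"
        unfolding o_def by (intro holomorphic_intros holH')
      show "Re (q (P k w) - H k w) \<ge> 0" if "norm w = 1" for w
        using q(2)[OF PS[of w]] that by (simp add: bd)
    qed
    then show ?thesis by simp
  qed
  obtain M where M: "\<And>w. w \<in> S \<Longrightarrow> norm w \<le> M" using S(2) by (auto simp: bounded_iff)
  have H0: "Re (H k 0) \<le> M\<^sup>2" for k
    using upper[of "\<lambda>_. of_real (M\<^sup>2)" 0 k] M by (auto simp: power_mono)
  have Hbd: "norm (H k z + 1) \<le> 2 * (M\<^sup>2 + 1) / (1 - \<rho>)" if z: "norm z \<le> \<rho>" "\<rho> < 1" for k z \<rho>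
  proof -
    have pos: "Re (H k w) \<ge> 0" if "w \<in> ball 0 1" for w using lower[OF that, of k] by (smt (verit) zero_le_power2)
    \<comment> \<open>The summand \<open>1\<close> makes the real part strictly positive.\<close>
    have "norm (H k z + 1) \<le> 2 * norm (H k 0 + 1) / (1 - \<rho>)"
    proof (rule norm_le_positive_Re[where F = "\<lambda>z. H k z + 1", OF _ _ z])
      show "(\<lambda>z. H k z + 1) holomorphic_on ball 0 1" by (intro holomorphic_intros holH')
      show "0 < Re (H k w + 1)" if "w \<in> ball 0 1" for w using pos[OF that] by simp
    qed
    also have "norm (H k 0 + 1) = Re (H k 0) + 1"
      using pos[of 0] Im0[of k] by (simp add: cmod_def)
    also have "2 * (Re (H k 0) + 1) / (1 - \<rho>) \<le> 2 * (M\<^sup>2 + 1) / (1 - \<rho>)"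
      using z H0[of k] by (intro divide_right_mono) auto
    finally show ?thesis .
  qed
  obtain h \<sigma> where h: "h holomorphic_on ball 0 1" "strict_mono (\<sigma> :: nat \<Rightarrow> nat)"
    and lim: "\<And>z. z \<in> ball 0 1 \<Longrightarrow> (\<lambda>n. H (\<sigma> n) z) \<longlonglongrightarrow> h z"
  proof (rule Montel[of "ball 0 1" "range H" H])
    show "\<exists>B. \<forall>h\<in>range H. \<forall>z\<in>K. norm (h z) \<le> B" if K: "compact K" "K \<subseteq> ball 0 1" for K
    proof -
      have "\<exists>\<rho><1. \<forall>z\<in>K. norm z \<le> \<rho>"
      proof (cases "K = {}")
        case False
        obtain x where "x \<in> K" "\<And>y. y \<in> K \<Longrightarrow> norm y \<le> norm x"
          using continuous_attains_sup[OF K(1) False, of norm] by (auto intro: continuous_intros)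
        then show ?thesis using K(2) by (intro exI[of _ "norm x"]) auto
      qed (auto intro: exI[of _ 0])
      then obtain \<rho> where \<rho>: "\<rho> < 1" "\<And>z. z \<in> K \<Longrightarrow> norm z \<le> \<rho>" by blast
      have "norm (H k z) \<le> 2 * (M\<^sup>2 + 1) / (1 - \<rho>) + 1" if "z \<in> K" for k z
        using Hbd[OF \<rho>(2)[OF that] \<rho>(1), of k] norm_triangle_ineq4[of "H k z + 1" 1] by simp
      then show ?thesis by blast
    qed
  qed (use holH' in auto)
  have limP: "(\<lambda>n. P (\<sigma> n) z) \<longlonglongrightarrow> \<phi> z" if z: "z \<in> ball 0 1" for z
  proof -
    have "r \<longlonglongrightarrow> 1 - 0"
      unfolding r_def by (intro tendsto_diff tendsto_const LIMSEQ_Suc[OF LIMSEQ_Suc[OF lim_1_over_n]])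
    then have "(\<lambda>k. of_real (r k) * z) \<longlonglongrightarrow> of_real (1 - 0) * z"
      by (intro tendsto_mult tendsto_of_real tendsto_const)
    then have "(\<lambda>k. of_real (r k) * z) \<longlonglongrightarrow> z" by simp
    moreover have "isCont \<phi> z"
      using holomorphic_on_imp_continuous_on[OF hol] z by (simp add: continuous_on_eq_continuous_at)
    ultimately have 1: "(\<lambda>k. \<phi> (of_real (r k) * z)) \<longlonglongrightarrow> \<phi> z"
      by (rule isCont_tendsto_compose[rotated])
    have "(\<lambda>k. P k z - \<phi> (of_real (r k) * z)) \<longlonglongrightarrow> 0"
    proof (rule Lim_null_comparison[OF _ LIMSEQ_Suc[OF lim_1_over_n]])
      show "\<forall>\<^sub>F k in sequentially. norm (P k z - \<phi> (of_real (r k) * z)) \<le> 1 / real (Suc k)"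
        using Pd[of z] z by (auto simp: dist_norm less_imp_le)
    qed
    from tendsto_add[OF this 1] have "(\<lambda>k. P k z) \<longlonglongrightarrow> \<phi> z" by simp
    then show ?thesis using LIMSEQ_subseq_LIMSEQ[OF _ h(2)] by (auto simp: o_def)
  qed
  show ?thesis
  proof
    show "h holomorphic_on ball 0 1" by fact
    show "(norm (\<phi> z))\<^sup>2 \<le> Re (h z)" if z: "z \<in> ball 0 1" for z
      by (rule LIMSEQ_le[OF tendsto_power[OF tendsto_norm[OF limP[OF z]]] tendsto_Re[OF lim[OF z]]])
         (use lower[OF z] in auto)
    show "Re (h z) \<le> Re (q (\<phi> z))"
      if q: "q holomorphic_on S" "\<And>w. w \<in> S \<Longrightarrow> (norm w)\<^sup>2 \<le> Re (q w)" and z: "z \<in> ball 0 1" for q z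
    proof -
      have "\<phi> z \<in> S" using S(3) z by blast
      then have "isCont q (\<phi> z)"
        using holomorphic_on_imp_continuous_on[OF q(1)] S(1) by (simp add: continuous_on_eq_continuous_at)
      then have "(\<lambda>n. q (P (\<sigma> n) z)) \<longlonglongrightarrow> q (\<phi> z)"
        using limP[OF z] by (rule isCont_tendsto_compose)
      from LIMSEQ_le[OF tendsto_Re[OF lim[OF z]] tendsto_Re[OF this]] upper[OF q z]
      show ?thesis by auto
    qed
  qed
qed

text \<open>
  The Riemann map transports the majorant from the disc to \<open>S\<close>.
\<close>

lemma least_harmonic_majorant:
  assumes S: "open S" "simply_connected S" "bounded S" "S \<noteq> {}"
  obtains h where "h holomorphic_on S"
    "\<And>z. z \<in> S \<Longrightarrow> (norm z)\<^sup>2 \<le> Re (h z)"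
    "\<And>q z. q holomorphic_on S \<Longrightarrow> (\<And>w. w \<in> S \<Longrightarrow> (norm w)\<^sup>2 \<le> Re (q w)) \<Longrightarrow> z \<in> S
       \<Longrightarrow> Re (h z) \<le> Re (q z)"
proof -
  have "S \<noteq> UNIV" using S(3) not_bounded_UNIV by auto
  then obtain f g where f: "f holomorphic_on S" and g: "g holomorphic_on ball 0 1"
    and fg: "\<And>z. z \<in> S \<Longrightarrow> f z \<in> ball 0 1 \<and> g (f z) = z"
      "\<And>z. z \<in> ball 0 1 \<Longrightarrow> g z \<in> S \<and> f (g z) = z"
    using Riemann_mapping_theorem[of S] S by metis
  obtain H where H: "H holomorphic_on ball 0 1"
    "\<And>z. z \<in> ball 0 1 \<Longrightarrow> (norm (g z))\<^sup>2 \<le> Re (H z)"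
    "\<And>q z. q holomorphic_on S \<Longrightarrow> (\<And>w. w \<in> S \<Longrightarrow> (norm w)\<^sup>2 \<le> Re (q w)) \<Longrightarrow> z \<in> ball 0 1
       \<Longrightarrow> Re (H z) \<le> Re (q (g z))"
    by (rule least_harmonic_majorant_disc[OF g S(1,3)]) (use fg in auto)
  show ?thesis
  proof
    show "(H \<circ> f) holomorphic_on S"
      by (rule holomorphic_on_compose_gen[OF f H(1)]) (use fg in auto)
    show "(norm z)\<^sup>2 \<le> Re ((H \<circ> f) z)" if "z \<in> S" for z
      using H(2)[of "f z"] fg(1)[OF that] by simp
    show "Re ((H \<circ> f) z) \<le> Re (q z)"
      if "q holomorphic_on S" "\<And>w. w \<in> S \<Longrightarrow> (norm w)\<^sup>2 \<le> Re (q w)" "z \<in> S" for q z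
      using H(3)[of q "f z"] fg(1)[OF that(3)] that by simp
  qed
qed

section \<open>The plane as the complex numbers\<close>

definition cplx :: "real^2 \<Rightarrow> complex" where "cplx x = Complex (x $ 1) (x $ 2)"

definition vec2 :: "complex \<Rightarrow> real^2" where "vec2 z = vector [Re z, Im z]"

lemma cplx_simps [simp]: "Re (cplx x) = x $ 1" "Im (cplx x) = x $ 2"
  by (simp_all add: cplx_def)

lemma vec2_simps [simp]: "vec2 z $ 1 = Re z" "vec2 z $ 2 = Im z"
  by (simp_all add: vec2_def)

lemma cplx_vec2 [simp]: "cplx (vec2 z) = z"
  by (simp add: complex_eq_iff)

lemma vec2_cplx [simp]: "vec2 (cplx x) = x"
  by (simp add: vec_eq_iff forall_2)

lemma linear_cplx: "linear cplx" and linear_vec2: "linear vec2"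
  by (auto intro!: linearI simp: complex_eq_iff vec_eq_iff forall_2)

lemma bounded_linear_cplx: "bounded_linear cplx" and bounded_linear_vec2: "bounded_linear vec2"
  using linear_cplx linear_vec2 by (simp_all add: linear_conv_bounded_linear)

lemma bij_cplx: "bij cplx"
  by (rule bijI') (metis vec2_cplx, metis cplx_vec2)

lemma inner_vec2: "x \<bullet> y = x $ 1 * y $ 1 + x $ 2 * (y :: real^2) $ 2"
  by (simp add: inner_vec_def sum_2)

lemma norm_cplx [simp]: "norm (cplx x) = norm x"
  by (simp add: cmod_def norm_eq_sqrt_inner inner_vec2 power2_eq_square)

lemma norm_vec2 [simp]: "norm (vec2 z) = norm z"
  by (metis cplx_vec2 norm_cplx)

lemma cplx_diff: "cplx (x - y) = cplx x - cplx y" and cplx_add: "cplx (x + y) = cplx x + cplx y"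
  and cplx_scaleR: "cplx (c *\<^sub>R x) = c *\<^sub>R cplx x"
  using linear_cplx by (simp_all add: linear_diff linear_add linear_cmul)

lemma dist_cplx [simp]: "dist (cplx x) (cplx y) = dist x y"
  by (simp add: dist_norm flip: cplx_diff)

lemma cplx_image_eq_vimage: "cplx ` S = vec2 -` S"
  by (auto simp: image_iff) (metis cplx_vec2)

lemma mem_cplx_image [simp]: "z \<in> cplx ` S \<longleftrightarrow> vec2 z \<in> S"
  by (simp add: cplx_image_eq_vimage)

lemma open_cplx_image: "open S \<Longrightarrow> open (cplx ` S)"
  using open_bijective_linear_image_eq[OF linear_cplx bij_cplx] by simp

lemma closure_cplx_image: "closure (cplx ` S) = cplx ` closure S"
  using closure_injective_linear_image[OF linear_cplx bij_is_inj[OF bij_cplx]] by metis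

lemma frontier_cplx_image: "frontier (cplx ` S) = cplx ` frontier S"
  using interior_bijective_linear_image[OF linear_cplx bij_cplx, of S]
  by (simp add: frontier_def closure_cplx_image image_set_diff[OF bij_is_inj[OF bij_cplx]])

lemma cplx_image_ball: "cplx ` ball c R = ball (cplx c) R"
  by (auto simp: cplx_image_eq_vimage dist_norm simp flip: norm_cplx cplx_diff) (metis cplx_diff cplx_vec2 norm_cplx)+

lemma convex_cplx_image: "convex S \<Longrightarrow> convex (cplx ` S)"
  by (rule convex_linear_image[OF linear_cplx])

lemma bounded_cplx_image: "bounded S \<Longrightarrow> bounded (cplx ` S)"
  by (rule bounded_linear_image[OF _ bounded_linear_cplx])

lemma inner_eq_Re_cplx: "x \<bullet> y = Re (cplx x * cnj (cplx y))"
  by (simp add: inner_vec2)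

section \<open>Harmonic functions in the plane\<close>

text \<open>
  On the convex sets considered here every harmonic function is the real part of a holomorphic
  function. Taking this as the definition gives direct access to the theorems of complex analysis.
\<close>

definition harmonic_on :: "(real^2 \<Rightarrow> real) \<Rightarrow> (real^2) set \<Rightarrow> bool" where
  "harmonic_on h S \<longleftrightarrow> (\<exists>F. F holomorphic_on cplx ` S \<and> (\<forall>x\<in>S. h x = Re (F (cplx x))))"

lemma harmonic_on_subset: "harmonic_on h S \<Longrightarrow> T \<subseteq> S \<Longrightarrow> harmonic_on h T"
  unfolding harmonic_on_def by (meson holomorphic_on_subset image_mono subsetD)

lemma harmonic_on_add: "harmonic_on h S \<Longrightarrow> harmonic_on k S \<Longrightarrow> harmonic_on (\<lambda>x. h x + k x) S"
  unfolding harmonic_on_def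
proof (elim exE conjE)
  fix F G assume *: "F holomorphic_on cplx ` S" "\<forall>x\<in>S. h x = Re (F (cplx x))"
    "G holomorphic_on cplx ` S" "\<forall>x\<in>S. k x = Re (G (cplx x))"
  show "\<exists>H. H holomorphic_on cplx ` S \<and> (\<forall>x\<in>S. h x + k x = Re (H (cplx x)))"
    by (rule exI[of _ "\<lambda>z. F z + G z"]) (use * in \<open>auto intro!: holomorphic_intros\<close>)
qed

lemma harmonic_on_cmult: "harmonic_on h S \<Longrightarrow> harmonic_on (\<lambda>x. c * h x) S"
  unfolding harmonic_on_def
proof (elim exE conjE)
  fix F assume *: "F holomorphic_on cplx ` S" "\<forall>x\<in>S. h x = Re (F (cplx x))"
  show "\<exists>H. H holomorphic_on cplx ` S \<and> (\<forall>x\<in>S. c * h x = Re (H (cplx x)))"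
    by (rule exI[of _ "\<lambda>z. of_real c * F z"]) (use * in \<open>auto intro!: holomorphic_intros\<close>)
qed

lemma harmonic_on_diff: "harmonic_on h S \<Longrightarrow> harmonic_on k S \<Longrightarrow> harmonic_on (\<lambda>x. h x - k x) S"
  using harmonic_on_add[OF _ harmonic_on_cmult[of k S "-1"], of h] by simp

lemma harmonic_on_const: "harmonic_on (\<lambda>x. c) S"
  unfolding harmonic_on_def by (rule exI[of _ "\<lambda>z. of_real c"]) auto

lemma harmonic_on_inner: "harmonic_on (\<lambda>x. x \<bullet> v) S"
  unfolding harmonic_on_def inner_eq_Re_cplx
  by (rule exI[of _ "\<lambda>z. z * cnj (cplx v)"]) (auto intro!: holomorphic_intros)

lemmas harmonic_intros = harmonic_on_add harmonic_on_diff harmonic_on_cmult harmonic_on_const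
  harmonic_on_inner

lemma harmonic_max_principle:
  assumes S: "open S" "convex S" "bounded S" and h: "harmonic_on h S"
    and cont: "continuous_on (closure S) h" and bd: "\<And>x. x \<in> frontier S \<Longrightarrow> h x \<ge> 0"
    and x: "x \<in> S"
  shows "h x \<ge> 0"
proof -
  obtain F where F: "F holomorphic_on cplx ` S" "\<And>x. x \<in> S \<Longrightarrow> h x = Re (F (cplx x))"
    using h unfolding harmonic_on_def by blast
  have "(h \<circ> vec2) (cplx x) \<ge> 0"
  proof (rule Re_nonneg_max_principle[OF open_cplx_image[OF S(1)] _ bounded_cplx_image[OF S(3)] F(1)])
    show "connected (cplx ` S)" using S(2) by (intro convex_connected convex_cplx_image)
    show "continuous_on (closure (cplx ` S)) (h \<circ> vec2)"
      unfolding closure_cplx_image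
      by (intro continuous_on_compose linear_continuous_on[OF bounded_linear_vec2]) (simp add: image_image cont)
    show "0 \<le> (h \<circ> vec2) z" if "z \<in> frontier (cplx ` S)" for z
      using that bd by (simp add: frontier_cplx_image)
  qed (use F(2) x in auto)
  then show ?thesis by simp
qed

lemma harmonic_Harnack:
  assumes h: "harmonic_on h (ball c R)" and "R > 0"
    and nonneg: "\<And>x. x \<in> ball c R \<Longrightarrow> h x \<ge> 0" and x: "x \<in> ball c R"
  shows "h c * (R - dist c x) \<le> h x * (R + dist c x)"
proof -
  obtain F where F: "F holomorphic_on ball (cplx c) R" "\<And>x. x \<in> ball c R \<Longrightarrow> h x = Re (F (cplx x))"
    using h unfolding harmonic_on_def cplx_image_ball by blast
  have "Re (F (cplx c)) * (R - dist (cplx c) (cplx x)) \<le> Re (F (cplx x)) * (R + dist (cplx c) (cplx x))"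
  proof (rule Harnack_ball[OF F(1) \<open>R > 0\<close>])
    show "Re (F z) \<ge> 0" if "z \<in> ball (cplx c) R" for z
    proof -
      have "vec2 z \<in> ball c R" using that unfolding cplx_image_ball[symmetric] by simp
      then show ?thesis using nonneg[of "vec2 z"] F(2)[of "vec2 z"] by simp
    qed
  qed (use x in simp)
  then show ?thesis using F(2)[of c] F(2)[OF x] \<open>R > 0\<close> by simp
qed

section \<open>Gradients and second derivatives\<close>

lemma has_derivative_ray_tendsto:
  fixes f :: "'a::real_normed_vector \<Rightarrow> real"
  assumes f: "(f has_derivative f') (at p within S)"
    and S: "\<And>t. 0 < t \<Longrightarrow> t < e \<Longrightarrow> p + t *\<^sub>R d \<in> S" and "e > 0"
  shows "((\<lambda>t. (f (p + t *\<^sub>R d) - f p) / t) \<longlongrightarrow> f' d) (at_right 0)"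
proof -
  have "at p within (insert p S) = at p within S"
    by (simp add: at_within_def)
  with f have f1: "(f has_derivative f') (at p within (insert p S))"
    by (simp add: has_derivative_def)
  have sub: "(\<lambda>t. p + t *\<^sub>R d) ` {0..<e} \<subseteq> insert p S"
  proof
    fix y assume "y \<in> (\<lambda>t. p + t *\<^sub>R d) ` {0..<e}"
    then obtain t where t: "0 \<le> t" "t < e" "y = p + t *\<^sub>R d" by auto
    then show "y \<in> insert p S" using S[of t] by (cases "t = 0") auto
  qed
  have "((\<lambda>t. p + t *\<^sub>R d) has_derivative (\<lambda>t. t *\<^sub>R d)) (at 0 within {0..<e})"
    by (auto intro!: derivative_eq_intros)
  moreover have "(f has_derivative f') (at (p + 0 *\<^sub>R d) within ((\<lambda>t. p + t *\<^sub>R d) ` {0..<e}))"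
    using has_derivative_subset[OF f1 sub] by simp
  ultimately have "((\<lambda>t. f (p + t *\<^sub>R d)) has_derivative (\<lambda>t. f' (t *\<^sub>R d))) (at 0 within {0..<e})"
    by (rule has_derivative_in_compose)
  moreover have "(\<lambda>t. f' (t *\<^sub>R d)) = (*) (f' d)"
    using has_derivative_linear[OF f] by (auto simp: linear_cmul)
  ultimately have "((\<lambda>t. f (p + t *\<^sub>R d)) has_field_derivative f' d) (at 0 within {0..<e})"
    by (simp add: has_field_derivative_def)
  then have "((\<lambda>t. (f (p + t *\<^sub>R d) - f p) / t) \<longlongrightarrow> f' d) (at 0 within {0..<e})"
    by (simp add: has_field_derivative_iff)
  moreover have "at 0 within {0..<e} = at_right (0::real)"
    using \<open>e > 0\<close> by (intro at_within_nhd[of 0 "{..<e}"]) auto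
  ultimately show ?thesis by simp
qed

lemma gradient_exists:
  fixes f :: "real^2 \<Rightarrow> real"
  assumes "f differentiable F"
  shows "\<exists>v. (f has_derivative (\<lambda>h. h \<bullet> v)) F"
proof -
  obtain f' where f': "(f has_derivative f') F" using assms by (auto simp: differentiable_def)
  have lin: "linear f'" using f' by (rule has_derivative_linear)
  have "f' h = h \<bullet> vector [f' (axis 1 1), f' (axis 2 1)]" for h
  proof -
    have "h = h $ 1 *\<^sub>R axis 1 1 + h $ 2 *\<^sub>R axis 2 1"
      by (simp add: vec_eq_iff forall_2 axis_def)
    then have "f' h = f' (h $ 1 *\<^sub>R axis 1 1 + h $ 2 *\<^sub>R axis 2 1)"
      by (rule arg_cong)
    also have "\<dots> = h $ 1 * f' (axis 1 1) + h $ 2 * f' (axis 2 1)"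
      using lin by (simp add: linear_add linear_cmul)
    finally show ?thesis by (simp add: inner_vec2)
  qed
  then have "f' = (\<lambda>h. h \<bullet> vector [f' (axis 1 1), f' (axis 2 1)])" by blast
  then show ?thesis using f' by metis
qed

lemma grad_eq:
  assumes "(u has_derivative (\<lambda>h. h \<bullet> v)) (at x)"
  shows "grad u (at x) = v"
  unfolding grad_def
proof (rule the_equality)
  show "(u has_derivative (\<lambda>h. h \<bullet> v)) (at x)" by fact
  fix w assume "(u has_derivative (\<lambda>h. h \<bullet> w)) (at x)"
  then have "(\<lambda>h. h \<bullet> w) = (\<lambda>h. h \<bullet> v)" using assms has_derivative_unique by blast
  then show "w = v" by (metis vector_eq_ldot)
qed

lemma has_derivative_grad:
  assumes "u differentiable (at x)"
  shows "(u has_derivative (\<lambda>h. h \<bullet> grad u (at x))) (at x)"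
  using gradient_exists[OF assms] grad_eq by metis

text \<open>
  Uniqueness of the one-sided gradient: two candidates agree on all directions \<open>y - p\<close> with \<open>y\<close> in
  \<open>\<Omega>\<close>, and these form an open set.
\<close>

lemma has_derivative_grad_closure:
  assumes \<Omega>: "open \<Omega>" "convex \<Omega>" "\<Omega> \<noteq> {}" and p: "p \<in> closure \<Omega>"
    and u: "u differentiable (at p within closure \<Omega>)"
  shows "(u has_derivative (\<lambda>h. h \<bullet> grad u (at p within closure \<Omega>))) (at p within closure \<Omega>)"
proof -
  have uniq: "v = w" if v: "(u has_derivative (\<lambda>h. h \<bullet> v)) (at p within closure \<Omega>)"
    and w: "(u has_derivative (\<lambda>h. h \<bullet> w)) (at p within closure \<Omega>)" for v w
  proof -
    have eq: "(y - p) \<bullet> (v - w) = 0" if y: "y \<in> \<Omega>" for y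
    proof -
      have "p + t *\<^sub>R (y - p) \<in> closure \<Omega>" if "0 < t" "t < 1" for t
      proof -
        have "(1 - t) *\<^sub>R p + t *\<^sub>R y \<in> closure \<Omega>"
          using p y closure_subset[of \<Omega>] convex_closure[OF \<Omega>(2)] that by (intro convexD) auto
        then show ?thesis by (simp add: algebra_simps)
      qed
      then have "(y - p) \<bullet> v = (y - p) \<bullet> w"
        using has_derivative_ray_tendsto[OF v, of 1 "y - p"] has_derivative_ray_tendsto[OF w, of 1 "y - p"]
        by (intro tendsto_unique[of "at_right (0::real)"]) auto
      then show ?thesis by (simp add: inner_diff_right)
    qed
    obtain y e where y: "y \<in> \<Omega>" and e: "e > 0" "ball y e \<subseteq> \<Omega>"
      using \<Omega>(1,3) by (meson ex_in_conv openE)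
    define s where "s = e / (2 * (norm (v - w) + 1))"
    have s: "s > 0" using e(1) unfolding s_def by (intro divide_pos_pos) (auto simp: add_nonneg_pos)
    have "s * norm (v - w) < e"
      using e(1) by (simp add: s_def divide_less_eq add_nonneg_pos)
    then have "y + s *\<^sub>R (v - w) \<in> \<Omega>"
      using e s by (intro subsetD[OF e(2)]) (simp add: dist_norm norm_minus_commute[of "s *\<^sub>R v"])
    from eq[OF this] eq[OF y] have "s * ((v - w) \<bullet> (v - w)) = 0"
      by (simp add: inner_diff_left inner_add_left algebra_simps)
    then show ?thesis using s by simp
  qed
  obtain v where v: "(u has_derivative (\<lambda>h. h \<bullet> v)) (at p within closure \<Omega>)"
    using gradient_exists[OF u] by blast
  have "grad u (at p within closure \<Omega>) = v"
    unfolding grad_def by (rule the_equality) (use v uniq[OF _ v] in blast)+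
  then show ?thesis using v by simp
qed

text \<open>
  The mean value theorem turns the second difference quotient into a first difference of the
  gradient in the direction \<open>h\<close>. The quotient is symmetric in \<open>h\<close> and \<open>k\<close>, so both orders have the
  same limit, which yields the symmetry of the second derivative.
\<close>

lemma second_difference_estimate:
  fixes u :: "real^2 \<Rightarrow> real"
  assumes "open S" "x \<in> S"
    and u: "\<And>y. y \<in> S \<Longrightarrow> (u has_derivative (\<lambda>h. h \<bullet> g y)) (at y)"
    and g: "(g has_derivative A) (at x)" and "e > 0" and hk: "norm h = 1" "norm k = 1"
  shows "\<exists>d>0. \<forall>t. 0 < t \<and> t < d \<longrightarrow>
    \<bar>(u (x + t *\<^sub>R h + t *\<^sub>R k) - u (x + t *\<^sub>R h) - u (x + t *\<^sub>R k) + u x) / t\<^sup>2 - A h \<bullet> k\<bar> \<le> e"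
proof -
  have linA: "linear A" using g by (rule has_derivative_linear)
  obtain r where r: "r > 0" "ball x r \<subseteq> S" using \<open>open S\<close> \<open>x \<in> S\<close> by (meson openE)
  have "e / 3 > 0" using \<open>e > 0\<close> by simp
  then obtain d where d: "d > 0"
    and gd: "\<And>y. norm (y - x) < d \<Longrightarrow> norm (g y - g x - A (y - x)) \<le> e / 3 * norm (y - x)"
    using g unfolding has_derivative_at_alt by meson
  show ?thesis
  proof (intro exI[of _ "min r d / 3"] conjI allI impI)
    show "0 < min r d / 3" using r d by simp
    fix t assume t: "0 < t \<and> t < min r d / 3"
    define q where "q = (\<lambda>\<tau>. u (x + \<tau> *\<^sub>R k + t *\<^sub>R h) - u (x + \<tau> *\<^sub>R k))"
    have n1: "norm (\<tau> *\<^sub>R k + t *\<^sub>R h) \<le> 2 * t" "norm (\<tau> *\<^sub>R k) \<le> t" if "0 \<le> \<tau>" "\<tau> \<le> t" for \<tau>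
      using that t norm_triangle_ineq[of "\<tau> *\<^sub>R k" "t *\<^sub>R h"] hk by auto
    have inS: "x + v \<in> S" if "norm v \<le> 2 * t" for v
      using that t by (intro subsetD[OF r(2)]) (simp add: dist_norm)
    have "(q has_real_derivative k \<bullet> (g (x + \<tau> *\<^sub>R k + t *\<^sub>R h) - g (x + \<tau> *\<^sub>R k))) (at \<tau>)"
      if "0 \<le> \<tau>" "\<tau> \<le> t" for \<tau>
    proof -
      have "((\<lambda>\<tau>. u (x + \<tau> *\<^sub>R k + t *\<^sub>R h)) has_derivative (\<lambda>s. (s *\<^sub>R k) \<bullet> g (x + \<tau> *\<^sub>R k + t *\<^sub>R h))) (at \<tau>)"
        by (rule has_derivative_compose[OF _ u])
           (use inS[of "\<tau> *\<^sub>R k + t *\<^sub>R h"] n1(1)[OF that] in \<open>auto intro!: derivative_eq_intros simp: add.assoc\<close>)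
      moreover have "((\<lambda>\<tau>. u (x + \<tau> *\<^sub>R k)) has_derivative (\<lambda>s. (s *\<^sub>R k) \<bullet> g (x + \<tau> *\<^sub>R k))) (at \<tau>)"
        by (rule has_derivative_compose[OF _ u])
           (use inS[of "\<tau> *\<^sub>R k"] n1(2)[OF that] t in \<open>auto intro!: derivative_eq_intros\<close>)
      ultimately have "(q has_derivative (\<lambda>s. (s *\<^sub>R k) \<bullet> g (x + \<tau> *\<^sub>R k + t *\<^sub>R h) - (s *\<^sub>R k) \<bullet> g (x + \<tau> *\<^sub>R k))) (at \<tau>)"
        unfolding q_def by (rule has_derivative_diff)
      then show ?thesis
        by (rule has_derivative_imp_has_field_derivative) (simp add: inner_diff_right algebra_simps)
    qed
    then obtain \<tau> where \<tau>: "0 < \<tau>" "\<tau> < t"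
      and q: "q t - q 0 = (t - 0) * (k \<bullet> (g (x + \<tau> *\<^sub>R k + t *\<^sub>R h) - g (x + \<tau> *\<^sub>R k)))"
      using MVT2[of 0 t q "\<lambda>\<tau>. k \<bullet> (g (x + \<tau> *\<^sub>R k + t *\<^sub>R h) - g (x + \<tau> *\<^sub>R k))"] t by auto
    define D where "D = g (x + \<tau> *\<^sub>R k + t *\<^sub>R h) - g (x + \<tau> *\<^sub>R k) - t *\<^sub>R A h"
    have lin_err: "norm (g (x + v) - g x - A v) \<le> e / 3 * s" if "norm v \<le> s" "s \<le> 2 * t" for v s
    proof -
      have "norm (g (x + v) - g x - A v) \<le> e / 3 * norm v"
        using gd[of "x + v"] that t by simp
      also have "\<dots> \<le> e / 3 * s" using that \<open>e > 0\<close> by (intro mult_left_mono) auto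
      finally show ?thesis .
    qed
    have e1: "norm (g (x + (\<tau> *\<^sub>R k + t *\<^sub>R h)) - g x - A (\<tau> *\<^sub>R k + t *\<^sub>R h)) \<le> e / 3 * (2 * t)"
      using n1(1)[of \<tau>] \<tau> by (intro lin_err) auto
    have e2: "norm (g (x + \<tau> *\<^sub>R k) - g x - A (\<tau> *\<^sub>R k)) \<le> e / 3 * t"
      using n1(2)[of \<tau>] \<tau> by (intro lin_err) auto
    have "D = (g (x + (\<tau> *\<^sub>R k + t *\<^sub>R h)) - g x - A (\<tau> *\<^sub>R k + t *\<^sub>R h)) - (g (x + \<tau> *\<^sub>R k) - g x - A (\<tau> *\<^sub>R k))"
      using linA by (simp add: D_def linear_add linear_cmul algebra_simps)
    then have "norm D \<le> e / 3 * (2 * t) + e / 3 * t"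
      using e1 e2 by (simp only: order.trans[OF norm_triangle_ineq4 add_mono])
    then have nD: "norm D \<le> e * t" by (simp add: algebra_simps)
    have "u (x + t *\<^sub>R h + t *\<^sub>R k) - u (x + t *\<^sub>R h) - u (x + t *\<^sub>R k) + u x = q t - q 0"
      by (simp add: q_def algebra_simps)
    also have "\<dots> = t * (t * (A h \<bullet> k) + k \<bullet> D)"
      unfolding q D_def by (simp add: inner_diff_right inner_commute algebra_simps)
    finally have "(u (x + t *\<^sub>R h + t *\<^sub>R k) - u (x + t *\<^sub>R h) - u (x + t *\<^sub>R k) + u x) / t\<^sup>2 - A h \<bullet> k
        = (k \<bullet> D) / t"
      using t by (simp add: field_simps power2_eq_square)
    moreover have "\<bar>k \<bullet> D\<bar> \<le> e * t" using Cauchy_Schwarz_ineq2[of k D] hk nD by simp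
    ultimately show "\<bar>(u (x + t *\<^sub>R h + t *\<^sub>R k) - u (x + t *\<^sub>R h) - u (x + t *\<^sub>R k) + u x) / t\<^sup>2 - A h \<bullet> k\<bar> \<le> e"
      using t by (simp add: abs_divide divide_le_eq)
  qed
qed

lemma second_derivative_symmetric:
  fixes u :: "real^2 \<Rightarrow> real"
  assumes "open S" "x \<in> S"
    and u: "\<And>y. y \<in> S \<Longrightarrow> (u has_derivative (\<lambda>h. h \<bullet> g y)) (at y)"
    and g: "(g has_derivative A) (at x)" and hk: "norm h = 1" "norm k = 1"
  shows "A h \<bullet> k = A k \<bullet> h"
proof -
  have "\<bar>A h \<bullet> k - A k \<bullet> h\<bar> \<le> 0"
  proof (rule field_le_epsilon)
    fix e :: real assume "e > 0"
    then have "e / 2 > 0" by simp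
    obtain d1 where d1: "d1 > 0" "\<And>t. 0 < t \<Longrightarrow> t < d1 \<Longrightarrow>
      \<bar>(u (x + t *\<^sub>R h + t *\<^sub>R k) - u (x + t *\<^sub>R h) - u (x + t *\<^sub>R k) + u x) / t\<^sup>2 - A h \<bullet> k\<bar> \<le> e / 2"
      using second_difference_estimate[OF assms(1-4) \<open>e / 2 > 0\<close> hk] by blast
    obtain d2 where d2: "d2 > 0" "\<And>t. 0 < t \<Longrightarrow> t < d2 \<Longrightarrow>
      \<bar>(u (x + t *\<^sub>R k + t *\<^sub>R h) - u (x + t *\<^sub>R k) - u (x + t *\<^sub>R h) + u x) / t\<^sup>2 - A k \<bullet> h\<bar> \<le> e / 2"
      using second_difference_estimate[OF assms(1-4) \<open>e / 2 > 0\<close> hk(2,1)] by blast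
    define t where "t = min d1 d2 / 2"
    have t: "0 < t" "t < d1" "t < d2" using d1 d2 by (auto simp: t_def)
    have eq: "u (x + t *\<^sub>R k + t *\<^sub>R h) - u (x + t *\<^sub>R k) - u (x + t *\<^sub>R h) + u x
        = u (x + t *\<^sub>R h + t *\<^sub>R k) - u (x + t *\<^sub>R h) - u (x + t *\<^sub>R k) + u x"
      by (simp add: algebra_simps)
    show "\<bar>A h \<bullet> k - A k \<bullet> h\<bar> \<le> 0 + e"
      using d1(2)[OF t(1,2)] d2(2)[OF t(1,3), unfolded eq] by linarith
  qed
  then show ?thesis by simp
qed

section \<open>Torsion functions and harmonic functions\<close>

text \<open>
  The functions \<open>|x - c|\<^sup>2\<close> and \<open>|x|\<^sup>2\<close> differ by an affine function, which is harmonic.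
\<close>

lemma torsion_harmonic_shift:
  assumes "harmonic_on (\<lambda>x. u x + (norm x)\<^sup>2 / 4) S"
  shows "harmonic_on (\<lambda>x. u x + (norm (x - c))\<^sup>2 / 4) S"
proof -
  have "harmonic_on (\<lambda>x. (u x + (norm x)\<^sup>2 / 4) - 1 / 2 * (x \<bullet> c) + (norm c)\<^sup>2 / 4) S"
    by (intro harmonic_intros assms)
  moreover have "u x + (norm (x - c))\<^sup>2 / 4 = (u x + (norm x)\<^sup>2 / 4) - 1 / 2 * (x \<bullet> c) + (norm c)\<^sup>2 / 4" for x
    by (simp add: power2_norm_eq_inner inner_diff_left inner_diff_right inner_commute)
  ultimately show ?thesis by (simp only:)
qed

text \<open>
  The equation \<open>\<Delta> u = -1\<close> and the symmetry of the second derivative are the Cauchy-Riemann equations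
  for the complex gradient \<open>f\<close> of \<open>u + |x|\<^sup>2 / 4\<close>. On a convex set \<open>f\<close> has a primitive, whose real part
  has the same gradient as \<open>u + |x|\<^sup>2 / 4\<close>.
\<close>

lemma torsion_function_imp_harmonic:
  assumes \<Omega>: "open \<Omega>" "convex \<Omega>" and u: "torsion_function \<Omega> u"
  shows "harmonic_on (\<lambda>x. u x + (norm x)\<^sup>2 / 4) \<Omega>"
proof -
  define g where "g = (\<lambda>x. grad u (at x))"
  have ug: "(u has_derivative (\<lambda>h. h \<bullet> g x)) (at x)" if "x \<in> \<Omega>" for x
    using u that has_derivative_grad unfolding torsion_function_def C2_on_def g_def by blast
  define A where "A = (\<lambda>x. frechet_derivative g (at x))"
  have gA: "(g has_derivative A x) (at x)" if "x \<in> \<Omega>" for x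
    using u that unfolding torsion_function_def C2_on_def g_def A_def frechet_derivative_works by blast
  have linA: "linear (A x)" if "x \<in> \<Omega>" for x
    using gA[OF that] by (rule has_derivative_linear)
  have tr: "A x (axis 1 1) $ 1 + A x (axis 2 1) $ 2 = -1" if "x \<in> \<Omega>" for x
    using u that unfolding torsion_function_def laplacian_def divergence_def A_def g_def
    by (auto simp: sum_2)
  have sym: "A x (axis 1 1) $ 2 = A x (axis 2 1) $ 1" if "x \<in> \<Omega>" for x
    using second_derivative_symmetric[OF \<Omega>(1) that ug gA[OF that], of "axis 1 1" "axis 2 1"]
    by (simp add: inner_axis)
  have Ak: "A x k = k $ 1 *\<^sub>R A x (axis 1 1) + k $ 2 *\<^sub>R A x (axis 2 1)" if "x \<in> \<Omega>" for x k
  proof -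
    have "k = k $ 1 *\<^sub>R axis 1 1 + k $ 2 *\<^sub>R axis 2 1"
      by (simp add: vec_eq_iff forall_2 axis_def)
    then have "A x k = A x (k $ 1 *\<^sub>R axis 1 1 + k $ 2 *\<^sub>R axis 2 1)" by (rule arg_cong)
    also have "\<dots> = k $ 1 *\<^sub>R A x (axis 1 1) + k $ 2 *\<^sub>R A x (axis 2 1)"
      using linA[OF that] by (simp add: linear_add linear_cmul)
    finally show ?thesis .
  qed
  define f where "f = (\<lambda>z. cnj (cplx (g (vec2 z))) + cnj z / 2)"
  define S where "S = cplx ` \<Omega>"
  have S: "open S" "convex S" using \<Omega> by (simp_all add: S_def open_cplx_image convex_cplx_image)
  have "(f has_field_derivative Complex (A x (axis 1 1) $ 1 + 1 / 2) (- A x (axis 1 1) $ 2)) (at z)"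
    if z: "z \<in> S" and x: "x = vec2 z" for z x
  proof -
    have x\<Omega>: "x \<in> \<Omega>" using z x by (simp add: S_def)
    have "((\<lambda>z. g (vec2 z)) has_derivative (\<lambda>k. A x (vec2 k))) (at z)"
      using bounded_linear_imp_has_derivative[OF bounded_linear_vec2] gA[OF x\<Omega>] unfolding x
      by (rule has_derivative_compose)
    then have "(f has_derivative (\<lambda>k. cnj (cplx (A x (vec2 k))) + cnj k / 2)) (at z)"
      unfolding f_def
      by (intro has_derivative_add bounded_linear.has_derivative[OF bounded_linear_cnj]
          bounded_linear.has_derivative[OF bounded_linear_cplx])
         (auto intro!: derivative_eq_intros)
    moreover have "cnj (cplx (A x (vec2 k))) + cnj k / 2
        = Complex (A x (axis 1 1) $ 1 + 1 / 2) (- A x (axis 1 1) $ 2) * k" for k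
    proof -
      have d: "A x (axis 2 1) $ 2 = -1 - A x (axis 1 1) $ 1" using tr[OF x\<Omega>] by simp
      show ?thesis
        unfolding Ak[OF x\<Omega>, of "vec2 k"] by (simp add: complex_eq_iff sym[OF x\<Omega>, symmetric] d algebra_simps)
    qed
    ultimately show ?thesis by (simp add: has_field_derivative_def)
  qed
  then have "f holomorphic_on S" using S(1) by (auto simp: holomorphic_on_open)
  then obtain F where F: "\<And>z. z \<in> S \<Longrightarrow> (F has_field_derivative f z) (at z)"
    using holomorphic_convex_primitive'[OF S(2,1)] S(1) by (metis at_within_open)
  define d where "d = (\<lambda>z. u (vec2 z) + (norm z)\<^sup>2 / 4 - Re (F z))"
  have "(d has_derivative (\<lambda>h. 0)) (at z within S)" if z: "z \<in> S" for z
  proof -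
    have x\<Omega>: "vec2 z \<in> \<Omega>" using z by (simp add: S_def)
    have 1: "((\<lambda>z. u (vec2 z)) has_derivative (\<lambda>k. vec2 k \<bullet> g (vec2 z))) (at z)"
      using bounded_linear_imp_has_derivative[OF bounded_linear_vec2] ug[OF x\<Omega>]
      by (rule has_derivative_compose)
    have 2: "((\<lambda>z. Re (F z)) has_derivative (\<lambda>k. Re (f z * k))) (at z)"
      using F[OF z] unfolding has_field_derivative_def
      by (rule bounded_linear.has_derivative[OF bounded_linear_Re])
    have 3: "((\<lambda>z::complex. (norm z)\<^sup>2 / 4) has_derivative (\<lambda>k. z \<bullet> k / 2)) (at z)"
      unfolding power2_norm_eq_inner by (auto intro!: derivative_eq_intros simp: inner_commute)
    have "(d has_derivative (\<lambda>k. vec2 k \<bullet> g (vec2 z) + z \<bullet> k / 2 - Re (f z * k))) (at z)"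
      unfolding d_def by (intro has_derivative_add has_derivative_diff 1 2 3)
    moreover have "vec2 k \<bullet> g (vec2 z) + z \<bullet> k / 2 - Re (f z * k) = 0" for k
      by (simp add: f_def inner_vec2 inner_complex_def algebra_simps)
    ultimately show ?thesis by (simp add: has_derivative_at_withinI)
  qed
  then obtain c where c: "\<And>z. z \<in> S \<Longrightarrow> d z = c"
    using has_derivative_zero_constant[OF S(2)] by blast
  show ?thesis
    unfolding harmonic_on_def
  proof (intro exI conjI ballI)
    show "(\<lambda>z. F z + of_real c) holomorphic_on cplx ` \<Omega>"
      using F S(1) unfolding S_def[symmetric]
      by (intro holomorphic_intros) (auto simp: holomorphic_on_open)
    show "u x + (norm x)\<^sup>2 / 4 = Re (F (cplx x) + of_real c)" if "x \<in> \<Omega>" for x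
      using c[of "cplx x"] that by (simp add: d_def S_def)
  qed
qed

lemma C2_on_and_laplacian_of_harmonic:
  assumes "open \<Omega>" and harm: "harmonic_on (\<lambda>x. u x + (norm x)\<^sup>2 / 4) \<Omega>"
  shows "C2_on \<Omega> u" and "x \<in> \<Omega> \<Longrightarrow> - laplacian u x = 1"
proof -
  obtain F where F: "F holomorphic_on cplx ` \<Omega>"
    and uF: "\<And>x. x \<in> \<Omega> \<Longrightarrow> u x = Re (F (cplx x)) - (norm x)\<^sup>2 / 4"
    using harm unfolding harmonic_on_def by (metis add_diff_cancel_right')
  have opn: "open (cplx ` \<Omega>)" using assms(1) by (rule open_cplx_image)
  define v where "v = (\<lambda>x. vec2 (cnj (deriv F (cplx x))) - (1/2) *\<^sub>R x)"
  define A where "A = (\<lambda>x k. vec2 (cnj (deriv (deriv F) (cplx x) * cplx k)) - (1/2) *\<^sub>R k)"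
  have du: "(u has_derivative (\<lambda>h. h \<bullet> v x)) (at x)" if x: "x \<in> \<Omega>" for x
  proof -
    have "(F has_derivative (\<lambda>h. deriv F (cplx x) * h)) (at (cplx x))"
      using holomorphic_derivI[OF F opn] x by (simp add: has_field_derivative_def)
    then have "((\<lambda>y. Re (F (cplx y))) has_derivative (\<lambda>k. Re (deriv F (cplx x) * cplx k))) (at x)"
      by (intro bounded_linear.has_derivative[OF bounded_linear_Re]
          has_derivative_compose[OF bounded_linear_imp_has_derivative[OF bounded_linear_cplx]])
    moreover have "((\<lambda>y. (norm y)\<^sup>2 / 4) has_derivative (\<lambda>k. x \<bullet> k / 2)) (at x)"
      unfolding power2_norm_eq_inner by (auto intro!: derivative_eq_intros simp: inner_commute)
    ultimately have "((\<lambda>y. Re (F (cplx y)) - (norm y)\<^sup>2 / 4) has_derivative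
        (\<lambda>k. Re (deriv F (cplx x) * cplx k) - x \<bullet> k / 2)) (at x)"
      by (rule has_derivative_diff)
    moreover have "Re (deriv F (cplx x) * cplx k) - x \<bullet> k / 2 = k \<bullet> v x" for k
      by (simp add: v_def inner_vec2 algebra_simps)
    ultimately have "((\<lambda>y. Re (F (cplx y)) - (norm y)\<^sup>2 / 4) has_derivative (\<lambda>k. k \<bullet> v x)) (at x)"
      by simp
    then show ?thesis
      by (rule has_derivative_transform_within_open[OF _ assms(1) x]) (simp add: uF)
  qed
  then have gv: "grad u (at x) = v x" if "x \<in> \<Omega>" for x
    using that by (intro grad_eq) auto
  have dv: "((\<lambda>y. grad u (at y)) has_derivative A x) (at x)" if x: "x \<in> \<Omega>" for x
  proof -
    have "(deriv F has_derivative (\<lambda>h. deriv (deriv F) (cplx x) * h)) (at (cplx x))"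
      using holomorphic_derivI[OF holomorphic_deriv[OF F opn] opn] x by (simp add: has_field_derivative_def)
    then have "((\<lambda>y. deriv F (cplx y)) has_derivative (\<lambda>k. deriv (deriv F) (cplx x) * cplx k)) (at x)"
      by (intro has_derivative_compose[OF bounded_linear_imp_has_derivative[OF bounded_linear_cplx]])
    then have "(v has_derivative A x) (at x)"
      unfolding v_def A_def
      by (intro has_derivative_diff bounded_linear.has_derivative[OF bounded_linear_vec2]
          bounded_linear.has_derivative[OF bounded_linear_cnj] has_derivative_scaleR_right has_derivative_ident)
    then show ?thesis
      by (rule has_derivative_transform_within_open[OF _ assms(1) x]) (simp add: gv)
  qed
  have fA: "frechet_derivative (\<lambda>y. grad u (at y)) (at x) = A x" if "x \<in> \<Omega>" for x
    using frechet_derivative_at[OF dv[OF that]] by simp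
  show "C2_on \<Omega> u"
    unfolding C2_on_def
  proof (intro conjI ballI allI)
    show "u differentiable (at x)" if "x \<in> \<Omega>" for x
      using du[OF that] by (auto simp: differentiable_def)
    show "(\<lambda>y. grad u (at y)) differentiable (at x)" if "x \<in> \<Omega>" for x
      using dv[OF that] by (auto simp: differentiable_def)
    have "continuous_on (cplx ` \<Omega>) (deriv (deriv F))"
      by (intro holomorphic_on_imp_continuous_on holomorphic_deriv F opn)
    then have "continuous_on \<Omega> (\<lambda>x. deriv (deriv F) (cplx x))"
      by (rule continuous_on_compose2) (auto intro: linear_continuous_on[OF bounded_linear_cplx])
    then have "continuous_on \<Omega> (\<lambda>x. A x k)" for k
      unfolding A_def
      by (intro continuous_intros bounded_linear.continuous_on[OF bounded_linear_vec2])
    then show "continuous_on \<Omega> (\<lambda>x. frechet_derivative (\<lambda>y. grad u (at y)) (at x) k)" for k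
      by (rule continuous_on_eq) (simp add: fA)
  qed
  show "- laplacian u x = 1" if "x \<in> \<Omega>"
    unfolding laplacian_def divergence_def fA[OF that]
    by (simp add: sum_2 A_def axis_def)
qed

lemma torsion_function_iff_harmonic:
  assumes "open \<Omega>" "convex \<Omega>"
  shows "torsion_function \<Omega> u \<longleftrightarrow> continuous_on (closure \<Omega>) u \<and>
    harmonic_on (\<lambda>x. u x + (norm x)\<^sup>2 / 4) \<Omega> \<and> (\<forall>x\<in>frontier \<Omega>. u x = 0)"
  using torsion_function_imp_harmonic[OF assms] C2_on_and_laplacian_of_harmonic[OF assms(1)]
  unfolding torsion_function_def by blast

lemma support_line:
  assumes \<Omega>: "open \<Omega>" "convex \<Omega>" "\<Omega> \<noteq> {}" and p: "p \<in> frontier (\<Omega> :: (real^2) set)"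
  obtains n where "norm n = 1" "\<And>x. x \<in> closure \<Omega> \<Longrightarrow> (x - p) \<bullet> n \<ge> 0"
proof -
  have "p \<in> closure \<Omega>" "p \<notin> rel_interior \<Omega>"
    using p \<Omega> by (auto simp: frontier_def rel_interior_open interior_open)
  then obtain a where a: "a \<noteq> 0" "\<And>x. x \<in> closure \<Omega> \<Longrightarrow> a \<bullet> p \<le> a \<bullet> x"
    using supporting_hyperplane_rel_boundary[OF convex_closure[OF \<Omega>(2)]]
      convex_rel_interior_closure[OF \<Omega>(2)] by metis
  show ?thesis
  proof
    show "norm (a /\<^sub>R norm a) = 1" using a by simp
    show "(x - p) \<bullet> (a /\<^sub>R norm a) \<ge> 0" if "x \<in> closure \<Omega>" for x
      using a(2)[OF that] by (simp add: inner_commute[of _ a] inner_diff_right)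
  qed
qed

text \<open>
  If \<open>H\<close> is the least harmonic majorant of \<open>|z|\<^sup>2\<close>, then \<open>(H - |z|\<^sup>2) / 4\<close> is nonnegative and satisfies
  the differential equation. It tends to \<open>0\<close> at a boundary point \<open>p\<close> because the support line at \<open>p\<close>
  provides a competing majorant that touches \<open>|z|\<^sup>2\<close> at \<open>p\<close>.
\<close>

lemma torsion_function_exists:
  assumes "bounded_convex_domain \<Omega>"
  shows "\<exists>v. torsion_function \<Omega> v"
proof -
  have \<Omega>: "open \<Omega>" "convex \<Omega>" "bounded \<Omega>" "\<Omega> \<noteq> {}"
    using assms by (auto simp: bounded_convex_domain_def)
  define S where "S = cplx ` \<Omega>"
  have S: "open S" "simply_connected S" "bounded S" "S \<noteq> {}"
    using \<Omega> by (auto simp: S_def intro!: open_cplx_image bounded_cplx_image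
        convex_imp_simply_connected convex_cplx_image)
  obtain H where H: "H holomorphic_on S"
    and maj: "\<And>z. z \<in> S \<Longrightarrow> (norm z)\<^sup>2 \<le> Re (H z)"
    and least: "\<And>q z. q holomorphic_on S \<Longrightarrow> (\<And>w. w \<in> S \<Longrightarrow> (norm w)\<^sup>2 \<le> Re (q w)) \<Longrightarrow> z \<in> S
       \<Longrightarrow> Re (H z) \<le> Re (q z)"
    by (rule least_harmonic_majorant[OF S]) blast
  define v where "v = (\<lambda>x. if x \<in> \<Omega> then (Re (H (cplx x)) - (norm x)\<^sup>2) / 4 else 0)"
  have nonneg: "v x \<ge> 0" for x
    using maj[of "cplx x"] by (auto simp: v_def S_def)
  obtain D where D: "D > 0" "\<And>x y. x \<in> \<Omega> \<Longrightarrow> y \<in> closure \<Omega> \<Longrightarrow> norm (x - y) \<le> D"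
  proof -
    obtain B where B: "B > 0" "\<And>x. x \<in> closure \<Omega> \<Longrightarrow> norm x \<le> B"
      using \<Omega>(3) bounded_closure[of \<Omega>] bounded_pos by metis
    have "norm (x - y) \<le> 2 * B" if "x \<in> \<Omega>" "y \<in> closure \<Omega>" for x y
      using B(2)[of x] B(2)[of y] that closure_subset[of \<Omega>] norm_triangle_ineq4[of x y] by force
    then show ?thesis using that[of "2 * B"] B(1) by auto
  qed
  have barrier: "v x \<le> D / 2 * norm (x - p)" if p: "p \<in> frontier \<Omega>" for x p
  proof (cases "x \<in> \<Omega>")
    case True
    obtain n where n: "norm n = 1" "\<And>x. x \<in> closure \<Omega> \<Longrightarrow> (x - p) \<bullet> n \<ge> 0"
      using support_line[OF \<Omega>(1,2,4) p] by blast
    define \<zeta> where "\<zeta> = (\<lambda>z. (z - cplx p) * cnj (cplx n))"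
    \<comment> \<open>With \<open>s = Re (\<zeta> z)\<close>, the distance to the support line, \<open>Re (q z) = |z|\<^sup>2 + 2 s (D - s)\<close>. The added term
      is four times the torsion function of the strip \<open>0 < s < D\<close>, which contains \<open>\<Omega>\<close>.\<close>
    define q where "q = (\<lambda>z. of_real ((norm p)\<^sup>2) + 2 * cnj (cplx p) * (z - cplx p)
      + of_real (2 * D) * \<zeta> z - (\<zeta> z)\<^sup>2)"
    have \<zeta>: "norm (\<zeta> z) = norm (z - cplx p)" for z
      using n(1) by (simp add: \<zeta>_def norm_mult)
    have Re\<zeta>: "Re (\<zeta> (cplx y)) = (y - p) \<bullet> n" for y
      unfolding \<zeta>_def inner_eq_Re_cplx cplx_diff ..
    have Req: "Re (q z) = (norm z)\<^sup>2 + 2 * D * Re (\<zeta> z) - 2 * (Re (\<zeta> z))\<^sup>2" for z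
    proof -
      have "(norm z)\<^sup>2 = (norm p)\<^sup>2 + 2 * Re (cnj (cplx p) * (z - cplx p)) + (norm (z - cplx p))\<^sup>2"
        unfolding norm_cplx[symmetric] cmod_power2 by (simp add: power2_eq_square algebra_simps)
      moreover have "(norm (\<zeta> z))\<^sup>2 = 2 * (Re (\<zeta> z))\<^sup>2 - Re ((\<zeta> z)\<^sup>2)"
        unfolding cmod_power2 by (simp add: power2_eq_square)
      ultimately show ?thesis unfolding q_def \<zeta> by simp
    qed
    have r: "0 \<le> Re (\<zeta> w)" "Re (\<zeta> w) \<le> D" if w: "w \<in> S" for w
    proof -
      obtain y where y: "y \<in> \<Omega>" "w = cplx y" using w unfolding S_def by blast
      have "p \<in> closure \<Omega>" using p by (simp add: frontier_def)
      then show "0 \<le> Re (\<zeta> w)" "Re (\<zeta> w) \<le> D"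
        using n(2)[of y] y closure_subset[of \<Omega>] complex_Re_le_cmod[of "\<zeta> w"] D(2)[OF y(1), of p]
        by (auto simp: Re\<zeta> \<zeta> simp flip: cplx_diff)
    qed
    have "Re (H (cplx x)) \<le> Re (q (cplx x))"
    proof (rule least)
      show "q holomorphic_on S" unfolding q_def \<zeta>_def by (intro holomorphic_intros)
      show "(norm w)\<^sup>2 \<le> Re (q w)" if "w \<in> S" for w
      proof -
        have "(Re (\<zeta> w))\<^sup>2 \<le> D * Re (\<zeta> w)"
          unfolding power2_eq_square using r[OF that] by (intro mult_right_mono) auto
        then show ?thesis unfolding Req by simp
      qed
    qed (use True in \<open>simp add: S_def\<close>)
    then have "v x \<le> (2 * D * Re (\<zeta> (cplx x)) - 2 * (Re (\<zeta> (cplx x)))\<^sup>2) / 4"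
      unfolding Req v_def using True by simp
    also have "\<dots> \<le> D / 2 * Re (\<zeta> (cplx x))" by (simp add: field_simps)
    also have "\<dots> \<le> D / 2 * norm (x - p)"
      using complex_Re_le_cmod[of "\<zeta> (cplx x)"] D(1)
      by (intro mult_left_mono) (auto simp: \<zeta> simp flip: cplx_diff)
    finally show ?thesis .
  qed (use D in \<open>simp add: v_def\<close>)
  have harm: "harmonic_on (\<lambda>x. v x + (norm x)\<^sup>2 / 4) \<Omega>"
    unfolding harmonic_on_def
    by (rule exI[of _ "\<lambda>z. H z / 4"]) (use H in \<open>auto simp: v_def S_def field_simps intro!: holomorphic_intros\<close>)
  have "continuous_on (closure \<Omega>) v"
    unfolding continuous_on_def
  proof
    fix x assume x: "x \<in> closure \<Omega>"
    show "(v \<longlongrightarrow> v x) (at x within closure \<Omega>)"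
    proof (cases "x \<in> \<Omega>")
      case True
      have "v differentiable (at x)"
        using C2_on_and_laplacian_of_harmonic(1)[OF \<Omega>(1) harm] True by (simp add: C2_on_def)
      then have "isCont v x" by (rule differentiable_imp_continuous_within)
      then show ?thesis unfolding isCont_def by (rule tendsto_within_subset) auto
    next
      case False
      then have p: "x \<in> frontier \<Omega>" using x \<Omega>(1) by (simp add: frontier_def interior_open)
      have "((\<lambda>y. D / 2 * norm (y - x)) \<longlongrightarrow> D / 2 * norm (x - x)) (at x within closure \<Omega>)"
        by (intro tendsto_intros)
      then have lim: "((\<lambda>y. D / 2 * norm (y - x)) \<longlongrightarrow> 0) (at x within closure \<Omega>)" by simp
      have "(v \<longlongrightarrow> 0) (at x within closure \<Omega>)"
        by (rule tendsto_sandwich[OF _ _ tendsto_const lim]) (use nonneg barrier[OF p] in auto)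
      then show ?thesis using False by (simp add: v_def)
    qed
  qed
  moreover have "\<forall>x\<in>frontier \<Omega>. v x = 0"
    using \<Omega>(1) by (auto simp: v_def frontier_def interior_open)
  ultimately show ?thesis
    using torsion_function_iff_harmonic[OF \<Omega>(1,2)] harm by blast
qed

section \<open>Perimeter of convex sets\<close>

lemma diameter_le_dist:
  fixes S :: "'a::metric_space set"
  assumes "0 \<le> d" "\<And>x y. x \<in> S \<Longrightarrow> y \<in> S \<Longrightarrow> dist x y \<le> d"
  shows "diameter S \<le> d"
  using assms by (auto simp: diameter_def intro!: cSUP_least)

lemma hausdorff1_contraction:
  fixes f :: "'a::metric_space \<Rightarrow> 'b::metric_space"
  assumes f: "\<And>x y. x \<in> A \<Longrightarrow> y \<in> A \<Longrightarrow> dist (f x) (f y) \<le> dist x y"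
  shows "hausdorff1 (f ` A) \<le> hausdorff1 A"
  unfolding hausdorff1_def
proof (rule SUP_mono)
  fix \<delta> :: real assume "\<delta> \<in> {0<..}"
  have "hausdorff1_pre \<delta> (f ` A) \<le> hausdorff1_pre \<delta> A"
    unfolding hausdorff1_pre_def
  proof (rule INF_greatest)
    fix C :: "nat \<Rightarrow> 'a set" assume "C \<in> {C. A \<subseteq> (\<Union>i. C i) \<and> (\<forall>i. bounded (C i) \<and> diameter (C i) \<le> \<delta>)}"
    then have C: "A \<subseteq> (\<Union>i. C i)" "\<And>i. bounded (C i)" "\<And>i. diameter (C i) \<le> \<delta>" by auto
    define C' where "C' = (\<lambda>i. f ` (C i \<inter> A))"
    have d: "dist x y \<le> diameter (C i)" if "x \<in> C' i" "y \<in> C' i" for x y i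
    proof -
      obtain a b where ab: "a \<in> C i" "a \<in> A" "x = f a" "b \<in> C i" "b \<in> A" "y = f b"
        using \<open>x \<in> C' i\<close> \<open>y \<in> C' i\<close> unfolding C'_def by blast
      have "dist x y \<le> dist a b" using f ab by simp
      also have "\<dots> \<le> diameter (C i)" using diameter_bounded_bound[OF C(2)] ab by blast
      finally show ?thesis .
    qed
    then have diam: "diameter (C' i) \<le> diameter (C i)" for i
      by (intro diameter_le_dist diameter_ge_0 C)
    have bdd: "bounded (C' i)" for i
      unfolding bounded_def using d[of _ i] by blast
    have "f ` A \<subseteq> (\<Union>i. C' i)" using C(1) unfolding C'_def by blast
    moreover have "diameter (C' i) \<le> \<delta>" for i using diam C(3) by (rule order.trans)
    ultimately show "(INF C\<in>{C. f ` A \<subseteq> \<Union> (range C) \<and> (\<forall>i. bounded (C i) \<and> diameter (C i) \<le> \<delta>)}. \<Sum>i. ennreal (diameter (C i)))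
        \<le> (\<Sum>i. ennreal (diameter (C i)))"
      using bdd diam
      by (intro INF_lower2[of C'] suminf_le summableI ennreal_leI) auto
  qed
  then show "\<exists>m\<in>{0<..}. hausdorff1_pre \<delta> (f ` A) \<le> hausdorff1_pre m A"
    using \<open>\<delta> \<in> {0<..}\<close> by blast
qed

lemma hausdorff1_mono: "A \<subseteq> B \<Longrightarrow> hausdorff1 A \<le> hausdorff1 B"
  unfolding hausdorff1_def hausdorff1_pre_def
  by (intro SUP_mono) (auto intro!: INF_superset_mono bexI)

text \<open>
  The factor \<open>2\<close> comes from enclosing each set of a cover in an interval of twice its diameter around
  one of its points. It is harmless, as the estimate serves to show that perimeters are positive.
\<close>

lemma hausdorff1_interval_ge:
  "ennreal (b - a) \<le> 2 * hausdorff1 {a..b::real}"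
proof -
  have *: "ennreal (b - a) \<le> 2 * (\<Sum>i. ennreal (diameter (C i)))"
    if C: "{a..b} \<subseteq> (\<Union>i. C i)" "\<And>i. bounded (C i)" for C :: "nat \<Rightarrow> real set"
  proof -
    define J where "J = (\<lambda>i. if C i = {} then {} else
      {(SOME x. x \<in> C i) - diameter (C i)..(SOME x. x \<in> C i) + diameter (C i)})"
    have sub: "C i \<subseteq> J i" for i
    proof
      fix x assume x: "x \<in> C i"
      then have "(SOME x. x \<in> C i) \<in> C i" by (rule someI)
      from diameter_bounded_bound[OF C(2) x this] x show "x \<in> J i"
        by (auto simp: J_def dist_real_def)
    qed
    have m: "emeasure lborel (J i) \<le> 2 * ennreal (diameter (C i))" for i
      using diameter_ge_0[OF C(2)[of i]] by (auto simp: J_def simp flip: ennreal_numeral ennreal_mult)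
    have Jm: "J i \<in> sets lborel" for i by (auto simp: J_def)
    have Jc: "{a..b} \<subseteq> (\<Union>i. J i)" using C(1) sub by blast
    have "ennreal (b - a) \<le> emeasure lborel {a..b}" by (cases "a \<le> b") (auto simp: ennreal_neg)
    also have "\<dots> \<le> emeasure lborel (\<Union>i. J i)"
      using Jc by (rule emeasure_mono) (use Jm in auto)
    also have "\<dots> \<le> (\<Sum>i. emeasure lborel (J i))"
      by (rule emeasure_subadditive_countably) (use Jm in auto)
    also have "\<dots> \<le> (\<Sum>i. 2 * ennreal (diameter (C i)))"
      by (intro suminf_le summableI m)
    also have "\<dots> = 2 * (\<Sum>i. ennreal (diameter (C i)))" by simp
    finally show ?thesis .
  qed
  have "ennreal (b - a) / 2 \<le> hausdorff1_pre 1 {a..b}"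
    unfolding hausdorff1_pre_def
  proof (rule INF_greatest)
    fix C :: "nat \<Rightarrow> real set" assume "C \<in> {C. {a..b} \<subseteq> (\<Union>i. C i) \<and> (\<forall>i. bounded (C i) \<and> diameter (C i) \<le> 1)}"
    then have "ennreal (b - a) \<le> (\<Sum>i. ennreal (diameter (C i))) * 2" using *[of C] by (simp add: mult.commute)
    then show "ennreal (b - a) / 2 \<le> (\<Sum>i. ennreal (diameter (C i)))"
      by (intro divide_le_posI_ennreal) (simp_all add: mult.commute)
  qed
  also have "\<dots> \<le> hausdorff1 {a..b}"
    unfolding hausdorff1_def by (rule SUP_upper) simp
  finally have "ennreal (b - a) / 2 * 2 \<le> hausdorff1 {a..b} * 2" by (rule mult_right_mono) simp
  moreover have "ennreal (b - a) / 2 * 2 = ennreal (b - a)"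
    by (simp add: ennreal_divide_times ennreal_divide_self)
  ultimately show ?thesis by (simp add: mult.commute)
qed

lemma hausdorff1_interval_le:
  assumes "a \<le> (b::real)"
  shows "hausdorff1 {a..b} \<le> ennreal (b - a)"
  unfolding hausdorff1_def
proof (rule SUP_least)
  fix \<delta> :: real assume "\<delta> \<in> {0<..}"
  then have "\<delta> > 0" by simp
  obtain N where N: "(b - a) / \<delta> < real N" "N > 0"
    by (metis reals_Archimedean2 gr0I less_trans of_nat_0 of_nat_1 order_less_irrefl zero_less_one linorder_not_less less_numeral_extra(1) order.strict_trans1)
  define h where "h = (b - a) / N"
  have h: "0 \<le> h" "h \<le> \<delta>" "real N * h = b - a"
    using assms N \<open>\<delta> > 0\<close> by (auto simp: h_def field_simps)
  define C where "C = (\<lambda>i. if i < N then {a + real i * h..a + real (Suc i) * h} else {})"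
  have cover: "{a..b} \<subseteq> (\<Union>i. C i)"
  proof
    fix x assume x: "x \<in> {a..b}"
    have "\<exists>i<N. x \<le> a + real (Suc i) * h"
      using x h N by (intro exI[of _ "N - 1"]) (auto simp: of_nat_diff)
    then obtain i where i: "i < N \<and> x \<le> a + real (Suc i) * h"
      and min: "\<And>j. j < i \<Longrightarrow> \<not> (j < N \<and> x \<le> a + real (Suc j) * h)"
      using exists_least_iff[of "\<lambda>i. i < N \<and> x \<le> a + real (Suc i) * h"] by blast
    have "a + real i * h \<le> x"
      using min[of "i - 1"] i x by (cases i) auto
    then show "x \<in> (\<Union>i. C i)" using i by (auto simp: C_def)
  qed
  have dC: "diameter (C i) \<le> (if i < N then h else 0)" and bC: "bounded (C i)" for i
    unfolding C_def using h(1) by (auto intro!: diameter_le_dist simp: dist_real_def algebra_simps)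
  have "diameter (C i) \<le> \<delta>" for i
    using dC[of i] h(2) \<open>\<delta> > 0\<close> by (auto split: if_splits)
  then have "hausdorff1_pre \<delta> {a..b} \<le> (\<Sum>i. ennreal (diameter (C i)))"
    unfolding hausdorff1_pre_def
    using cover bC by (intro INF_lower) auto
  also have "\<dots> \<le> (\<Sum>i. ennreal (if i < N then h else 0))"
    by (intro suminf_le summableI ennreal_leI dC)
  also have "\<dots> = (\<Sum>i<N. ennreal (if i < N then h else 0))"
    by (rule suminf_finite) auto
  also have "\<dots> = ennreal (b - a)"
    using h by (simp add: ennreal_of_nat_eq_real_of_nat flip: ennreal_mult)
  finally show "hausdorff1_pre \<delta> {a..b} \<le> ennreal (b - a)" .
qed

lemma norm_cis_diff_le: "norm (cis s - cis t) \<le> \<bar>s - t\<bar>"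
proof -
  have "cis s - cis t = cis t * (cis (s - t) - 1)"
    by (simp add: algebra_simps cis_mult)
  then have "norm (cis s - cis t) = norm (exp (\<i> * of_real (s - t)) - 1)"
    by (simp add: norm_mult cis_conv_exp)
  also have "\<dots> = 2 * \<bar>sin ((s - t) / 2)\<bar>" by (rule dist_exp_i_1)
  also have "\<dots> \<le> 2 * \<bar>(s - t) / 2\<bar>" by (intro mult_left_mono abs_sin_x_le_abs_x) auto
  finally show ?thesis by simp
qed

lemma hausdorff1_sphere_finite:
  assumes "B > 0"
  shows "hausdorff1 (sphere (0::real^2) B) < \<infinity>"
proof -
  define f where "f = (\<lambda>t. vec2 (of_real B * cis (t / B)))"
  have "dist (f s) (f t) \<le> dist s t" for s t
  proof -
    have "dist (f s) (f t) = norm (of_real B * (cis (s / B) - cis (t / B)))"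
      unfolding f_def dist_norm linear_diff[OF linear_vec2, symmetric] norm_vec2 right_diff_distrib ..
    also have "\<dots> \<le> B * \<bar>s / B - t / B\<bar>"
      using assms norm_cis_diff_le by (simp add: norm_mult)
    also have "\<dots> = dist s t" using assms by (simp add: dist_real_def abs_mult[symmetric] flip: diff_divide_distrib)
    finally show ?thesis .
  qed
  then have "hausdorff1 (f ` {0..2 * pi * B}) \<le> hausdorff1 {0..2 * pi * B}"
    by (intro hausdorff1_contraction)
  also have "\<dots> \<le> ennreal (2 * pi * B - 0)" using assms by (intro hausdorff1_interval_le) simp
  also have "\<dots> < \<infinity>" by simp
  finally have "hausdorff1 (f ` {0..2 * pi * B}) < \<infinity>" .
  moreover have "sphere (0::real^2) B \<subseteq> f ` {0..2 * pi * B}"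
  proof
    fix x :: "real^2" assume "x \<in> sphere 0 B"
    then have nx: "norm (cplx x) = B" by simp
    define t where "t = Arg2pi (cplx x)"
    have "cplx x = of_real B * cis t"
      using Arg2pi_eq[of "cplx x"] nx by (simp add: t_def cis_conv_exp)
    then have "x = f (t * B)" unfolding f_def using assms by (metis nonzero_mult_div_cancel_right order_less_irrefl vec2_cplx)
    moreover have "t * B \<in> {0..2 * pi * B}"
      using Arg2pi_ge_0[of "cplx x"] Arg2pi_lt_2pi[of "cplx x"] assms by (simp add: t_def)
    ultimately show "x \<in> f ` {0..2 * pi * B}" by blast
  qed
  ultimately show ?thesis using hausdorff1_mono le_less_trans by blast
qed

lemma segment_meets_frontier:
  fixes B :: "'a::real_normed_vector set"
  assumes x: "x \<in> closure B" and B: "bounded B" and d: "d \<noteq> 0"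
  shows "\<exists>t\<ge>0. x + t *\<^sub>R d \<in> frontier B"
proof -
  obtain M where M: "M > 0" "\<And>y. y \<in> closure B \<Longrightarrow> norm y \<le> M"
    using bounded_closure[OF B] bounded_pos by metis
  define T where "T = (2 * M + 1) / norm d"
  have T: "norm (T *\<^sub>R d) = 2 * M + 1" "T \<ge> 0" using d M by (auto simp: T_def)
  have "x + T *\<^sub>R d \<notin> closure B"
  proof
    assume "x + T *\<^sub>R d \<in> closure B"
    then have "norm (x + T *\<^sub>R d) \<le> M" by (rule M)
    then show False using norm_triangle_ineq4[of "x + T *\<^sub>R d" x] T M(2)[OF x] by simp
  qed
  then have "closed_segment x (x + T *\<^sub>R d) \<inter> frontier (closure B) \<noteq> {}"
    using x by (intro connected_Int_frontier connected_segment) auto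
  then obtain y where y: "y \<in> closed_segment x (x + T *\<^sub>R d)" "y \<in> frontier B"
    using interior_mono[OF closure_subset[of B]] by (auto simp: frontier_def)
  then obtain s where s: "0 \<le> s" "y = (1 - s) *\<^sub>R x + s *\<^sub>R (x + T *\<^sub>R d)"
    by (auto simp: in_segment)
  then have "y = x + (s * T) *\<^sub>R d" by (simp add: algebra_simps)
  then show ?thesis using y(2) s(1) T(2) by (metis mult_nonneg_nonneg)
qed

text \<open>
  The nearest-point projection onto the closure of \<open>\<Omega>\<close> does not increase distances. It maps the boundary
  of \<open>B\<close> onto that of \<open>\<Omega>\<close>: the outward normal ray at a boundary point \<open>p\<close> of \<open>\<Omega>\<close> leaves the bounded
  set \<open>B\<close>, and all of its points project to \<open>p\<close>.
\<close>

lemma hausdorff1_frontier_mono: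
  fixes \<Omega> :: "(real^2) set"
  assumes \<Omega>: "open \<Omega>" "convex \<Omega>" "\<Omega> \<noteq> {}" and B: "\<Omega> \<subseteq> B" "bounded B"
  shows "hausdorff1 (frontier \<Omega>) \<le> hausdorff1 (frontier B)"
proof -
  have ne: "closure \<Omega> \<noteq> {}" using \<Omega>(3) closure_subset by blast
  have "frontier \<Omega> \<subseteq> closest_point (closure \<Omega>) ` frontier B"
  proof
    fix p assume p: "p \<in> frontier \<Omega>"
    obtain n where n: "norm n = 1" "\<And>x. x \<in> closure \<Omega> \<Longrightarrow> (x - p) \<bullet> n \<ge> 0"
      using support_line[OF \<Omega> p] by blast
    have pc: "p \<in> closure \<Omega>" using p by (simp add: frontier_def)
    then have "p \<in> closure B" using closure_mono[OF B(1)] by blast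
    then obtain t where t: "t \<ge> 0" "p + t *\<^sub>R (- n) \<in> frontier B"
      using segment_meets_frontier[OF _ B(2), of p "-n"] n(1) by force
    have "p = closest_point (closure \<Omega>) (p + t *\<^sub>R (- n))"
    proof (rule closest_point_unique[OF convex_closure[OF \<Omega>(2)] closed_closure pc], intro ballI)
      fix z assume z: "z \<in> closure \<Omega>"
      have "t = (t *\<^sub>R n) \<bullet> n" using n(1) by (simp add: dot_square_norm)
      also have "\<dots> \<le> (z - p + t *\<^sub>R n) \<bullet> n" using n(2)[OF z] by (simp add: inner_add_left)
      also have "\<dots> \<le> norm (z - p + t *\<^sub>R n)" using norm_cauchy_schwarz[of "z - p + t *\<^sub>R n" n] n(1) by simp
      also have "\<dots> = dist (p + t *\<^sub>R (- n)) z" by (simp add: dist_norm norm_minus_commute algebra_simps)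
      finally show "dist (p + t *\<^sub>R (- n)) p \<le> dist (p + t *\<^sub>R (- n)) z"
        using t(1) n(1) by (simp add: dist_norm)
    qed
    then show "p \<in> closest_point (closure \<Omega>) ` frontier B" using t(2) by blast
  qed
  then have "hausdorff1 (frontier \<Omega>) \<le> hausdorff1 (closest_point (closure \<Omega>) ` frontier B)"
    by (rule hausdorff1_mono)
  also have "\<dots> \<le> hausdorff1 (frontier B)"
    by (intro hausdorff1_contraction closest_point_lipschitz convex_closure \<Omega> closed_closure ne)
  finally show ?thesis .
qed

lemma hausdorff1_frontier_finite:
  fixes \<Omega> :: "(real^2) set"
  assumes "bounded_convex_domain \<Omega>"
  shows "hausdorff1 (frontier \<Omega>) < \<infinity>"
proof -
  have \<Omega>: "open \<Omega>" "convex \<Omega>" "bounded \<Omega>" "\<Omega> \<noteq> {}"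
    using assms by (auto simp: bounded_convex_domain_def)
  obtain B where B: "B > 0" "\<Omega> \<subseteq> ball 0 B" using bounded_subset_ballD[OF \<Omega>(3)] by blast
  have "hausdorff1 (frontier \<Omega>) \<le> hausdorff1 (sphere (0::real^2) B)"
    using hausdorff1_frontier_mono[OF \<Omega>(1,2,4) B(2)] B(1) by (simp add: frontier_ball)
  then show ?thesis using hausdorff1_sphere_finite[OF B(1)] by (rule le_less_trans)
qed

text \<open>
  The first coordinate maps the boundary onto a set that contains an interval: each vertical line
  through an inscribed ball meets the boundary.
\<close>

lemma hausdorff1_frontier_pos:
  fixes \<Omega> :: "(real^2) set"
  assumes "bounded_convex_domain \<Omega>"
  shows "hausdorff1 (frontier \<Omega>) > 0"
proof -
  have \<Omega>: "open \<Omega>" "bounded \<Omega>" "\<Omega> \<noteq> {}"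
    using assms by (auto simp: bounded_convex_domain_def)
  then obtain c e where e: "e > 0" "ball c e \<subseteq> \<Omega>"
    by (meson ex_in_conv openE)
  have "{c $ 1 .. c $ 1 + e / 2} \<subseteq> (\<lambda>x. x $ 1) ` frontier \<Omega>"
  proof
    fix s assume s: "s \<in> {c $ 1 .. c $ 1 + e / 2}"
    define y where "y = c + (s - c $ 1) *\<^sub>R axis 1 1"
    have "y \<in> \<Omega>" using s e by (intro subsetD[OF e(2)]) (auto simp: y_def dist_norm)
    moreover have "axis 2 1 \<noteq> (0 :: real^2)" by (simp add: axis_eq_0_iff)
    ultimately obtain t where "y + t *\<^sub>R axis 2 1 \<in> frontier \<Omega>"
      using segment_meets_frontier[OF _ \<Omega>(2), of y "axis 2 1"] closure_subset[of \<Omega>] by blast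
    moreover have "(y + t *\<^sub>R axis 2 1) $ 1 = s" by (simp add: y_def axis_def)
    ultimately show "s \<in> (\<lambda>x. x $ 1) ` frontier \<Omega>" by blast
  qed
  then have "hausdorff1 {c $ 1 .. c $ 1 + e / 2} \<le> hausdorff1 ((\<lambda>x. x $ 1) ` frontier \<Omega>)"
    by (rule hausdorff1_mono)
  also have "\<dots> \<le> hausdorff1 (frontier \<Omega>)"
    by (rule hausdorff1_contraction) (metis dist_vec_nth_le)
  finally have "2 * hausdorff1 {c $ 1 .. c $ 1 + e / 2} \<le> 2 * hausdorff1 (frontier \<Omega>)"
    by (rule mult_left_mono) simp
  with hausdorff1_interval_ge[of "c $ 1 + e / 2" "c $ 1"] have "ennreal (e / 2) \<le> 2 * hausdorff1 (frontier \<Omega>)"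
    by simp
  moreover have "0 < ennreal (e / 2)" using e by simp
  ultimately show ?thesis by (metis gr_zeroI leD mult_zero_right)
qed

section \<open>Comparison with a smaller domain\<close>

lemma ennreal_le_of_divide_le:
  fixes X Y P Q :: ennreal
  assumes "X / P \<le> Y / Q" "0 < P" "P \<le> Q" "Q < top"
  shows "X \<le> Y"
proof -
  have "X = X / P * P"
    using assms by (simp add: ennreal_divide_times ennreal_divide_self le_less_trans)
  also have "\<dots> \<le> Y / Q * Q" using assms by (intro mult_mono) auto
  also have "\<dots> = Y"
    using assms by (simp add: ennreal_divide_times ennreal_divide_self less_le_trans)
  finally show ?thesis .
qed

text \<open>
  A subdomain has a smaller denominator in both functionals, so its numerator cannot be larger. The
  denominators are positive and finite, which makes the division in the extended reals reversible.
\<close>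

lemma maximizer_grad_norm_subdomain:
  assumes \<Omega>: "bounded_convex_domain \<Omega>" and \<Omega>': "bounded_convex_domain \<Omega>'" "\<Omega>' \<subseteq> \<Omega>"
    and v: "torsion_function \<Omega>' v"
    and max: "maximizes area_functional \<Omega> u \<or> maximizes perimeter_functional \<Omega> u"
  shows "grad_norm \<Omega>' v \<le> grad_norm \<Omega> u"
  using max
proof
  assume "maximizes area_functional \<Omega> u"
  then have le: "area_functional \<Omega>' v \<le> area_functional \<Omega> u"
    using \<Omega>' v by (simp add: maximizes_def)
  have lm: "\<Omega> \<in> lmeasurable" "\<Omega>' \<in> lmeasurable"
    using \<Omega> \<Omega>' by (auto simp: bounded_convex_domain_def intro: lmeasurable_open)
  have "measure lebesgue \<Omega>' > 0"
    using \<Omega>'(1) lm(2) open_not_negligible[of \<Omega>']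
    by (auto simp: bounded_convex_domain_def negligible_iff_measure zero_less_measure_iff measure_nonneg less_le)
  moreover have "measure lebesgue \<Omega>' \<le> measure lebesgue \<Omega>"
    using lm \<Omega>'(2) by (intro measure_mono_fmeasurable) auto
  ultimately show ?thesis
    using le unfolding area_functional_def
    by (elim ennreal_le_of_divide_le) (auto intro: ennreal_leI)
next
  assume "maximizes perimeter_functional \<Omega> u"
  then have le: "perimeter_functional \<Omega>' v \<le> perimeter_functional \<Omega> u"
    using \<Omega>' v by (simp add: maximizes_def)
  show ?thesis
  proof (rule ennreal_le_of_divide_le[OF le[unfolded perimeter_functional_def]])
    show "0 < hausdorff1 (frontier \<Omega>')" using \<Omega>'(1) by (rule hausdorff1_frontier_pos)
    show "hausdorff1 (frontier \<Omega>) < top" using hausdorff1_frontier_finite[OF \<Omega>] by simp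
    show "hausdorff1 (frontier \<Omega>') \<le> hausdorff1 (frontier \<Omega>)"
      using \<Omega> \<Omega>' by (intro hausdorff1_frontier_mono) (auto simp: bounded_convex_domain_def)
  qed
qed

text \<open>
  The gradient is continuous, so the set where the bound fails is open; being null, it is empty.
\<close>

lemma grad_le_of_grad_norm_le:
  assumes "open \<Omega>" and u: "C2_on \<Omega> u" and le: "grad_norm \<Omega> u \<le> ennreal G" and "0 \<le> G" and x: "x \<in> \<Omega>"
  shows "norm (grad u (at x)) \<le> G"
proof -
  have "continuous_on \<Omega> (\<lambda>x. grad u (at x))"
    using u differentiable_imp_continuous_within[of "\<lambda>x. grad u (at x)"]
    by (auto simp: C2_on_def intro!: continuous_at_imp_continuous_on)
  then have "continuous_on \<Omega> (\<lambda>x. norm (grad u (at x)))" by (intro continuous_intros)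
  then have opn: "open {x \<in> \<Omega>. norm (grad u (at x)) > G}"
    using continuous_open_preimage[OF _ assms(1) open_greaterThan, of "\<lambda>x. norm (grad u (at x))" G]
    by (simp add: vimage_def Int_def)
  have "AE x in lebesgue_on \<Omega>. ennreal (norm (grad u (at x))) \<le> grad_norm \<Omega> u"
    unfolding grad_norm_def Linf_norm_def by (rule esssup_AE)
  then have "AE x in lebesgue_on \<Omega>. norm (grad u (at x)) \<le> G"
    by eventually_elim (metis le ennreal_le_iff[OF \<open>0 \<le> G\<close>] order.trans)
  then have "AE x in lebesgue. x \<in> \<Omega> \<longrightarrow> norm (grad u (at x)) \<le> G"
    using assms(1) by (subst (asm) AE_restrict_space_iff) (auto intro: lmeasurable_iff_integrable)
  then have "AE x in lebesgue. x \<notin> {x \<in> \<Omega>. norm (grad u (at x)) > G}"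
    by eventually_elim auto
  then have "{x \<in> \<Omega>. norm (grad u (at x)) > G} \<in> null_sets lebesgue"
    using opn by (subst AE_iff_null_sets) auto
  then have "negligible {x \<in> \<Omega>. norm (grad u (at x)) > G}" by (simp add: negligible_iff_null_sets)
  then have "{x \<in> \<Omega>. norm (grad u (at x)) > G} = {}" using open_not_negligible[OF opn] by blast
  then show ?thesis using x by (auto simp: not_less)
qed

section \<open>Bounds for the torsion function\<close>

text \<open>
  The minimum principle is applied to \<open>u + |y - x|\<^sup>2 / 4\<close>, which is at least \<open>e\<^sup>2 / 4\<close> on the boundary when
  \<open>\<Omega>\<close> contains the ball of radius \<open>e\<close> around \<open>x\<close>.
\<close>

lemma torsion_function_pos:
  assumes \<Omega>: "open \<Omega>" "convex \<Omega>" "bounded \<Omega>" and u: "torsion_function \<Omega> u" and x: "x \<in> \<Omega>"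
  shows "u x > 0"
proof -
  have cont: "continuous_on (closure \<Omega>) u" and bd: "\<And>y. y \<in> frontier \<Omega> \<Longrightarrow> u y = 0"
    and harm: "harmonic_on (\<lambda>y. u y + (norm y)\<^sup>2 / 4) \<Omega>"
    using u torsion_function_iff_harmonic[OF \<Omega>(1,2)] by auto
  obtain e where e: "e > 0" "ball x e \<subseteq> \<Omega>" using \<Omega>(1) x by (meson openE)
  define h where "h = (\<lambda>y. u y + (norm (y - x))\<^sup>2 / 4 - e\<^sup>2 / 4)"
  have "h x \<ge> 0"
  proof (rule harmonic_max_principle[OF \<Omega>])
    show "harmonic_on h \<Omega>" unfolding h_def
      by (intro harmonic_on_diff torsion_harmonic_shift harm harmonic_on_const)
    show "continuous_on (closure \<Omega>) h" unfolding h_def by (intro continuous_intros cont) auto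
    show "h y \<ge> 0" if y: "y \<in> frontier \<Omega>" for y
    proof -
      have "y \<notin> ball x e" using y e(2) \<Omega>(1) by (auto simp: frontier_def interior_open)
      then have "e \<le> norm (y - x)" by (simp add: dist_norm norm_minus_commute)
      then have "e\<^sup>2 \<le> (norm (y - x))\<^sup>2" using e(1) by (intro power_mono) auto
      then show ?thesis using bd[OF y] by (simp add: h_def)
    qed
  qed (rule x)
  then have "u x \<ge> e\<^sup>2 / 4" by (simp add: h_def)
  moreover have "e\<^sup>2 > 0" using e(1) by simp
  ultimately show ?thesis by linarith
qed

text \<open>
  Move from \<open>x\<close> in the direction \<open>- n\<close>. The boundary, where \<open>u\<close> vanishes, is reached after a distance
  of at most \<open>(x - p) \<bullet> n - c\<close>, and along the way \<open>u\<close> changes at rate at most \<open>G\<close>.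
\<close>

lemma torsion_function_le_of_grad_le:
  assumes \<Omega>: "open \<Omega>" "convex \<Omega>" "bounded \<Omega>" and u: "torsion_function \<Omega> u"
    and G: "0 \<le> G" "\<And>y. y \<in> \<Omega> \<Longrightarrow> norm (grad u (at y)) \<le> G"
    and n: "norm n = 1" "\<And>y. y \<in> closure \<Omega> \<Longrightarrow> c \<le> (y - p) \<bullet> n" and x: "x \<in> \<Omega>"
  shows "u x \<le> G * ((x - p) \<bullet> n - c)"
proof -
  have cont: "continuous_on (closure \<Omega>) u" and bd: "\<And>y. y \<in> frontier \<Omega> \<Longrightarrow> u y = 0"
    and C2: "C2_on \<Omega> u"
    using u by (auto simp: torsion_function_def)
  obtain t where t: "0 \<le> t" "x + t *\<^sub>R (- n) \<in> frontier \<Omega>"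
    using segment_meets_frontier[of x \<Omega> "- n"] x closure_subset[of \<Omega>] \<Omega>(3) n(1) by force
  have "x \<notin> frontier \<Omega>" using x \<Omega>(1) by (simp add: frontier_def interior_open)
  then have tpos: "0 < t" using t by (cases "t = 0") auto
  have q: "x + t *\<^sub>R (- n) \<in> closure \<Omega>" using t(2) by (simp add: frontier_def)
  have in\<Omega>: "x + s *\<^sub>R (- n) \<in> \<Omega>" if "0 < s" "s < t" for s
  proof -
    have "x + s *\<^sub>R (- n) = (1 - s / t) *\<^sub>R x + (s / t) *\<^sub>R (x + t *\<^sub>R (- n))"
      using tpos by (simp add: algebra_simps)
    then have "x + s *\<^sub>R (- n) \<in> open_segment x (x + t *\<^sub>R (- n))"
      using that tpos n(1) unfolding in_segment by (intro conjI exI[of _ "s / t"]) auto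
    moreover have "open_segment x (x + t *\<^sub>R (- n)) \<subseteq> interior \<Omega>"
      using in_interior_closure_convex_segment[OF \<Omega>(2) _ q, of x] x \<Omega>(1) by (simp add: interior_open)
    ultimately show ?thesis using \<Omega>(1) by (auto simp: interior_open)
  qed
  have cf: "continuous_on {0..t} (\<lambda>s. u (x + s *\<^sub>R (- n)))"
  proof (rule continuous_on_compose2[OF cont])
    show "(\<lambda>s. x + s *\<^sub>R (- n)) ` {0..t} \<subseteq> closure \<Omega>"
      using in\<Omega> q x closure_subset[of \<Omega>] by (force simp: le_less)
  qed (intro continuous_intros)
  have df: "((\<lambda>s. u (x + s *\<^sub>R (- n))) has_derivative
      (\<lambda>r. (r *\<^sub>R (- n)) \<bullet> grad u (at (x + s *\<^sub>R (- n))))) (at s)" if "0 < s" "s < t" for s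
  proof (rule has_derivative_compose[of "\<lambda>s. x + s *\<^sub>R (- n)" "\<lambda>r. r *\<^sub>R (- n)"])
    show "((\<lambda>s. x + s *\<^sub>R (- n)) has_derivative (\<lambda>r. r *\<^sub>R (- n))) (at s)"
      by (auto intro!: derivative_eq_intros)
    show "(u has_derivative (\<lambda>h. h \<bullet> grad u (at (x + s *\<^sub>R (- n))))) (at (x + s *\<^sub>R (- n)))"
      using C2 in\<Omega>[OF that] by (intro has_derivative_grad) (simp add: C2_on_def)
  qed
  obtain s where s: "0 < s" "s < t"
    and eq: "u (x + t *\<^sub>R (- n)) - u (x + 0 *\<^sub>R (- n)) = ((t - 0) *\<^sub>R (- n)) \<bullet> grad u (at (x + s *\<^sub>R (- n)))"
    by (rule mvt[OF tpos cf df])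
  have "u x = t * (n \<bullet> grad u (at (x + s *\<^sub>R (- n))))"
    using eq bd[OF t(2)] by simp
  also have "\<dots> \<le> t * G"
    using norm_cauchy_schwarz[of n "grad u (at (x + s *\<^sub>R (- n)))"] G(2)[OF in\<Omega>[of s]] s n(1) tpos
    by (intro mult_left_mono) auto
  also have "\<dots> \<le> ((x - p) \<bullet> n - c) * G"
  proof (intro mult_right_mono G)
    show "t \<le> (x - p) \<bullet> n - c"
      using n(2)[OF q] n(1) by (simp add: inner_diff_left inner_add_left dot_square_norm)
  qed
  finally show ?thesis by (simp add: mult.commute)
qed

lemma inner_along_normal:
  fixes n :: "'a::real_inner"
  assumes "norm n = 1"
  shows "(p + t *\<^sub>R n - p) \<bullet> n = t" and "norm (p + t *\<^sub>R n - (p + s *\<^sub>R n)) = \<bar>t - s\<bar>"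
  using assms by (auto simp: dot_square_norm algebra_simps simp flip: scaleR_diff_left)

lemma internally_tangent_ball_subset:
  fixes n :: "'a::real_inner"
  assumes n: "norm n = 1" and "\<rho> \<le> s" "s + \<rho> \<le> 2 * R"
  shows "ball (p + s *\<^sub>R n) \<rho> \<subseteq> ball (p + R *\<^sub>R n) R"
proof
  fix x assume "x \<in> ball (p + s *\<^sub>R n) \<rho>"
  then have "dist (p + s *\<^sub>R n) x < \<rho>" by simp
  moreover have "dist (p + R *\<^sub>R n) (p + s *\<^sub>R n) = \<bar>R - s\<bar>"
    unfolding dist_norm by (rule inner_along_normal(2)[OF n])
  moreover have "dist (p + R *\<^sub>R n) x \<le> dist (p + R *\<^sub>R n) (p + s *\<^sub>R n) + dist (p + s *\<^sub>R n) x"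
    by (rule dist_triangle)
  ultimately show "x \<in> ball (p + R *\<^sub>R n) R" using assms by auto
qed

text \<open>
  A quantitative Hopf lemma at the point \<open>p\<close> of the sphere. The function \<open>\<psi>\<close> is the deficit
  \<open>G * ((x - p) \<bullet> n) - u x\<close> plus the torsion function of the ball, hence harmonic and nonnegative.
  The normal derivative of the deficit at \<open>p\<close> is \<open>0\<close> and that of the torsion function of the ball is
  \<open>R / 2\<close>, so Harnack's inequality on the radius towards \<open>p\<close> bounds \<open>\<psi>\<close> at the centre by \<open>R\<^sup>2\<close>, and the
  deficit there by \<open>3 * R\<^sup>2 / 4\<close>.
\<close>

lemma torsion_function_ge_of_interior_ball:
  assumes harm: "harmonic_on (\<lambda>x. u x + (norm x)\<^sup>2 / 4) (ball (p + R *\<^sub>R n) R)" and "R > 0"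
    and n: "norm n = 1"
    and ule: "\<And>x. x \<in> ball (p + R *\<^sub>R n) R \<Longrightarrow> u x \<le> G * ((x - p) \<bullet> n)"
    and lim: "((\<lambda>t. u (p + t *\<^sub>R n) / t) \<longlongrightarrow> G) (at_right 0)"
  shows "u (p + R *\<^sub>R n) \<ge> G * R - 3 * R\<^sup>2 / 4"
proof -
  define c where "c = p + R *\<^sub>R n"
  define \<psi> where "\<psi> = (\<lambda>x. G * (x \<bullet> n - p \<bullet> n) + R\<^sup>2 / 4 - (u x + (norm (x - c))\<^sup>2 / 4))"
  have harm\<psi>: "harmonic_on \<psi> (ball c R)"
    unfolding \<psi>_def using harm unfolding c_def[symmetric]
    by (intro harmonic_on_diff[OF harmonic_on_add[OF harmonic_on_cmult[OF
          harmonic_on_diff[OF harmonic_on_inner harmonic_on_const]] harmonic_on_const]]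
        torsion_harmonic_shift)
  have nonneg: "\<psi> x \<ge> 0" if "x \<in> ball c R" for x
  proof -
    have "(norm (x - c))\<^sup>2 \<le> R\<^sup>2"
      using that by (intro power_mono) (auto simp: dist_norm norm_minus_commute)
    then show ?thesis using ule[of x] that by (simp add: \<psi>_def c_def inner_diff_left)
  qed
  have val: "\<psi> (p + t *\<^sub>R n) = G * t + (2 * R * t - t\<^sup>2) / 4 - u (p + t *\<^sub>R n)" for t
  proof -
    have e1: "(norm (p + t *\<^sub>R n - c))\<^sup>2 = (t - R)\<^sup>2"
      unfolding c_def inner_along_normal(2)[OF n] by simp
    have e2: "(p + t *\<^sub>R n) \<bullet> n - p \<bullet> n = t"
      using n by (simp add: inner_add_left dot_square_norm)
    show ?thesis unfolding \<psi>_def e1 e2 by (simp add: power2_eq_square field_simps)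
  qed
  have Harnack: "\<psi> c \<le> (G - u (p + t *\<^sub>R n) / t + (2 * R - t) / 4) * (2 * R - t)" if t: "0 < t" "t < R" for t
  proof -
    have d: "dist c (p + t *\<^sub>R n) = R - t"
      unfolding c_def dist_norm inner_along_normal(2)[OF n] using t by simp
    then have "\<psi> c * (R - (R - t)) \<le> \<psi> (p + t *\<^sub>R n) * (R + (R - t))"
      using harmonic_Harnack[OF harm\<psi> \<open>R > 0\<close> nonneg, of "p + t *\<^sub>R n"] t by simp
    also have "\<dots> = t * ((G - u (p + t *\<^sub>R n) / t + (2 * R - t) / 4) * (2 * R - t))"
      unfolding val using t by (simp add: field_simps power2_eq_square)
    finally show ?thesis using t by simp
  qed
  have "((\<lambda>t. (G - u (p + t *\<^sub>R n) / t + (2 * R - t) / 4) * (2 * R - t)) \<longlongrightarrow>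
      (G - G + (2 * R - 0) / 4) * (2 * R - 0)) (at_right 0)"
    by (intro tendsto_intros lim) auto
  moreover have "\<forall>\<^sub>F t in at_right 0. \<psi> c \<le> (G - u (p + t *\<^sub>R n) / t + (2 * R - t) / 4) * (2 * R - t)"
    using Harnack \<open>R > 0\<close> by (auto simp: eventually_at_right_field intro!: exI[of _ R])
  ultimately have "\<psi> c \<le> (G - G + (2 * R - 0) / 4) * (2 * R - 0)"
    by (rule tendsto_lowerbound) simp
  then show ?thesis
    using val[of R] by (simp add: c_def power2_eq_square algebra_simps)
qed

section \<open>Cutting off a cap raises the gradient\<close>

lemma closure_near_touching_point:
  fixes \<Omega> :: "'a::euclidean_space set"
  assumes "bounded \<Omega>" and nonneg: "\<And>x. x \<in> closure \<Omega> \<Longrightarrow> (x - p) \<bullet> n \<ge> 0"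
    and touch: "\<And>x. x \<in> closure \<Omega> \<Longrightarrow> (x - p) \<bullet> n = 0 \<Longrightarrow> x = p" and "a > 0"
  shows "\<exists>d>0. \<forall>x\<in>closure \<Omega>. (x - p) \<bullet> n \<le> d \<longrightarrow> norm (x - p) \<le> a"
proof -
  define K where "K = closure \<Omega> - ball p a"
  have "compact K"
    unfolding K_def using assms(1) by (intro compact_diff) auto
  show ?thesis
  proof (cases "K = {}")
    case True
    then have "norm (x - p) \<le> a" if "x \<in> closure \<Omega>" for x
      using that by (auto simp: K_def dist_norm norm_minus_commute)
    then show ?thesis by (intro exI[of _ 1]) auto
  next
    case False
    have "continuous_on K (\<lambda>x. (x - p) \<bullet> n)" by (intro continuous_intros)
    then obtain x0 where x0: "x0 \<in> K" "\<And>y. y \<in> K \<Longrightarrow> (x0 - p) \<bullet> n \<le> (y - p) \<bullet> n"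
      using continuous_attains_inf[OF \<open>compact K\<close> False] by blast
    have "x0 \<noteq> p" using x0(1) \<open>a > 0\<close> by (auto simp: K_def)
    then have pos: "(x0 - p) \<bullet> n > 0"
      using x0(1) nonneg[of x0] touch[of x0] by (auto simp: K_def less_le)
    have "norm (x - p) \<le> a" if "x \<in> closure \<Omega>" "(x - p) \<bullet> n \<le> (x0 - p) \<bullet> n / 2" for x
    proof (rule ccontr)
      assume "\<not> norm (x - p) \<le> a"
      then have "x \<in> K" using that(1) by (simp add: K_def dist_norm norm_minus_commute)
      then show False using x0(2)[of x] that(2) pos by simp
    qed
    then show ?thesis using pos by (intro exI[of _ "(x0 - p) \<bullet> n / 2"]) auto
  qed
qed

text \<open>
  A multiple of the Poisson kernel of the half-plane \<open>(x - p) \<bullet> n > \<delta> - a\<close> with pole at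
  \<open>p + (\<delta> - a) n\<close>. It is at least \<open>1\<close> on the chord \<open>(x - p) \<bullet> n = \<delta>\<close> within distance \<open>a\<close> of \<open>p\<close>, but
  has dropped to \<open>1 / 2\<close> at height \<open>3 * a\<close> above that chord.
\<close>

definition cap_barrier :: "real^2 \<Rightarrow> real^2 \<Rightarrow> real \<Rightarrow> real \<Rightarrow> real^2 \<Rightarrow> real" where
  "cap_barrier p n a \<delta> x =
     Re (of_real (2 * a) / ((cplx x - cplx p) * cnj (cplx n) - of_real \<delta> + of_real a))"

lemma cap_barrier:
  assumes n: "norm n = 1" and "a > 0"
  shows "harmonic_on (cap_barrier p n a \<delta>) {x. (x - p) \<bullet> n > \<delta>}"
    and "continuous_on {x. (x - p) \<bullet> n \<ge> \<delta>} (cap_barrier p n a \<delta>)"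
    and "(x - p) \<bullet> n \<ge> \<delta> \<Longrightarrow> cap_barrier p n a \<delta> x \<ge> 0"
    and "(x - p) \<bullet> n = \<delta> \<Longrightarrow> norm (x - p) \<le> a \<Longrightarrow> cap_barrier p n a \<delta> x \<ge> 1"
    and "cap_barrier p n a \<delta> (p + (\<delta> + 3 * a) *\<^sub>R n) = 1 / 2"
proof -
  define \<zeta> where "\<zeta> = (\<lambda>z. (z - cplx p) * cnj (cplx n) - of_real \<delta> + of_real a)"
  have Re\<zeta>: "Re (\<zeta> (cplx x)) = (x - p) \<bullet> n - \<delta> + a" for x
    unfolding \<zeta>_def inner_eq_Re_cplx cplx_diff by simp
  let ?b = "cap_barrier p n a \<delta>"
  have b: "?b x = Re (of_real (2 * a) / \<zeta> (cplx x))" for x by (simp add: cap_barrier_def \<zeta>_def)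
  have nz: "\<zeta> (cplx x) \<noteq> 0" if "(x - p) \<bullet> n \<ge> \<delta>" for x
    using Re\<zeta>[of x] that \<open>a > 0\<close> by force
  have bval: "?b x = 2 * a * Re (\<zeta> (cplx x)) / (norm (\<zeta> (cplx x)))\<^sup>2" for x
    unfolding b by (simp add: Re_divide cmod_power2)
  show "harmonic_on ?b {x. (x - p) \<bullet> n > \<delta>}"
    unfolding harmonic_on_def
  proof (intro exI conjI ballI)
    show "(\<lambda>z. of_real (2 * a) / \<zeta> z) holomorphic_on cplx ` {x. (x - p) \<bullet> n > \<delta>}"
    proof -
      have "\<zeta> z \<noteq> 0" if "z \<in> cplx ` {x. (x - p) \<bullet> n > \<delta>}" for z
        using nz[of "vec2 z"] that by simp
      moreover have "\<zeta> holomorphic_on cplx ` {x. (x - p) \<bullet> n > \<delta>}"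
        unfolding \<zeta>_def by (intro holomorphic_intros)
      ultimately show ?thesis by (intro holomorphic_intros)
    qed
  qed (rule b)
  have "continuous_on {x. (x - p) \<bullet> n \<ge> \<delta>} cplx"
    by (rule linear_continuous_on[OF bounded_linear_cplx])
  then show "continuous_on {x. (x - p) \<bullet> n \<ge> \<delta>} ?b"
    using nz unfolding cap_barrier_def \<zeta>_def by (intro continuous_intros) auto
  show "?b x \<ge> 0" if "(x - p) \<bullet> n \<ge> \<delta>"
    unfolding bval Re\<zeta> using that \<open>a > 0\<close> by simp
  show "?b x \<ge> 1" if "(x - p) \<bullet> n = \<delta>" "norm (x - p) \<le> a"
  proof -
    have "norm (\<zeta> (cplx x) + of_real \<delta> - of_real a) = norm (x - p)"
      using n by (simp add: \<zeta>_def norm_mult flip: cplx_diff)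
    then have "\<bar>Im (\<zeta> (cplx x))\<bar> \<le> a"
      using abs_Im_le_cmod[of "\<zeta> (cplx x) + of_real \<delta> - of_real a"] that(2) by simp
    then have "(Im (\<zeta> (cplx x)))\<^sup>2 \<le> a\<^sup>2" by (metis abs_ge_zero power2_abs power_mono)
    then have "(norm (\<zeta> (cplx x)))\<^sup>2 \<le> 2 * a * a"
      unfolding cmod_power2 Re\<zeta> that(1) by (simp add: power2_eq_square)
    moreover have "(norm (\<zeta> (cplx x)))\<^sup>2 > 0" using nz[of x] that(1) by simp
    ultimately show ?thesis unfolding bval Re\<zeta> that(1) by (simp add: le_divide_eq)
  qed
  have "cplx n * cnj (cplx n) = 1" using n by (simp add: complex_norm_square[symmetric])
  moreover have "(cplx p + s *\<^sub>R cplx n - cplx p) * cnj (cplx n) = of_real s * (cplx n * cnj (cplx n))" for s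
    by (simp add: scaleR_conv_of_real)
  ultimately have "\<zeta> (cplx (p + (\<delta> + 3 * a) *\<^sub>R n)) = of_real (4 * a)"
    unfolding \<zeta>_def cplx_add cplx_scaleR by simp
  then show "?b (p + (\<delta> + 3 * a) *\<^sub>R n) = 1 / 2"
    unfolding b using \<open>a > 0\<close> by (simp add: Re_divide_of_real flip: of_real_divide)
qed

text \<open>
  Let \<open>v\<close> be the torsion function of the domain above the chord at height \<open>\<delta>\<close>. The harmonic function
  \<open>u - v\<close> is at most \<open>G * \<delta>\<close> on the chord and zero on the remaining boundary, so by comparison with
  the barrier it is at most \<open>G * \<delta> / 2\<close> at height \<open>3 * a\<close> above the chord. Harnack's inequality carries
  a part \<open>\<delta> / (6 * a)\<close> of this gain down to the point \<open>x1\<close> at height \<open>\<delta>\<close> above the chord: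
  \<open>u x1 - v x1 \<le> G * \<delta> - G * \<delta>\<^sup>2 / (12 * a)\<close>. On the other hand the ball of radius \<open>2 * \<delta>\<close> around \<open>x1\<close> gives
  \<open>u x1 \<ge> 2 * G * \<delta> - 3 * \<delta>\<^sup>2\<close>. Hence \<open>v x1 > G * \<delta>\<close> as soon as \<open>36 * a < G\<close>, and \<open>a\<close> may be chosen freely
  because \<open>p\<close> is the only point of the closure on the support line.
\<close>

lemma cut_torsion_function_steep:
  assumes dom: "bounded_convex_domain \<Omega>" and u: "torsion_function \<Omega> u" and n: "norm n = 1"
    and nonneg: "\<And>x. x \<in> closure \<Omega> \<Longrightarrow> (x - p) \<bullet> n \<ge> 0"
    and touch: "\<And>x. x \<in> closure \<Omega> \<Longrightarrow> (x - p) \<bullet> n = 0 \<Longrightarrow> x = p"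
    and "G > 0" and ule: "\<And>x. x \<in> \<Omega> \<Longrightarrow> u x \<le> G * ((x - p) \<bullet> n)"
    and lim: "((\<lambda>t. u (p + t *\<^sub>R n) / t) \<longlongrightarrow> G) (at_right 0)"
    and "R > 0" and ball: "ball (p + R *\<^sub>R n) R \<subseteq> \<Omega>"
  obtains \<delta> where "bounded_convex_domain {x \<in> \<Omega>. (x - p) \<bullet> n > \<delta>}"
    "\<And>v. torsion_function {x \<in> \<Omega>. (x - p) \<bullet> n > \<delta>} v \<Longrightarrow>
       \<exists>x\<in>{x \<in> \<Omega>. (x - p) \<bullet> n > \<delta>}. G * ((x - p) \<bullet> n - \<delta>) < v x"
proof -
  have \<Omega>: "open \<Omega>" "convex \<Omega>" "bounded \<Omega>"
    using dom by (auto simp: bounded_convex_domain_def)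
  have contu: "continuous_on (closure \<Omega>) u" and bdu: "\<And>y. y \<in> frontier \<Omega> \<Longrightarrow> u y = 0"
    and harmu: "harmonic_on (\<lambda>y. u y + (norm y)\<^sup>2 / 4) \<Omega>"
    using u torsion_function_iff_harmonic[OF \<Omega>(1,2)] by auto
  \<comment> \<open>\<open>G / 40\<close> secures \<open>36 * a < G\<close>, and \<open>R / 8\<close> keeps the balls of radius \<open>3 * a\<close> and \<open>2 * \<delta>\<close> inside the interior ball.\<close>
  define a where "a = min (G / 40) (R / 8)"
  have a: "a > 0" "40 * a \<le> G" "8 * a \<le> R" using \<open>G > 0\<close> \<open>R > 0\<close> by (auto simp: a_def)
  obtain d where d: "d > 0" "\<And>x. x \<in> closure \<Omega> \<Longrightarrow> (x - p) \<bullet> n \<le> d \<Longrightarrow> norm (x - p) \<le> a"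
    using closure_near_touching_point[OF \<Omega>(3) nonneg touch a(1)] by blast
  define \<delta> where "\<delta> = min d a"
  have \<delta>: "\<delta> > 0" "\<delta> \<le> d" "\<delta> \<le> a" using a d by (auto simp: \<delta>_def)
  define \<Omega>' where "\<Omega>' = {x \<in> \<Omega>. (x - p) \<bullet> n > \<delta>}"
  have in\<Omega>: "p + t *\<^sub>R n \<in> \<Omega>" if "0 < t" "t < 2 * R" for t
  proof (rule subsetD[OF ball])
    have "norm (p + R *\<^sub>R n - (p + t *\<^sub>R n)) < R" unfolding inner_along_normal(2)[OF n] using that by auto
    then show "p + t *\<^sub>R n \<in> ball (p + R *\<^sub>R n) R" by (simp only: mem_ball dist_norm)
  qed
  have "{x. (x - p) \<bullet> n > \<delta>} = {x. n \<bullet> x > \<delta> + n \<bullet> p}"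
    by (auto simp: inner_diff_left inner_diff_right inner_commute)
  then have half: "open {x. (x - p) \<bullet> n > \<delta>}" "convex {x. (x - p) \<bullet> n > \<delta>}"
    by (simp_all add: open_halfspace_gt convex_halfspace_gt)
  have \<Omega>'_eq: "\<Omega>' = \<Omega> \<inter> {x. (x - p) \<bullet> n > \<delta>}" by (auto simp: \<Omega>'_def)
  define x1 where "x1 = p + (2 * \<delta>) *\<^sub>R n"
  have Yx1: "(x1 - p) \<bullet> n = 2 * \<delta>" unfolding x1_def by (rule inner_along_normal(1)[OF n])
  then have x1: "x1 \<in> \<Omega>'"
    using in\<Omega>[of "2 * \<delta>"] \<delta> a by (simp add: \<Omega>'_def x1_def)
  have \<Omega>': "open \<Omega>'" "convex \<Omega>'" "bounded \<Omega>'"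
    unfolding \<Omega>'_eq using \<Omega> half by (auto intro: convex_Int bounded_Int)
  have dom': "bounded_convex_domain \<Omega>'" using \<Omega>' x1 by (auto simp: bounded_convex_domain_def)
  have "\<exists>x\<in>\<Omega>'. G * ((x - p) \<bullet> n - \<delta>) < v x" if v: "torsion_function \<Omega>' v" for v
  proof (intro bexI[OF _ x1])
    have contv: "continuous_on (closure \<Omega>') v" and bdv: "\<And>y. y \<in> frontier \<Omega>' \<Longrightarrow> v y = 0"
      and harmv: "harmonic_on (\<lambda>y. v y + (norm y)\<^sup>2 / 4) \<Omega>'"
      using v torsion_function_iff_harmonic[OF \<Omega>'(1,2)] by auto
    have cl: "closure \<Omega>' \<subseteq> closure \<Omega>" by (intro closure_mono) (auto simp: \<Omega>'_def)
    have cl2: "closure \<Omega>' \<subseteq> {x. (x - p) \<bullet> n \<ge> \<delta>}"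
    proof (rule closure_minimal)
      show "closed {x. (x - p) \<bullet> n \<ge> \<delta>}"
        by (intro closed_Collect_le continuous_intros)
    qed (auto simp: \<Omega>'_def)
    define b where "b = cap_barrier p n a \<delta>"
    note barrier = cap_barrier[OF n a(1), where p = p and \<delta> = \<delta>, folded b_def]
    have uv: "harmonic_on (\<lambda>x. u x - v x) \<Omega>'"
    proof -
      have "harmonic_on (\<lambda>y. (u y + (norm y)\<^sup>2 / 4) - (v y + (norm y)\<^sup>2 / 4)) \<Omega>'"
        by (intro harmonic_on_diff harmv harmonic_on_subset[OF harmu]) (auto simp: \<Omega>'_def)
      then show ?thesis by simp
    qed
    \<comment> \<open>Used twice: with the barrier, and with the constant \<open>1\<close>, which makes \<open>G * \<delta> - (u - v)\<close> nonnegative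
      as Harnack's inequality requires.\<close>
    have compare: "u x - v x \<le> G * \<delta> * k x"
      if k: "harmonic_on k \<Omega>'" "continuous_on (closure \<Omega>') k" "\<And>y. y \<in> closure \<Omega>' \<Longrightarrow> k y \<ge> 0"
        "\<And>y. y \<in> closure \<Omega>' \<Longrightarrow> (y - p) \<bullet> n = \<delta> \<Longrightarrow> k y \<ge> 1" and x: "x \<in> \<Omega>'" for k x
    proof -
      have "G * \<delta> * k x - (u x - v x) \<ge> 0"
      proof (rule harmonic_max_principle[OF \<Omega>' _ _ _ x, where h = "\<lambda>x. G * \<delta> * k x - (u x - v x)"])
        show "harmonic_on (\<lambda>x. G * \<delta> * k x - (u x - v x)) \<Omega>'"
          by (intro harmonic_on_diff[OF harmonic_on_cmult[OF k(1)] uv])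
        show "continuous_on (closure \<Omega>') (\<lambda>x. G * \<delta> * k x - (u x - v x))"
          by (intro continuous_intros k(2) contv continuous_on_subset[OF contu cl])
        show "G * \<delta> * k y - (u y - v y) \<ge> 0" if y: "y \<in> frontier \<Omega>'" for y
        proof -
          have yc: "y \<in> closure \<Omega>'" and "y \<notin> \<Omega>'"
            using y \<Omega>'(1) by (auto simp: frontier_def interior_open)
          then consider "(y - p) \<bullet> n = \<delta>" | "y \<notin> \<Omega>" using cl2 by (force simp: \<Omega>'_def)
          then have "u y \<le> G * \<delta> * k y"
          proof cases
            case 1
            have "u y \<le> G * \<delta>"
            proof (cases "y \<in> \<Omega>")
              case False
              then have "y \<in> frontier \<Omega>" using yc cl \<Omega>(1) by (auto simp: frontier_def interior_open)
              then show ?thesis using bdu \<delta> \<open>G > 0\<close> by simp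
            qed (use ule[of y] 1 in simp)
            also have "\<dots> \<le> G * \<delta> * k y"
              using k(4)[OF yc 1] \<delta> \<open>G > 0\<close> by simp
            finally show ?thesis .
          next
            case 2
            then have "y \<in> frontier \<Omega>" using yc cl \<Omega>(1) by (auto simp: frontier_def interior_open)
            then show ?thesis using bdu k(3)[OF yc] \<delta> \<open>G > 0\<close> by simp
          qed
          then show ?thesis using bdv[OF y] by simp
        qed
      qed
      then show ?thesis by simp
    qed
    have uv_le: "u x - v x \<le> G * \<delta>" if "x \<in> \<Omega>'" for x
      using compare[of "\<lambda>_. 1" x] that harmonic_on_const[of 1 \<Omega>'] by simp
    define c where "c = p + (\<delta> + 3 * a) *\<^sub>R n"
    have ballc: "ball c (3 * a) \<subseteq> \<Omega>'"
    proof
      fix x assume x: "x \<in> ball c (3 * a)"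
      have "ball c (3 * a) \<subseteq> ball (p + R *\<^sub>R n) R"
        unfolding c_def using \<delta> a by (intro internally_tangent_ball_subset[OF n]) auto
      then have "x \<in> \<Omega>" using x ball by blast
      moreover have "(x - p) \<bullet> n > \<delta>"
      proof -
        have "(c - p) \<bullet> n = \<delta> + 3 * a" unfolding c_def by (rule inner_along_normal(1)[OF n])
        moreover have "(c - x) \<bullet> n \<le> norm (c - x)"
          using norm_cauchy_schwarz[of "c - x" n] n by simp
        moreover have "norm (c - x) < 3 * a" using x by (simp add: dist_norm)
        ultimately show ?thesis by (simp add: inner_diff_left)
      qed
      ultimately show "x \<in> \<Omega>'" by (simp add: \<Omega>'_def)
    qed
    then have c\<Omega>': "c \<in> \<Omega>'" using a(1) by auto
    have "u c - v c \<le> G * \<delta> * b c"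
    proof (rule compare[OF _ _ _ _ c\<Omega>'])
      show "harmonic_on b \<Omega>'" by (rule harmonic_on_subset[OF barrier(1)]) (auto simp: \<Omega>'_def)
      show "continuous_on (closure \<Omega>') b" by (rule continuous_on_subset[OF barrier(2) cl2])
      show "b y \<ge> 0" if "y \<in> closure \<Omega>'" for y using that cl2 by (intro barrier(3)) auto
      show "b y \<ge> 1" if "y \<in> closure \<Omega>'" "(y - p) \<bullet> n = \<delta>" for y
        using that cl d(2)[of y] \<delta>(2) by (intro barrier(4)) auto
    qed
    then have hc: "G * \<delta> / 2 \<le> G * \<delta> - (u c - v c)"
      using barrier(5) by (simp add: c_def)
    have "(G * \<delta> - (u c - v c)) * (3 * a - dist c x1) \<le> (G * \<delta> - (u x1 - v x1)) * (3 * a + dist c x1)"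
    proof (rule harmonic_Harnack[where h = "\<lambda>x. G * \<delta> - (u x - v x)"])
      show "harmonic_on (\<lambda>x. G * \<delta> - (u x - v x)) (ball c (3 * a))"
        by (intro harmonic_on_diff harmonic_on_const harmonic_on_subset[OF uv ballc])
      show "G * \<delta> - (u x - v x) \<ge> 0" if "x \<in> ball c (3 * a)" for x
        using uv_le[of x] that ballc by auto
      have "dist c x1 = \<bar>\<delta> + 3 * a - 2 * \<delta>\<bar>"
        unfolding dist_norm c_def x1_def by (rule inner_along_normal(2)[OF n])
      then show "x1 \<in> ball c (3 * a)" using \<delta> a by simp
    qed (use a in auto)
    moreover have "dist c x1 = 3 * a - \<delta>"
    proof -
      have "dist c x1 = \<bar>\<delta> + 3 * a - 2 * \<delta>\<bar>"
        unfolding dist_norm c_def x1_def by (rule inner_along_normal(2)[OF n])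
      then show ?thesis using \<delta> a by simp
    qed
    ultimately have H: "(G * \<delta> - (u c - v c)) * \<delta> \<le> (G * \<delta> - (u x1 - v x1)) * (6 * a - \<delta>)"
      by (simp add: algebra_simps)
    have "G * \<delta> / 2 * \<delta> \<le> (G * \<delta> - (u c - v c)) * \<delta>"
      using hc \<delta> by (intro mult_right_mono) auto
    also note H
    also have "(G * \<delta> - (u x1 - v x1)) * (6 * a - \<delta>) \<le> (G * \<delta> - (u x1 - v x1)) * (6 * a)"
      using uv_le[OF x1] \<delta> by (intro mult_left_mono) auto
    finally have low: "G * \<delta> / 2 * \<delta> \<le> (G * \<delta> - (u x1 - v x1)) * (6 * a)" .
    have "u x1 \<ge> G * (2 * \<delta>) - 3 * (2 * \<delta>)\<^sup>2 / 4"
      unfolding x1_def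
    proof (rule torsion_function_ge_of_interior_ball[OF _ _ n _ lim])
      have "ball (p + (2 * \<delta>) *\<^sub>R n) (2 * \<delta>) \<subseteq> ball (p + R *\<^sub>R n) R"
        using \<delta> a by (intro internally_tangent_ball_subset[OF n]) auto
      then have sub: "ball (p + (2 * \<delta>) *\<^sub>R n) (2 * \<delta>) \<subseteq> \<Omega>" using ball by blast
      show "harmonic_on (\<lambda>x. u x + (norm x)\<^sup>2 / 4) (ball (p + (2 * \<delta>) *\<^sub>R n) (2 * \<delta>))"
        by (rule harmonic_on_subset[OF harmu sub])
      show "u x \<le> G * ((x - p) \<bullet> n)" if "x \<in> ball (p + (2 * \<delta>) *\<^sub>R n) (2 * \<delta>)" for x
        using that sub by (intro ule) auto
    qed (use \<delta> in auto)
    then have ux1: "u x1 \<ge> 2 * G * \<delta> - 3 * \<delta>\<^sup>2" by (simp add: power2_eq_square)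
    have "3 * \<delta>\<^sup>2 * (6 * a) < G * \<delta> / 2 * \<delta>"
    proof -
      have "36 * a < G" using a by simp
      then have "36 * a * \<delta>\<^sup>2 < G * \<delta>\<^sup>2" using \<delta> by (intro mult_strict_right_mono) auto
      then show ?thesis by (simp add: power2_eq_square algebra_simps)
    qed
    then have "3 * \<delta>\<^sup>2 * (6 * a) < (G * \<delta> - (u x1 - v x1)) * (6 * a)"
      using low by (rule less_le_trans)
    then have "3 * \<delta>\<^sup>2 < G * \<delta> - (u x1 - v x1)" using a(1) by simp
    then show "G * ((x1 - p) \<bullet> n - \<delta>) < v x1"
      unfolding Yx1 using ux1 by (simp add: algebra_simps)
  qed
  then show ?thesis using that[of \<delta>] dom' unfolding \<Omega>'_def by blast
qed

section \<open>The boundary near a point\<close>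

lemma orthonormal_expansion:
  fixes a b x :: "real^2"
  assumes "norm a = 1" "norm b = 1" "a \<bullet> b = 0"
  shows "x = (x \<bullet> a) *\<^sub>R a + (x \<bullet> b) *\<^sub>R b"
proof -
  have a: "a $ 1 * a $ 1 + a $ 2 * a $ 2 = 1" and b: "b $ 1 * b $ 1 + b $ 2 * b $ 2 = 1"
    and ab: "a $ 1 * b $ 1 + a $ 2 * b $ 2 = 0"
    using assms by (simp_all add: norm_eq_1 inner_vec2)
  define y where "y = x - (x \<bullet> a) *\<^sub>R a - (x \<bullet> b) *\<^sub>R b"
  have ya: "y \<bullet> a = 0" and yb: "y \<bullet> b = 0"
    using assms inner_commute[of a b] by (simp_all add: y_def inner_diff_left norm_eq_1)
  define D where "D = a $ 1 * b $ 2 - a $ 2 * b $ 1"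
  have "D * D = (a $ 1 * a $ 1 + a $ 2 * a $ 2) * (b $ 1 * b $ 1 + b $ 2 * b $ 2)
      - (a $ 1 * b $ 1 + a $ 2 * b $ 2) * (a $ 1 * b $ 1 + a $ 2 * b $ 2)"
    by (simp add: D_def algebra_simps)
  then have "D \<noteq> 0" unfolding a b ab by auto
  moreover have "y $ 1 * D = b $ 2 * (y \<bullet> a) - a $ 2 * (y \<bullet> b)"
    "y $ 2 * D = a $ 1 * (y \<bullet> b) - b $ 1 * (y \<bullet> a)"
    by (simp_all add: D_def inner_vec2 algebra_simps)
  ultimately have "y = 0" using ya yb by (simp add: vec_eq_iff forall_2)
  then show ?thesis by (simp add: y_def algebra_simps)
qed

lemma Ck_on_mono:
  assumes "Ck_on k I f" "j \<le> k"
  shows "Ck_on j I f"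
proof (cases "j = k")
  case False
  then have "j < k" using assms by simp
  then have "(deriv ^^ j) f differentiable (at x)" if "x \<in> I" for x
    using assms that by (auto simp: Ck_on_def)
  then have "continuous_on I ((deriv ^^ j) f)"
    by (intro continuous_at_imp_continuous_on ballI differentiable_imp_continuous_within) auto
  then show ?thesis using assms by (auto simp: Ck_on_def)
qed (use assms in simp)

lemma boundary_of_class_C2_graph:
  assumes "boundary_of_class (2 + e) \<Omega>" "e > 0" "p \<in> frontier \<Omega>"
  obtains a b r f where "local_graph \<Omega> p a b r f" "Ck_on 2 {-r<..<r} f"
proof -
  obtain a b r f where "local_graph \<Omega> p a b r f" "holder_class (2 + e) {-r<..<r} f"
    using assms unfolding boundary_of_class_def by blast
  moreover have "2 \<le> nat \<lfloor>2 + e\<rfloor>" using \<open>e > 0\<close> by linarith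
  ultimately show ?thesis using that Ck_on_mono unfolding holder_class_def by blast
qed

lemma Ck_on_2_continuous:
  assumes "Ck_on 2 {-r<..<r} f"
  shows "continuous_on {-r<..<r} f"
proof -
  have "Ck_on 0 {-r<..<r} f" using assms by (rule Ck_on_mono) simp
  then show ?thesis by (simp add: Ck_on_def)
qed

lemma local_graph_coordinate:
  assumes "local_graph \<Omega> p a b r f" "x \<in> ball p r"
  shows "(x - p) \<bullet> a \<in> {-r<..<r}"
proof -
  have "\<bar>(x - p) \<bullet> a\<bar> \<le> norm (x - p)"
    using Cauchy_Schwarz_ineq2[of "x - p" a] assms(1) by (simp add: local_graph_def)
  also have "\<dots> < r" using assms(2) by (simp add: dist_norm norm_minus_commute)
  finally show ?thesis by auto
qed

lemma local_graph_frontier: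
  assumes \<Omega>: "open \<Omega>" and lg: "local_graph \<Omega> p a b r f" and cont: "continuous_on {-r<..<r} f"
    and x: "x \<in> frontier \<Omega>" "x \<in> ball p r"
  shows "f ((x - p) \<bullet> a) = (x - p) \<bullet> b"
proof (rule antisym)
  have "x \<notin> \<Omega>" using x(1) \<Omega> by (simp add: frontier_def interior_open)
  then show "(x - p) \<bullet> b \<le> f ((x - p) \<bullet> a)"
    using lg x(2) by (auto simp: local_graph_def not_less)
  have "x \<in> closure \<Omega>" using x(1) by (simp add: frontier_def)
  then obtain X where X: "\<And>k. X k \<in> \<Omega>" "X \<longlonglongrightarrow> x" by (auto simp: closure_sequential)
  have "eventually (\<lambda>k. X k \<in> ball p r) sequentially"
    using X(2) x(2) by (intro topological_tendstoD[OF X(2)]) auto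
  then have ev: "eventually (\<lambda>k. f ((X k - p) \<bullet> a) \<le> (X k - p) \<bullet> b) sequentially"
  proof eventually_elim
    case (elim k)
    then have "f ((X k - p) \<bullet> a) < (X k - p) \<bullet> b" using lg X(1)[of k] unfolding local_graph_def by blast
    then show ?case by (rule less_imp_le)
  qed
  have "isCont f ((x - p) \<bullet> a)"
    using cont local_graph_coordinate[OF lg x(2)] by (simp add: continuous_on_eq_continuous_at)
  then have l1: "(\<lambda>k. f ((X k - p) \<bullet> a)) \<longlonglongrightarrow> f ((x - p) \<bullet> a)"
    by (rule isCont_tendsto_compose) (intro tendsto_intros X(2))
  have l2: "(\<lambda>k. (X k - p) \<bullet> b) \<longlonglongrightarrow> (x - p) \<bullet> b" by (intro tendsto_intros X(2))
  show "f ((x - p) \<bullet> a) \<le> (x - p) \<bullet> b"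
    using tendsto_le[OF _ l2 l1 ev] by simp
qed

text \<open>
  Where the boundary contains a segment, the graph function is linear.
\<close>

lemma zero_curvature_on_segment:
  assumes \<Omega>: "open \<Omega>" and q: "q \<in> frontier \<Omega>" and cls: "boundary_of_class (2 + e) \<Omega>" "e > 0"
    and "d \<noteq> 0" "s > 0" and seg: "\<And>t. \<bar>t\<bar> < s \<Longrightarrow> q + t *\<^sub>R d \<in> frontier \<Omega>"
  shows "has_boundary_curvature \<Omega> q 0"
proof -
  obtain a b r f where lg: "local_graph \<Omega> q a b r f" and C2: "Ck_on 2 {-r<..<r} f"
    using boundary_of_class_C2_graph[OF cls q] by blast
  have r: "r > 0" and ab: "norm a = 1" "norm b = 1" "a \<bullet> b = 0" using lg by (auto simp: local_graph_def)
  define \<alpha> where "\<alpha> = d \<bullet> a"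
  define \<beta> where "\<beta> = d \<bullet> b"
  define s' where "s' = min s (r / norm d)"
  have s': "s' > 0" "s' \<le> s" "s' * norm d \<le> r" using r \<open>s > 0\<close> \<open>d \<noteq> 0\<close>
    by (auto simp: s'_def min_def field_simps)
  have graph: "f (t * \<alpha>) = t * \<beta>" if t: "\<bar>t\<bar> < s'" for t
  proof -
    have "\<bar>t\<bar> * norm d < s' * norm d" using t \<open>d \<noteq> 0\<close> by simp
    then have "q + t *\<^sub>R d \<in> ball q r" using s'(3) by (simp add: dist_norm)
    then have "f ((q + t *\<^sub>R d - q) \<bullet> a) = (q + t *\<^sub>R d - q) \<bullet> b"
      using t s' by (intro local_graph_frontier[OF \<Omega> lg Ck_on_2_continuous[OF C2] seg]) auto
    then show ?thesis by (simp add: \<alpha>_def \<beta>_def)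
  qed
  have "\<alpha> \<noteq> 0"
  proof
    assume "\<alpha> = 0"
    with graph[of 0] graph[of "s' / 2"] s' have "\<beta> = 0" by auto
    have "d = \<alpha> *\<^sub>R a + \<beta> *\<^sub>R b" unfolding \<alpha>_def \<beta>_def by (rule orthonormal_expansion[OF ab])
    then show False using \<open>\<alpha> = 0\<close> \<open>\<beta> = 0\<close> \<open>d \<noteq> 0\<close> by simp
  qed
  define I where "I = {- (s' * \<bar>\<alpha>\<bar>)<..<s' * \<bar>\<alpha>\<bar>}"
  have I: "open I" "0 \<in> I" using s' \<open>\<alpha> \<noteq> 0\<close> by (auto simp: I_def)
  have lin: "f x = \<beta> / \<alpha> * x" if "x \<in> I" for x
  proof -
    have "\<bar>x\<bar> < s' * \<bar>\<alpha>\<bar>" using that by (auto simp: I_def)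
    then have "\<bar>x / \<alpha>\<bar> < s'" using \<open>\<alpha> \<noteq> 0\<close> by (simp add: abs_divide divide_less_eq)
    from graph[OF this] show ?thesis using \<open>\<alpha> \<noteq> 0\<close> by simp
  qed
  have d1: "deriv f x = \<beta> / \<alpha>" if "x \<in> I" for x
  proof (rule DERIV_imp_deriv)
    have "((\<lambda>x. \<beta> / \<alpha> * x) has_field_derivative \<beta> / \<alpha>) (at x)"
      using \<open>\<alpha> \<noteq> 0\<close> by (auto intro!: derivative_eq_intros)
    then show "(f has_field_derivative \<beta> / \<alpha>) (at x)"
      by (rule has_field_derivative_transform_within_open[OF _ I(1) that]) (simp add: lin)
  qed
  have "deriv (deriv f) 0 = 0"
  proof (rule DERIV_imp_deriv)
    have "((\<lambda>x. \<beta> / \<alpha>) has_field_derivative 0) (at 0)" by simp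
    then show "(deriv f has_field_derivative 0) (at 0)"
      by (rule has_field_derivative_transform_within_open[OF _ I(1,2)]) (simp add: d1)
  qed
  then show ?thesis
    unfolding has_boundary_curvature_def
    by (intro exI[of _ a] exI[of _ b] exI[of _ r] exI[of _ f]) (use lg C2 in simp)
qed

lemma C2_quadratic_upper_bound:
  assumes C2: "Ck_on 2 {-r<..<r} f" and r: "r > 0"
  obtains K where "K > 0" "\<And>t. \<bar>t\<bar> \<le> r / 2 \<Longrightarrow> f t \<le> f 0 + deriv f 0 * t + K * t\<^sup>2"
proof -
  have sub: "{- (r/2)..r/2} \<subseteq> {-r<..<r}" using r by auto
  have "continuous_on {- (r/2)..r/2} (\<lambda>x. (deriv ^^ 2) f x)"
    using C2 continuous_on_subset[OF _ sub] by (auto simp: Ck_on_def)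
  then have "bounded ((deriv ^^ 2) f ` {- (r/2)..r/2})"
    by (intro compact_imp_bounded compact_continuous_image) auto
  then obtain K where K: "K > 0" "\<And>t. t \<in> {- (r/2)..r/2} \<Longrightarrow> \<bar>(deriv ^^ 2) f t\<bar> \<le> K"
    by (auto simp: bounded_pos)
  have diff: "DERIV ((deriv ^^ m) f) t :> (deriv ^^ Suc m) f t" if "m < 2" "t \<in> {- (r/2)..r/2}" for m t
  proof -
    have "(deriv ^^ m) f differentiable (at t)"
      using C2 that sub by (auto simp: Ck_on_def)
    then show ?thesis by (simp add: DERIV_deriv_iff_real_differentiable)
  qed
  have "f t \<le> f 0 + deriv f 0 * t + K * t\<^sup>2" if t: "\<bar>t\<bar> \<le> r / 2" for t
  proof (cases "t = 0")
    case False
    have t': "- (r / 2) \<le> t \<and> t * 2 \<le> r" using t by linarith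
    obtain \<tau> where \<tau>: "if t < 0 then t < \<tau> \<and> \<tau> < 0 else 0 < \<tau> \<and> \<tau> < t"
      and f: "f t = (\<Sum>m<2. (deriv ^^ m) f 0 / fact m * (t - 0) ^ m) + (deriv ^^ 2) f \<tau> / fact 2 * (t - 0) ^ 2"
      using Taylor[of 2 "\<lambda>m. (deriv ^^ m) f" f "- (r/2)" "r/2" 0 t] diff False t' r by auto
    have "(deriv ^^ 2) f \<tau> \<le> K" using K(2)[of \<tau>] \<tau> t r by (auto split: if_splits)
    then have "(deriv ^^ 2) f \<tau> / 2 * t\<^sup>2 \<le> K * t\<^sup>2" using K(1) by (intro mult_right_mono) auto
    then show ?thesis using f by (simp add: numeral_2_eq_2)
  qed simp
  then show ?thesis using K(1) that by blast
qed

text \<open>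
  Near \<open>p\<close> the domain contains everything above the parabola \<open>m * t + K * t\<^sup>2\<close>, where \<open>m\<close> is the slope of
  the graph at \<open>p\<close>. The points just above the parabola on both sides of \<open>p\<close> satisfy \<open>(x - p) \<bullet> n > 0\<close>, which
  forces \<open>n\<close> to be orthogonal to the tangent, and a ball of radius at most \<open>1 / (2 * K)\<close> that touches the
  tangent at \<open>p\<close> lies above the parabola.
\<close>

lemma interior_ball_at_C2_point:
  fixes n :: "real^2"
  assumes \<Omega>: "open \<Omega>" and p: "p \<in> frontier \<Omega>"
    and lg: "local_graph \<Omega> p a b r f" and C2: "Ck_on 2 {-r<..<r} f"
    and n: "norm n = 1" "\<And>x. x \<in> \<Omega> \<Longrightarrow> (x - p) \<bullet> n > 0"
  obtains R where "R > 0" "ball (p + R *\<^sub>R n) R \<subseteq> \<Omega>"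
proof -
  have r: "r > 0" and ab: "norm a = 1" "norm b = 1" "a \<bullet> b = 0"
    and graph: "\<And>x. x \<in> ball p r \<Longrightarrow> x \<in> \<Omega> \<longleftrightarrow> f ((x - p) \<bullet> a) < (x - p) \<bullet> b"
    using lg by (auto simp: local_graph_def)
  have f0: "f 0 = 0"
    using local_graph_frontier[OF \<Omega> lg Ck_on_2_continuous[OF C2] p] r by simp
  define m where "m = deriv f 0"
  obtain K where K: "K > 0" "\<And>t. \<bar>t\<bar> \<le> r / 2 \<Longrightarrow> f t \<le> m * t + K * t\<^sup>2"
    using C2_quadratic_upper_bound[OF C2 r] unfolding f0 m_def by auto
  have aa: "a \<bullet> a = 1" "b \<bullet> b = 1" "b \<bullet> a = 0" using ab by (simp_all add: norm_eq_1 inner_commute)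
  \<comment> \<open>\<open>K + 1\<close> in place of \<open>K\<close> puts the points strictly above the graph.\<close>
  have above: "t * (a \<bullet> n) + (m * t + (K + 1) * t\<^sup>2) * (b \<bullet> n) > 0"
    if t: "t \<noteq> 0" "\<bar>t\<bar> \<le> r / 2" "\<bar>t\<bar> + \<bar>m * t + (K + 1) * t\<^sup>2\<bar> < r" for t
  proof -
    define x where "x = p + (t *\<^sub>R a + (m * t + (K + 1) * t\<^sup>2) *\<^sub>R b)"
    have "norm (t *\<^sub>R a + (m * t + (K + 1) * t\<^sup>2) *\<^sub>R b) \<le> \<bar>t\<bar> + \<bar>m * t + (K + 1) * t\<^sup>2\<bar>"
      using norm_triangle_ineq[of "t *\<^sub>R a" "(m * t + (K + 1) * t\<^sup>2) *\<^sub>R b"] ab by simp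
    then have "x \<in> ball p r" unfolding mem_ball dist_commute[of p] using t(3) by (simp add: x_def dist_norm)
    moreover have "f ((x - p) \<bullet> a) < (x - p) \<bullet> b"
    proof -
      have "f t \<le> m * t + K * t\<^sup>2" using K(2) t by simp
      also have "\<dots> < m * t + (K + 1) * t\<^sup>2" using t(1) by (simp add: algebra_simps)
      finally show ?thesis using aa ab(3) by (simp add: x_def inner_add_left)
    qed
    ultimately have "x \<in> \<Omega>" using graph by blast
    from n(2)[OF this] show ?thesis by (simp add: x_def inner_add_left)
  qed
  have small: "\<forall>\<^sub>F t in at 0. t \<noteq> 0 \<and> \<bar>t\<bar> \<le> r / 2 \<and> \<bar>t\<bar> + \<bar>m * t + (K + 1) * t\<^sup>2\<bar> < r"
  proof (intro eventually_conj)
    have "((\<lambda>t::real. \<bar>t\<bar> + \<bar>m * t + (K + 1) * t\<^sup>2\<bar>) \<longlongrightarrow> \<bar>0\<bar> + \<bar>m * 0 + (K + 1) * 0\<^sup>2\<bar>) (at 0)"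
      by (intro tendsto_intros)
    then show "\<forall>\<^sub>F t in at 0. \<bar>t\<bar> + \<bar>m * t + (K + 1) * t\<^sup>2\<bar> < r" using r by (intro order_tendstoD) auto
    show "\<forall>\<^sub>F t in at 0. \<bar>t::real\<bar> \<le> r / 2"
      using r by (auto simp: eventually_at dist_real_def intro!: exI[of _ "r/2"])
  qed (auto simp: eventually_at intro: exI[of _ 1])
  have tangent: "a \<bullet> n + m * (b \<bullet> n) = 0"
  proof -
    define w where "w = (\<lambda>t. a \<bullet> n + (m + (K + 1) * t) * (b \<bullet> n))"
    have "(w \<longlongrightarrow> a \<bullet> n + (m + (K + 1) * 0) * (b \<bullet> n)) (at 0)"
      unfolding w_def by (intro tendsto_intros)
    then have lim: "(w \<longlongrightarrow> a \<bullet> n + m * (b \<bullet> n)) (at 0)" by simp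
    have ev: "\<forall>\<^sub>F t in at 0. t * w t > 0"
      using small by eventually_elim (use above in \<open>auto simp: w_def power2_eq_square algebra_simps\<close>)
    have "\<forall>\<^sub>F t in at_right 0. w t \<ge> 0"
      using eventually_at_split[of _ "0::real"] ev eventually_at_right_less[of 0]
      by (auto elim!: eventually_elim2 simp: zero_less_mult_iff)
    then have "a \<bullet> n + m * (b \<bullet> n) \<ge> 0"
      using lim by (intro tendsto_lowerbound[of w _ "at_right 0"]) (auto simp: filterlim_at_split)
    moreover have "\<forall>\<^sub>F t in at_left 0. w t \<le> 0"
    proof -
      have "\<forall>\<^sub>F t in at_left (0::real). t < 0" by (auto simp: eventually_at_filter)
      moreover have "\<forall>\<^sub>F t in at_left 0. t * w t > 0" using ev by (simp add: eventually_at_split)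
      ultimately show ?thesis by eventually_elim (auto simp: zero_less_mult_iff)
    qed
    then have "a \<bullet> n + m * (b \<bullet> n) \<le> 0"
      using lim by (intro tendsto_upperbound[of w _ "at_left 0"]) (auto simp: filterlim_at_split)
    ultimately show ?thesis by simp
  qed
  have bn: "b \<bullet> n > 0"
  proof -
    have "p + (r / 2) *\<^sub>R b \<in> ball p r" using r ab by (simp add: dist_norm)
    then have "p + (r / 2) *\<^sub>R b \<in> \<Omega>" using graph aa r f0 by simp
    from n(2)[OF this] show ?thesis using r by (simp add: zero_less_mult_iff)
  qed
  have bn1: "b \<bullet> n \<le> 1" using norm_cauchy_schwarz[of b n] ab n(1) by simp
  define R where "R = min (r / 4) (1 / (2 * K))"
  have R: "R > 0" "4 * R \<le> r" "2 * R * K \<le> 1" using r K(1) by (auto simp: R_def min_def field_simps)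
  have "ball (p + R *\<^sub>R n) R \<subseteq> \<Omega>"
  proof
    fix x assume x: "x \<in> ball (p + R *\<^sub>R n) R"
    define X where "X = x - p"
    define \<xi> where "\<xi> = X \<bullet> a"
    define \<eta> where "\<eta> = X \<bullet> b"
    have "norm (X - R *\<^sub>R n) < R" using x by (simp add: X_def dist_norm norm_minus_commute algebra_simps)
    then have "(norm (X - R *\<^sub>R n))\<^sup>2 < R\<^sup>2" by (intro power_strict_mono) auto
    moreover have "(norm (X - R *\<^sub>R n))\<^sup>2 = (norm X)\<^sup>2 - 2 * R * (X \<bullet> n) + R\<^sup>2"
      unfolding power2_norm_eq_inner using n(1) inner_commute[of n X]
      by (simp add: inner_diff_left inner_diff_right norm_eq_1 power2_eq_square algebra_simps)
    ultimately have XX: "(norm X)\<^sup>2 < 2 * R * (X \<bullet> n)" by simp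
    have "norm X \<le> norm (X - R *\<^sub>R n) + norm (R *\<^sub>R n)"
      by (metis norm_triangle_sub add.commute)
    then have nX: "norm X < 2 * R" using \<open>norm (X - R *\<^sub>R n) < R\<close> R(1) n(1) by simp
    have \<xi>: "\<bar>\<xi>\<bar> \<le> norm X" using Cauchy_Schwarz_ineq2[of X a] ab by (simp add: \<xi>_def)
    have Xn: "X \<bullet> n = (b \<bullet> n) * (\<eta> - m * \<xi>)"
    proof -
      have "X \<bullet> n = \<xi> * (a \<bullet> n) + \<eta> * (b \<bullet> n)"
        unfolding \<xi>_def \<eta>_def by (subst orthonormal_expansion[OF ab, of X]) (simp add: inner_add_left)
      also have "a \<bullet> n = - m * (b \<bullet> n)" using tangent by simp
      finally show ?thesis by (simp add: algebra_simps)
    qed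
    have "0 < 2 * R * (X \<bullet> n)" using XX by (smt (verit) zero_le_power2)
    then have Xnpos: "X \<bullet> n > 0" using R(1) by (simp add: zero_less_mult_iff)
    then have pos: "\<eta> - m * \<xi> > 0" unfolding Xn using bn by (simp add: zero_less_mult_iff)
    have "f \<xi> \<le> m * \<xi> + K * \<xi>\<^sup>2" using K(2)[of \<xi>] \<xi> nX R by simp
    also have "K * \<xi>\<^sup>2 < \<eta> - m * \<xi>"
    proof -
      have "\<xi>\<^sup>2 \<le> (norm X)\<^sup>2" using \<xi> by (metis abs_ge_zero power2_abs power_mono)
      then have "K * \<xi>\<^sup>2 < K * (2 * R * (X \<bullet> n))" using XX K(1) by (intro mult_strict_left_mono) auto
      also have "\<dots> = (2 * R * K) * (X \<bullet> n)" by simp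
      also have "\<dots> \<le> 1 * (X \<bullet> n)" using R(3) Xnpos by (intro mult_right_mono) auto
      also have "\<dots> \<le> 1 * (\<eta> - m * \<xi>)" unfolding Xn using bn1 pos by (simp add: mult_left_le_one_le bn less_imp_le)
      finally show ?thesis by simp
    qed
    finally have "f ((x - p) \<bullet> a) < (x - p) \<bullet> b" by (simp add: \<xi>_def \<eta>_def X_def)
    moreover have "x \<in> ball p r" using nX R by (simp add: X_def dist_norm norm_minus_commute)
    ultimately show "x \<in> \<Omega>" using graph by blast
  qed
  then show ?thesis using R(1) that by blast
qed

section \<open>Maximal domains are flat at the point of maximal gradient\<close>

text \<open>
  With gradient bound \<open>0\<close> the torsion function could not be positive.
\<close>

lemma grad_norm_pos:
  assumes dom: "bounded_convex_domain \<Omega>" and u: "torsion_function \<Omega> u"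
  shows "grad_norm \<Omega> u > 0"
proof (rule ccontr)
  assume "\<not> grad_norm \<Omega> u > 0"
  then have 0: "grad_norm \<Omega> u \<le> ennreal 0" by simp
  have \<Omega>: "open \<Omega>" "convex \<Omega>" "bounded \<Omega>" using dom by (auto simp: bounded_convex_domain_def)
  obtain x where x: "x \<in> \<Omega>" using dom by (auto simp: bounded_convex_domain_def)
  have C2: "C2_on \<Omega> u" using u by (simp add: torsion_function_def)
  obtain B where B: "\<And>y. y \<in> closure \<Omega> \<Longrightarrow> norm y \<le> B"
    using bounded_closure[OF \<Omega>(3)] by (auto simp: bounded_iff)
  have "u x \<le> 0 * ((x - 0) \<bullet> axis 1 1 - (- B))"
  proof (rule torsion_function_le_of_grad_le[OF \<Omega> u _ _ _ _ x])
    show "norm (grad u (at y)) \<le> 0" if "y \<in> \<Omega>" for y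
      using grad_le_of_grad_norm_le[OF \<Omega>(1) C2 0 _ that] by simp
    show "- B \<le> (y - 0) \<bullet> axis 1 1" if "y \<in> closure \<Omega>" for y
      using B[OF that] Cauchy_Schwarz_ineq2[of y "axis 1 1"] by (simp add: abs_le_iff)
  qed auto
  then show False using torsion_function_pos[OF \<Omega> u x] by simp
qed

theorem theorem1p2:
  fixes \<Omega> :: "(real^2) set" and u :: "real^2 \<Rightarrow> real"
  assumes "bounded_convex_domain \<Omega>"
    and "torsion_function \<Omega> u"
    and "maximizes area_functional \<Omega> u \<or> maximizes perimeter_functional \<Omega> u"
  shows "\<not> (\<exists>\<epsilon>>0. boundary_of_class (2 + \<epsilon>) \<Omega>) \<or>
         (\<forall>p. max_gradient_point \<Omega> u p \<longrightarrow>
            (\<forall>U. open U \<and> p \<in> U \<longrightarrow>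
               infinite {q \<in> U \<inter> frontier \<Omega>. has_boundary_curvature \<Omega> q 0}))"
proof (rule ccontr)
  assume "\<not> ?thesis"
  then obtain e p U where e: "e > 0" and cls: "boundary_of_class (2 + e) \<Omega>"
    and mg: "max_gradient_point \<Omega> u p" and U: "open U" "p \<in> U"
    and fin: "finite {q \<in> U \<inter> frontier \<Omega>. has_boundary_curvature \<Omega> q 0}"
    by blast
  have \<Omega>: "open \<Omega>" "convex \<Omega>" "bounded \<Omega>" "\<Omega> \<noteq> {}"
    using assms(1) by (auto simp: bounded_convex_domain_def)
  have C2: "C2_on \<Omega> u" and bd: "\<And>x. x \<in> frontier \<Omega> \<Longrightarrow> u x = 0"
    using assms(2) by (auto simp: torsion_function_def)
  have p: "p \<in> frontier \<Omega>" and diff: "u differentiable (at p within closure \<Omega>)"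
    using mg by (auto simp: max_gradient_point_def)
  have pc: "p \<in> closure \<Omega>" using p by (simp add: frontier_def)
  define g where "g = grad u (at p within closure \<Omega>)"
  define G where "G = norm g"
  have GN: "grad_norm \<Omega> u = ennreal G"
    using mg by (simp add: max_gradient_point_def G_def g_def)
  have G: "G > 0" using grad_norm_pos[OF assms(1,2)] GN by simp
  define n where "n = g /\<^sub>R G"
  have n: "norm n = 1" using G by (simp add: n_def G_def)
  have gn: "x \<bullet> g = G * (x \<bullet> n)" for x using G by (simp add: n_def)
  have der: "(u has_derivative (\<lambda>h. h \<bullet> g)) (at p within closure \<Omega>)"
    unfolding g_def by (rule has_derivative_grad_closure[OF \<Omega>(1,2,4) pc diff])
  \<comment> \<open>The line through \<open>p\<close> orthogonal to the gradient supports \<open>\<Omega>\<close>: in directions pointing into \<open>\<Omega>\<close> the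
    derivative of the nonnegative function \<open>u\<close> at its zero \<open>p\<close> is nonnegative.\<close>
  have nonneg: "(x - p) \<bullet> n \<ge> 0" if x: "x \<in> closure \<Omega>" for x
  proof -
    have in_cl: "p + t *\<^sub>R (x - p) \<in> closure \<Omega>" if "0 < t" "t < 1" for t
    proof -
      have "(1 - t) *\<^sub>R p + t *\<^sub>R x \<in> closure \<Omega>"
        using pc x convex_closure[OF \<Omega>(2)] that by (intro convexD) auto
      then show ?thesis by (simp add: algebra_simps)
    qed
    have "u y \<ge> 0" if "y \<in> closure \<Omega>" for y
      using that torsion_function_pos[OF \<Omega>(1-3) assms(2), of y] bd[of y] \<Omega>(1)
      by (cases "y \<in> \<Omega>") (auto simp: frontier_def interior_open)
    then have "\<forall>\<^sub>F t in at_right 0. (u (p + t *\<^sub>R (x - p)) - u p) / t \<ge> 0"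
      using in_cl bd[OF p] by (auto simp: eventually_at_right_field intro!: exI[of _ 1])
    then have "(x - p) \<bullet> g \<ge> 0"
      using has_derivative_ray_tendsto[OF der, of 1 "x - p"] in_cl
      by (intro tendsto_lowerbound[of _ _ "at_right (0::real)"]) auto
    then show ?thesis unfolding gn using G by (simp add: zero_le_mult_iff)
  qed
  have pos: "(x - p) \<bullet> n > 0" if x: "x \<in> \<Omega>" for x
  proof -
    obtain s where s: "s > 0" "ball x s \<subseteq> \<Omega>" using \<Omega>(1) x by (meson openE)
    have "x - (s / 2) *\<^sub>R n \<in> ball x s" using s(1) n by (simp add: dist_norm)
    then have "x - (s / 2) *\<^sub>R n \<in> closure \<Omega>" using s(2) closure_subset by blast
    from nonneg[OF this] have "(x - p) \<bullet> n \<ge> s / 2"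
      using n by (simp add: inner_diff_left norm_eq_1)
    then show ?thesis using s(1) by simp
  qed
  obtain a b r f where "local_graph \<Omega> p a b r f" "Ck_on 2 {-r<..<r} f"
    using boundary_of_class_C2_graph[OF cls e p] by blast
  then obtain R where R: "R > 0" "ball (p + R *\<^sub>R n) R \<subseteq> \<Omega>"
    using interior_ball_at_C2_point[OF \<Omega>(1) p _ _ n pos] by blast
  \<comment> \<open>Another point on the support line would give a boundary segment from \<open>p\<close>, and with it infinitely
    many points of zero curvature close to \<open>p\<close>.\<close>
  have touch: "x = p" if x: "x \<in> closure \<Omega>" "(x - p) \<bullet> n = 0" for x
  proof (rule ccontr)
    assume "x \<noteq> p"
    define d where "d = x - p"
    have "d \<noteq> 0" using \<open>x \<noteq> p\<close> by (simp add: d_def)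
    have seg: "p + t *\<^sub>R d \<in> frontier \<Omega>" if "0 \<le> t" "t \<le> 1" for t
    proof -
      have "(1 - t) *\<^sub>R p + t *\<^sub>R x \<in> closure \<Omega>"
        using pc x convex_closure[OF \<Omega>(2)] that by (intro convexD) auto
      then have "p + t *\<^sub>R d \<in> closure \<Omega>" by (simp add: d_def algebra_simps)
      moreover have "p + t *\<^sub>R d \<notin> \<Omega>" using pos[of "p + t *\<^sub>R d"] x(2) by (auto simp: d_def)
      ultimately show ?thesis using \<Omega>(1) by (simp add: frontier_def interior_open)
    qed
    obtain s where s: "s > 0" "ball p s \<subseteq> U" using U by (meson openE)
    define T where "T = min 1 (s / norm d)"
    have T: "T > 0" "T \<le> 1" "T * norm d \<le> s"
      using s(1) \<open>d \<noteq> 0\<close> by (auto simp: T_def min_def field_simps)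
    have "(\<lambda>t. p + t *\<^sub>R d) ` {0<..<T} \<subseteq> {q \<in> U \<inter> frontier \<Omega>. has_boundary_curvature \<Omega> q 0}"
    proof (rule image_subsetI)
      fix t assume t: "t \<in> {0<..<T}"
      have "\<bar>t\<bar> * norm d < T * norm d" using t \<open>d \<noteq> 0\<close> by simp
      then have "p + t *\<^sub>R d \<in> U" using T(3) by (intro subsetD[OF s(2)]) (simp add: dist_norm)
      moreover have fr: "p + t *\<^sub>R d \<in> frontier \<Omega>" using t T by (intro seg) auto
      moreover have "has_boundary_curvature \<Omega> (p + t *\<^sub>R d) 0"
      proof (rule zero_curvature_on_segment[OF \<Omega>(1) fr cls e \<open>d \<noteq> 0\<close>])
        show "min t (T - t) > 0" using t by simp
        show "p + t *\<^sub>R d + \<tau> *\<^sub>R d \<in> frontier \<Omega>" if "\<bar>\<tau>\<bar> < min t (T - t)" for \<tau>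
        proof -
          have "0 \<le> t + \<tau>" "t + \<tau> \<le> 1" using that t T(2) by auto
          from seg[OF this] show ?thesis by (simp add: algebra_simps)
        qed
      qed
      ultimately show "p + t *\<^sub>R d \<in> {q \<in> U \<inter> frontier \<Omega>. has_boundary_curvature \<Omega> q 0}" by blast
    qed
    then have "finite ((\<lambda>t. p + t *\<^sub>R d) ` {0<..<T})" using fin finite_subset by blast
    moreover have "inj_on (\<lambda>t. p + t *\<^sub>R d) {0<..<T}" using \<open>d \<noteq> 0\<close> by (auto simp: inj_on_def)
    ultimately have "finite {0<..<T}" by (rule finite_imageD)
    then show False using T(1) by (simp add: infinite_Ioo)
  qed
  have ule: "u x \<le> G * ((x - p) \<bullet> n)" if "x \<in> \<Omega>" for x
    using torsion_function_le_of_grad_le[OF \<Omega>(1-3) assms(2) _ _ n, of G 0 p x]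
      grad_le_of_grad_norm_le[OF \<Omega>(1) C2, of G] GN G nonneg that by simp
  have lim: "((\<lambda>t. u (p + t *\<^sub>R n) / t) \<longlongrightarrow> G) (at_right 0)"
  proof -
    have "p + t *\<^sub>R n \<in> closure \<Omega>" if "0 < t" "t < 2 * R" for t
    proof -
      have "norm (p + R *\<^sub>R n - (p + t *\<^sub>R n)) < R"
        unfolding inner_along_normal(2)[OF n] using that by auto
      then have "p + t *\<^sub>R n \<in> ball (p + R *\<^sub>R n) R" by (simp only: mem_ball dist_norm)
      then show ?thesis using R(2) closure_subset by blast
    qed
    from has_derivative_ray_tendsto[OF der this] R(1)
    have "((\<lambda>t. (u (p + t *\<^sub>R n) - u p) / t) \<longlongrightarrow> n \<bullet> g) (at_right 0)" by simp
    then show ?thesis using bd[OF p] n by (simp add: gn norm_eq_1)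
  qed
  obtain \<delta> where dom': "bounded_convex_domain {x \<in> \<Omega>. (x - p) \<bullet> n > \<delta>}"
    and steep: "\<And>v. torsion_function {x \<in> \<Omega>. (x - p) \<bullet> n > \<delta>} v \<Longrightarrow>
       \<exists>x\<in>{x \<in> \<Omega>. (x - p) \<bullet> n > \<delta>}. G * ((x - p) \<bullet> n - \<delta>) < v x"
    using cut_torsion_function_steep[OF assms(1,2) n nonneg touch G ule lim R] by blast
  define \<Omega>' where "\<Omega>' = {x \<in> \<Omega>. (x - p) \<bullet> n > \<delta>}"
  have \<Omega>': "open \<Omega>'" "convex \<Omega>'" "bounded \<Omega>'"
    using dom' by (auto simp: bounded_convex_domain_def \<Omega>'_def)
  obtain v where v: "torsion_function \<Omega>' v"
    using torsion_function_exists[OF dom'] unfolding \<Omega>'_def by blast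
  \<comment> \<open>Maximality bounds the gradient of \<open>v\<close> by \<open>G\<close>, hence \<open>v\<close> by \<open>G\<close> times the height above the chord.\<close>
  then have "grad_norm \<Omega>' v \<le> ennreal G"
    using maximizer_grad_norm_subdomain[OF assms(1) dom' _ _ assms(3)] GN by (auto simp: \<Omega>'_def)
  then have "norm (grad v (at x)) \<le> G" if "x \<in> \<Omega>'" for x
    using grad_le_of_grad_norm_le[OF \<Omega>'(1) _ _ _ that] v G by (simp add: torsion_function_def)
  moreover have "\<delta> \<le> (y - p) \<bullet> n" if "y \<in> closure \<Omega>'" for y
  proof -
    have "closure \<Omega>' \<subseteq> {x. (x - p) \<bullet> n \<ge> \<delta>}"
    proof (rule closure_minimal)
      show "closed {x. (x - p) \<bullet> n \<ge> \<delta>}" by (intro closed_Collect_le continuous_intros)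
    qed (auto simp: \<Omega>'_def)
    then show ?thesis using that by blast
  qed
  ultimately have "v x \<le> G * ((x - p) \<bullet> n - \<delta>)" if "x \<in> \<Omega>'" for x
    using torsion_function_le_of_grad_le[OF \<Omega>' v _ _ n _ that] G by simp
  then show False using steep[of v] v unfolding \<Omega>'_def by force
qed

end
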